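(* Let $H$ be a Hopf algebra with bijective antipode over a field $\mathbf{k}$ and let $R$ be a Hopf algebra in the braided tensor category ${}^{H}_{H}\mathcal{YD}$ of Yetter-Drinfeld modules over $H$. If the coradical filtration of $R$ is finite, then $R$ is co-Frobenius.
   Context: All vector spaces, algebras, coalgebras and tensor products are over the field $\mathbf{k}$; all Hopf algebras (including braided ones) are assumed to have bijective antipode. A Yetter-Drinfeld module over $H$ is a vector space $V$ that is a left $H$-module and a left $H$-comodule (coaction $\rho(v)=v_{(-1)}\otimes v_{(0)}$) with $\rho(h\cdot v)=h_{(1)}v_{(-1)}\mathcal{S}(h_{(3)})\otimes h_{(2)}\cdot v_{(0)}$ for all $h\in H$, $v\in V$. The category ${}^{H}_{H}\mathcal{YD}$ of these is a braided tensor category with braiding $c(v\otimes w)=v_{(-1)}\cdot w\otimes v_{(0)}$. A Hopf algebra in ${}^{H}_{H}\mathcal{YD}$ (braided Hopf algebra) is a Hopf algebra object of this braided category; its coproduct is written $x\mapsto x^{(1)}\otimes x^{(2)}$. In particular $R$ has an underlying (ordinary) coalgebra, and $R^*=\operatorname{Hom}_{\mathbf{k}}(R,\mathbf{k})$ is the algebra with convolution product $(fg)(x)=f(x^{(1)})g(x^{(2)})$. A right integral on $R$ is $\lambda\in R^*$ with $\lambda f=f(1)\lambda$ for all $f\in R^*$; a left integral is $\lambda\in R^*$ with $f\lambda=f(1)\lambda$ for all $f\in R^*$. $R$ is right (resp. left) co-Frobenius if it admits a non-zero right (resp. left) integral; these two conditions are equivalent, and one says $R$ is co-Frobenius. The coradical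 filtration $(R_n)_{n\ge 0}$ of $R$ is that of its underlying coalgebra; it is finite if $R_n=R$ for some $n\ge 0$. *)

theory Defs
  imports Complex_Main "HOL-Library.Poly_Mapping"
begin

section \<open>Tensor products over a field\<close>

text \<open>
  A vector space over a field is a type with a scalar multiplication satisfying the library
  locale \<^locale>\<open>vector_space\<close>. The tensor product of two vector spaces is the free abelian
  group on pairs (finitely supported integer combinations, \<^const>\<open>frag_of\<close>) modulo the
  subgroup generated by the biadditivity and balancing relations; its elements are residue
  classes. The pure tensor of \<open>a\<close> and \<open>b\<close> is the class of \<open>frag_of (a, b)\<close>.
\<close>

inductive_set tensor_null ::
  "('k::field \<Rightarrow> 'a::ab_group_add \<Rightarrow> 'a) \<Rightarrow> ('k \<Rightarrow> 'b::ab_group_add \<Rightarrow> 'b) \<Rightarrow> ('a \<times> 'b \<Rightarrow>\<^sub>0 int) set"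
  for sA sB where
  zero: "0 \<in> tensor_null sA sB"
| diff: "p \<in> tensor_null sA sB \<Longrightarrow> q \<in> tensor_null sA sB \<Longrightarrow> p - q \<in> tensor_null sA sB"
| add1: "frag_of (a + a', b) - frag_of (a, b) - frag_of (a', b) \<in> tensor_null sA sB"
| add2: "frag_of (a, b + b') - frag_of (a, b) - frag_of (a, b') \<in> tensor_null sA sB"
| balance: "frag_of (sA c a, b) - frag_of (a, sB c b) \<in> tensor_null sA sB"

definition tensor_rel ::
  "('k::field \<Rightarrow> 'a::ab_group_add \<Rightarrow> 'a) \<Rightarrow> ('k \<Rightarrow> 'b::ab_group_add \<Rightarrow> 'b)
    \<Rightarrow> (('a \<times> 'b \<Rightarrow>\<^sub>0 int) \<times> ('a \<times> 'b \<Rightarrow>\<^sub>0 int)) set"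
  where "tensor_rel sA sB = {(p, q). p - q \<in> tensor_null sA sB}"

definition tensor_class ::
  "('k::field \<Rightarrow> 'a::ab_group_add \<Rightarrow> 'a) \<Rightarrow> ('k \<Rightarrow> 'b::ab_group_add \<Rightarrow> 'b)
    \<Rightarrow> ('a \<times> 'b \<Rightarrow>\<^sub>0 int) \<Rightarrow> ('a \<times> 'b \<Rightarrow>\<^sub>0 int) set"
  where "tensor_class sA sB p = tensor_rel sA sB `` {p}"

definition tensor ::
  "('k::field \<Rightarrow> 'a::ab_group_add \<Rightarrow> 'a) \<Rightarrow> ('k \<Rightarrow> 'b::ab_group_add \<Rightarrow> 'b)
    \<Rightarrow> ('a \<times> 'b \<Rightarrow>\<^sub>0 int) set set"
  where "tensor sA sB = UNIV // tensor_rel sA sB"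

text \<open>Triple tensor products, constructed in the same way without bracketing.\<close>

inductive_set tensor3_null ::
  "('k::field \<Rightarrow> 'a::ab_group_add \<Rightarrow> 'a) \<Rightarrow> ('k \<Rightarrow> 'b::ab_group_add \<Rightarrow> 'b)
    \<Rightarrow> ('k \<Rightarrow> 'c::ab_group_add \<Rightarrow> 'c) \<Rightarrow> ('a \<times> 'b \<times> 'c \<Rightarrow>\<^sub>0 int) set"
  for sA sB sC where
  zero: "0 \<in> tensor3_null sA sB sC"
| diff: "p \<in> tensor3_null sA sB sC \<Longrightarrow> q \<in> tensor3_null sA sB sC \<Longrightarrow> p - q \<in> tensor3_null sA sB sC"
| add1: "frag_of (a + a', b, d) - frag_of (a, b, d) - frag_of (a', b, d) \<in> tensor3_null sA sB sC"
| add2: "frag_of (a, b + b', d) - frag_of (a, b, d) - frag_of (a, b', d) \<in> tensor3_null sA sB sC"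
| add3: "frag_of (a, b, d + d') - frag_of (a, b, d) - frag_of (a, b, d') \<in> tensor3_null sA sB sC"
| balance12: "frag_of (sA c a, b, d) - frag_of (a, sB c b, d) \<in> tensor3_null sA sB sC"
| balance23: "frag_of (a, sB c b, d) - frag_of (a, b, sC c d) \<in> tensor3_null sA sB sC"

definition tensor3_class ::
  "('k::field \<Rightarrow> 'a::ab_group_add \<Rightarrow> 'a) \<Rightarrow> ('k \<Rightarrow> 'b::ab_group_add \<Rightarrow> 'b)
    \<Rightarrow> ('k \<Rightarrow> 'c::ab_group_add \<Rightarrow> 'c) \<Rightarrow> ('a \<times> 'b \<times> 'c \<Rightarrow>\<^sub>0 int)
    \<Rightarrow> ('a \<times> 'b \<times> 'c \<Rightarrow>\<^sub>0 int) set"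
  where "tensor3_class sA sB sC p = {(p, q). p - q \<in> tensor3_null sA sB sC} `` {p}"

text \<open>
  Sweedler notation. A tensor \<open>T\<close> is written as a formal sum of pure tensors by picking a
  representative. \<open>sweedler T (\<lambda>(a, b). e)\<close> substitutes the formal sum \<open>e\<close> for each summand
  \<open>(a, b)\<close>; it is only used where the class of \<open>e\<close> in the target tensor product is bilinear in
  \<open>(a, b)\<close>, so that the class of the result does not depend on the representative.
  Likewise \<open>contract s f T\<close> is the value at \<open>T\<close> of the linear map induced by a bilinear map
  \<open>f\<close> into the vector space with scalar multiplication \<open>s\<close>.
\<close>

definition tensor_rep :: "('t \<Rightarrow>\<^sub>0 int) set \<Rightarrow> ('t \<Rightarrow>\<^sub>0 int)"
  where "tensor_rep T = (SOME p. p \<in> T)"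

definition sweedler :: "('t \<Rightarrow>\<^sub>0 int) set \<Rightarrow> ('t \<Rightarrow> ('u \<Rightarrow>\<^sub>0 int)) \<Rightarrow> ('u \<Rightarrow>\<^sub>0 int)"
  where "sweedler T f = frag_extend f (tensor_rep T)"

definition contract ::
  "('k::field \<Rightarrow> 'v::ab_group_add \<Rightarrow> 'v) \<Rightarrow> ('t \<Rightarrow> 'v) \<Rightarrow> ('t \<Rightarrow>\<^sub>0 int) set \<Rightarrow> 'v"
  where "contract s f T =
    (\<Sum>t\<in>Poly_Mapping.keys (tensor_rep T). s (of_int (Poly_Mapping.lookup (tensor_rep T) t)) (f t))"

definition tensor_linear ::
  "('k::field \<Rightarrow> 'v::ab_group_add \<Rightarrow> 'v) \<Rightarrow> ('k \<Rightarrow> 'a::ab_group_add \<Rightarrow> 'a)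
    \<Rightarrow> ('k \<Rightarrow> 'b::ab_group_add \<Rightarrow> 'b) \<Rightarrow> ('v \<Rightarrow> ('a \<times> 'b \<Rightarrow>\<^sub>0 int) set) \<Rightarrow> bool"
  where "tensor_linear sV sA sB F \<longleftrightarrow>
    (\<forall>x. F x \<in> tensor sA sB) \<and>
    (\<forall>x y. F (x + y) = tensor_class sA sB (tensor_rep (F x) + tensor_rep (F y))) \<and>
    (\<forall>c x. F (sV c x) = tensor_class sA sB (sweedler (F x) (\<lambda>(a, b). frag_of (sA c a, b))))"


section \<open>Algebras, coalgebras, Hopf algebras\<close>

text \<open>
  Algebras live on types of class \<^class>\<open>ring_1\<close>. This class demands \<open>0 \<noteq> 1\<close>, which is no
  restriction for (braided) Hopf algebras, since the counit sends the unit to \<open>1\<close>.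
\<close>

locale unital_algebra = vector_space scale
  for scale :: "'k::field \<Rightarrow> 'a::ring_1 \<Rightarrow> 'a" +
  assumes scale_mult_left: "scale c x * y = scale c (x * y)"
    and scale_mult_right: "x * scale c y = scale c (x * y)"

locale coalgebra = vector_space scale
  for scale :: "'k::field \<Rightarrow> 'a::ab_group_add \<Rightarrow> 'a" +
  fixes comul :: "'a \<Rightarrow> ('a \<times> 'a \<Rightarrow>\<^sub>0 int) set"
    and counit :: "'a \<Rightarrow> 'k"
  assumes comul_linear: "tensor_linear scale scale scale comul"
    and counit_linear: "Vector_Spaces.linear scale (*) counit"
    and comul_coassoc:
      "tensor3_class scale scale scale
          (sweedler (comul x) (\<lambda>(a, b). sweedler (comul a) (\<lambda>(a1, a2). frag_of (a1, a2, b)))) =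
       tensor3_class scale scale scale
          (sweedler (comul x) (\<lambda>(a, b). sweedler (comul b) (\<lambda>(b1, b2). frag_of (a, b1, b2))))"
    and counit_left: "contract scale (\<lambda>(a, b). scale (counit a) b) (comul x) = x"
    and counit_right: "contract scale (\<lambda>(a, b). scale (counit b) a) (comul x) = x"

locale hopf_algebra = unital_algebra scale + coalgebra scale comul counit
  for scale :: "'k::field \<Rightarrow> 'a::ring_1 \<Rightarrow> 'a"
    and comul :: "'a \<Rightarrow> ('a \<times> 'a \<Rightarrow>\<^sub>0 int) set"
    and counit :: "'a \<Rightarrow> 'k" +
  fixes antipode :: "'a \<Rightarrow> 'a"
  assumes comul_mult:
      "comul (x * y) = tensor_class scale scale
         (sweedler (comul x) (\<lambda>(a, b). sweedler (comul y) (\<lambda>(c, d). frag_of (a * c, b * d))))"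
    and comul_one: "comul 1 = tensor_class scale scale (frag_of (1, 1))"
    and counit_mult: "counit (x * y) = counit x * counit y"
    and counit_one: "counit 1 = 1"
    and antipode_linear: "Vector_Spaces.linear scale scale antipode"
    and antipode_left: "contract scale (\<lambda>(a, b). antipode a * b) (comul x) = scale (counit x) 1"
    and antipode_right: "contract scale (\<lambda>(a, b). a * antipode b) (comul x) = scale (counit x) 1"


section \<open>Yetter--Drinfeld modules and braided Hopf algebras\<close>

locale yetter_drinfeld_module =
  H: hopf_algebra sH comulH counitH antipodeH + V: vector_space sV
  for sH :: "'k::field \<Rightarrow> 'h::ring_1 \<Rightarrow> 'h"
    and comulH :: "'h \<Rightarrow> ('h \<times> 'h \<Rightarrow>\<^sub>0 int) set"
    and counitH :: "'h \<Rightarrow> 'k"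
    and antipodeH :: "'h \<Rightarrow> 'h"
    and sV :: "'k \<Rightarrow> 'v::ab_group_add \<Rightarrow> 'v" +
  fixes act :: "'h \<Rightarrow> 'v \<Rightarrow> 'v"
    and coact :: "'v \<Rightarrow> ('h \<times> 'v \<Rightarrow>\<^sub>0 int) set"
  assumes act_linear: "Vector_Spaces.linear sV sV (act h)"
    and act_linear_left: "Vector_Spaces.linear sH sV (\<lambda>h. act h v)"
    and act_one: "act 1 v = v"
    and act_mult: "act (g * h) v = act g (act h v)"
    and coact_linear: "tensor_linear sV sH sV coact"
    and coact_coassoc:
      "tensor3_class sH sH sV
          (sweedler (coact v) (\<lambda>(h, w). sweedler (comulH h) (\<lambda>(h1, h2). frag_of (h1, h2, w)))) =
       tensor3_class sH sH sV
          (sweedler (coact v) (\<lambda>(h, w). sweedler (coact w) (\<lambda>(g, u). frag_of (h, g, u))))"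
    and coact_counit: "contract sV (\<lambda>(h, w). sV (counitH h) w) (coact v) = v"
    and yetter_drinfeld:
      "coact (act h v) = tensor_class sH sV
         (sweedler (comulH h) (\<lambda>(h1, h').
          sweedler (comulH h') (\<lambda>(h2, h3).
          sweedler (coact v) (\<lambda>(g, w). frag_of (h1 * g * antipodeH h3, act h2 w)))))"

definition braiding ::
  "('h \<Rightarrow> 'w \<Rightarrow> 'w) \<Rightarrow> ('v \<Rightarrow> ('h \<times> 'v \<Rightarrow>\<^sub>0 int) set) \<Rightarrow> 'v \<Rightarrow> 'w \<Rightarrow> ('w \<times> 'v \<Rightarrow>\<^sub>0 int)"
  where "braiding act coact v w = sweedler (coact v) (\<lambda>(h, v0). frag_of (act h w, v0))"

text \<open>
  A Hopf algebra object in the category of Yetter--Drinfeld modules: the unit, multiplication,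
  counit, comultiplication and antipode are morphisms of modules and of comodules (tensor
  products carry the diagonal action and the codiagonal coaction, the ground field the trivial
  ones), and the counit and the comultiplication are algebra maps, where the tensor square of
  \<open>R\<close> has the multiplication twisted by the braiding.
\<close>

locale braided_hopf_algebra =
  yetter_drinfeld_module sH comulH counitH antipodeH sR act coact +
  R: unital_algebra sR + R: coalgebra sR comul counit
  for sH :: "'k::field \<Rightarrow> 'h::ring_1 \<Rightarrow> 'h"
    and comulH :: "'h \<Rightarrow> ('h \<times> 'h \<Rightarrow>\<^sub>0 int) set"
    and counitH :: "'h \<Rightarrow> 'k"
    and antipodeH :: "'h \<Rightarrow> 'h"
    and sR :: "'k \<Rightarrow> 'r::ring_1 \<Rightarrow> 'r"
    and act :: "'h \<Rightarrow> 'r \<Rightarrow> 'r"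
    and coact :: "'r \<Rightarrow> ('h \<times> 'r \<Rightarrow>\<^sub>0 int) set"
    and comul :: "'r \<Rightarrow> ('r \<times> 'r \<Rightarrow>\<^sub>0 int) set"
    and counit :: "'r \<Rightarrow> 'k" +
  fixes antipode :: "'r \<Rightarrow> 'r"
  assumes unit_act: "act h 1 = sR (counitH h) 1"
    and unit_coact: "coact 1 = tensor_class sH sR (frag_of (1, 1))"
    and mult_act: "act h (x * y) = contract sR (\<lambda>(h1, h2). act h1 x * act h2 y) (comulH h)"
    and mult_coact:
      "coact (x * y) = tensor_class sH sR
         (sweedler (coact x) (\<lambda>(g, x0). sweedler (coact y) (\<lambda>(h, y0). frag_of (g * h, x0 * y0))))"
    and counit_act: "counit (act h x) = counitH h * counit x"
    and counit_coact: "contract sH (\<lambda>(h, x0). sH (counit x0) h) (coact x) = sH (counit x) 1"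
    and comul_act:
      "comul (act h x) = tensor_class sR sR
         (sweedler (comulH h) (\<lambda>(h1, h2). sweedler (comul x) (\<lambda>(a, b). frag_of (act h1 a, act h2 b))))"
    and comul_coact:
      "tensor3_class sH sR sR
          (sweedler (coact x) (\<lambda>(h, x0). sweedler (comul x0) (\<lambda>(a, b). frag_of (h, a, b)))) =
       tensor3_class sH sR sR
          (sweedler (comul x) (\<lambda>(a, b).
           sweedler (coact a) (\<lambda>(g, a0). sweedler (coact b) (\<lambda>(h, b0). frag_of (g * h, a0, b0)))))"
    and comul_mult:
      "comul (x * y) = tensor_class sR sR
         (sweedler (comul x) (\<lambda>(a, b). sweedler (comul y) (\<lambda>(c, d).
            frag_extend (\<lambda>(c', b'). frag_of (a * c', b' * d)) (braiding act coact b c))))"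
    and comul_one: "comul 1 = tensor_class sR sR (frag_of (1, 1))"
    and counit_mult: "counit (x * y) = counit x * counit y"
    and counit_one: "counit 1 = 1"
    and antipode_linear: "Vector_Spaces.linear sR sR antipode"
    and antipode_act: "antipode (act h x) = act h (antipode x)"
    and antipode_coact:
      "coact (antipode x) = tensor_class sH sR (sweedler (coact x) (\<lambda>(h, x0). frag_of (h, antipode x0)))"
    and antipode_left: "contract sR (\<lambda>(a, b). antipode a * b) (comul x) = sR (counit x) 1"
    and antipode_right: "contract sR (\<lambda>(a, b). a * antipode b) (comul x) = sR (counit x) 1"


section \<open>Coradical filtration\<close>

definition subcoalgebra ::
  "('k::field \<Rightarrow> 'a::ab_group_add \<Rightarrow> 'a) \<Rightarrow> ('a \<Rightarrow> ('a \<times> 'a \<Rightarrow>\<^sub>0 int) set) \<Rightarrow> 'a set \<Rightarrow> bool"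
  where "subcoalgebra s comul D \<longleftrightarrow>
    module.subspace s D \<and> (\<forall>x\<in>D. \<exists>p\<in>comul x. Poly_Mapping.keys p \<subseteq> D \<times> D)"

definition simple_subcoalgebra ::
  "('k::field \<Rightarrow> 'a::ab_group_add \<Rightarrow> 'a) \<Rightarrow> ('a \<Rightarrow> ('a \<times> 'a \<Rightarrow>\<^sub>0 int) set) \<Rightarrow> 'a set \<Rightarrow> bool"
  where "simple_subcoalgebra s comul D \<longleftrightarrow>
    subcoalgebra s comul D \<and> D \<noteq> {0} \<and>
    (\<forall>E. subcoalgebra s comul E \<and> E \<subseteq> D \<longrightarrow> E = {0} \<or> E = D)"

definition coradical ::
  "('k::field \<Rightarrow> 'a::ab_group_add \<Rightarrow> 'a) \<Rightarrow> ('a \<Rightarrow> ('a \<times> 'a \<Rightarrow>\<^sub>0 int) set) \<Rightarrow> 'a set"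
  where "coradical s comul = module.span s (\<Union>{D. simple_subcoalgebra s comul D})"

text \<open>
  For subspaces \<open>X\<close> and \<open>Y\<close> of the coalgebra \<open>C\<close> this is the wedge
  \<open>\<Delta>\<^sup>-\<^sup>1(X \<otimes> C + C \<otimes> Y)\<close>.
\<close>

definition wedge :: "('a \<Rightarrow> ('a \<times> 'a \<Rightarrow>\<^sub>0 int) set) \<Rightarrow> 'a set \<Rightarrow> 'a set \<Rightarrow> 'a set"
  where "wedge comul X Y = {x. \<exists>p\<in>comul x. Poly_Mapping.keys p \<subseteq> X \<times> UNIV \<union> UNIV \<times> Y}"

primrec coradical_filtration ::
  "('k::field \<Rightarrow> 'a::ab_group_add \<Rightarrow> 'a) \<Rightarrow> ('a \<Rightarrow> ('a \<times> 'a \<Rightarrow>\<^sub>0 int) set) \<Rightarrow> nat \<Rightarrow> 'a set"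
  where
    "coradical_filtration s comul 0 = coradical s comul"
  | "coradical_filtration s comul (Suc n) =
       wedge comul (coradical s comul) (coradical_filtration s comul n)"

definition finite_coradical_filtration ::
  "('k::field \<Rightarrow> 'a::ab_group_add \<Rightarrow> 'a) \<Rightarrow> ('a \<Rightarrow> ('a \<times> 'a \<Rightarrow>\<^sub>0 int) set) \<Rightarrow> bool"
  where "finite_coradical_filtration s comul \<longleftrightarrow> (\<exists>n. coradical_filtration s comul n = UNIV)"


section \<open>Integrals\<close>

definition convolution ::
  "('a \<Rightarrow> ('a \<times> 'a \<Rightarrow>\<^sub>0 int) set) \<Rightarrow> ('a \<Rightarrow> 'k::field) \<Rightarrow> ('a \<Rightarrow> 'k) \<Rightarrow> 'a \<Rightarrow> 'k"
  where "convolution comul f g x = contract (*) (\<lambda>(a, b). f a * g b) (comul x)"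

definition right_integral ::
  "('k::field \<Rightarrow> 'a::ring_1 \<Rightarrow> 'a) \<Rightarrow> ('a \<Rightarrow> ('a \<times> 'a \<Rightarrow>\<^sub>0 int) set) \<Rightarrow> ('a \<Rightarrow> 'k) \<Rightarrow> bool"
  where "right_integral s comul l \<longleftrightarrow> Vector_Spaces.linear s (*) l \<and>
    (\<forall>f. Vector_Spaces.linear s (*) f \<longrightarrow> convolution comul l f = (\<lambda>x. f 1 * l x))"

definition left_integral ::
  "('k::field \<Rightarrow> 'a::ring_1 \<Rightarrow> 'a) \<Rightarrow> ('a \<Rightarrow> ('a \<times> 'a \<Rightarrow>\<^sub>0 int) set) \<Rightarrow> ('a \<Rightarrow> 'k) \<Rightarrow> bool"
  where "left_integral s comul l \<longleftrightarrow> Vector_Spaces.linear s (*) l \<and>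
    (\<forall>f. Vector_Spaces.linear s (*) f \<longrightarrow> convolution comul f l = (\<lambda>x. f 1 * l x))"

definition right_co_frobenius ::
  "('k::field \<Rightarrow> 'a::ring_1 \<Rightarrow> 'a) \<Rightarrow> ('a \<Rightarrow> ('a \<times> 'a \<Rightarrow>\<^sub>0 int) set) \<Rightarrow> bool"
  where "right_co_frobenius s comul \<longleftrightarrow> (\<exists>l. right_integral s comul l \<and> l \<noteq> (\<lambda>x. 0))"

definition left_co_frobenius ::
  "('k::field \<Rightarrow> 'a::ring_1 \<Rightarrow> 'a) \<Rightarrow> ('a \<Rightarrow> ('a \<times> 'a \<Rightarrow>\<^sub>0 int) set) \<Rightarrow> bool"
  where "left_co_frobenius s comul \<longleftrightarrow> (\<exists>l. left_integral s comul l \<and> l \<noteq> (\<lambda>x. 0))"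

text \<open>
  For a braided Hopf algebra with bijective antipode the two one-sided conditions are
  equivalent. The conjunction is used so that no side has to be preferred.
\<close>

definition co_frobenius ::
  "('k::field \<Rightarrow> 'a::ring_1 \<Rightarrow> 'a) \<Rightarrow> ('a \<Rightarrow> ('a \<times> 'a \<Rightarrow>\<^sub>0 int) set) \<Rightarrow> bool"
  where "co_frobenius s comul \<longleftrightarrow> right_co_frobenius s comul \<and> left_co_frobenius s comul"

end

theory Submission
  imports Defs
begin

text \<open>
  Let \<open>J\<close> be the annihilator of the coradical in the convolution algebra \<open>R\<^sup>*\<close>. If the coradical
  filtration is finite, then \<open>J\<close> is nilpotent, and a non-zero product \<open>f\<close> of as many elements of \<open>J\<close>
  as possible satisfies \<open>J f = f J = 0\<close>. The equation \<open>J f = 0\<close> says that the comodule map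
  \<open>x \<mapsto> x\<^sub>1 f(x\<^sub>2)\<close> has its image in the coradical. Multiplying \<open>f\<close> from the left by a form that lives
  on a single simple subcoalgebra makes this image finite-dimensional
  (\<open>finite_image_functional\<close>). So \<open>R\<close> has a non-zero comodule map \<open>G\<close> into a finite-dimensional left
  coideal \<open>V\<close> of \<open>R\<close>, and \<open>V\<close> can be enlarged to an \<open>H\<close>-subcomodule that is still a
  finite-dimensional left coideal (\<open>coaction_hull\<close>).

  For an ordinary Hopf algebra the rest is the standard argument that \<open>Hom(R, V)\<close> is
  \<open>Hom(V\<^sup>* \<otimes> R, k)\<close> and that \<open>V\<^sup>* \<otimes> R\<close> is a free comodule. In the braided case \<open>V\<close> is a comodule over
  the bosonization \<open>A = R # H\<close>, which acts on \<open>R\<close> by left multiplication and the given action, and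
  this makes \<open>R\<close> a module coalgebra over \<open>A\<close>; hence comodules over \<open>R\<close> may be tensored with comodules
  over \<open>A\<close>, and the same argument applies. In coordinates: let \<open>a\<^sub>i\<^sub>j\<close> be the coefficients of the
  coaction of \<open>A\<close> on \<open>V\<close>, let \<open>c\<^sub>i\<^sub>j\<close> and \<open>b\<^sub>i\<^sub>j\<close> be their images under the first and the second power of
  the inverse antipode of \<open>A\<close>, and let \<open>G\<^sub>i\<close> be the coordinates of \<open>G\<close>. Then every form
  \<open>l\<^sub>j(x) = \<Sum>\<^sub>i G\<^sub>i(b\<^sub>i\<^sub>j x)\<close> is a left integral, and one of them is non-zero because the matrix \<open>b\<close> is
  invertible (\<open>twisted_integral\<close>).

  The algebra \<open>A\<close> enters only through the operators on \<open>R\<close> by which \<open>a\<close>, \<open>b\<close>, \<open>c\<close> act, and the argument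
  rests on three properties of them: \<open>a\<close> is compatible with the comultiplication, the
  transpose of \<open>c\<close> is inverse to the transpose of \<open>a\<close>, and \<open>b\<close> is inverse to \<open>c\<close>. The compatibility of
  \<open>c\<close> and \<open>b\<close> with the comultiplication follows by inverting matrices (\<open>comatrix_inverse\<close>), which
  takes the place of the formula for the comultiplication of an antipode. The matrices are computed in
  \<open>left_matrix\<close>. Right integrals arise in the same way from a right coideal \<open>V\<close>, with the antipode of
  \<open>A\<close> in place of its inverse (\<open>right_matrix\<close>). The only structural fact about antipodes that enters is
  that they reverse products, up to the braiding (\<open>antipode_mult\<close>, \<open>SRi_mult\<close>).
\<close>

section \<open>Multilinear maps and sums over lists of pairs\<close>

named_theorems lin_intros

text \<open>
  Linearity without the requirement that both sides are vector spaces. This makes it closed under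
  composition unconditionally, so that linearity of nested Sweedler sums can be decided by
  resolution with \<open>lin_intros\<close>.
\<close>
definition lin :: "('k \<Rightarrow> 'a::plus \<Rightarrow> 'a) \<Rightarrow> ('k \<Rightarrow> 'b::plus \<Rightarrow> 'b) \<Rightarrow> ('a \<Rightarrow> 'b) \<Rightarrow> bool"
  where "lin s t f \<longleftrightarrow> (\<forall>x y. f (x + y) = f x + f y) \<and> (\<forall>c x. f (s c x) = t c (f x))"

definition bilin ::
  "('k \<Rightarrow> 'a::plus \<Rightarrow> 'a) \<Rightarrow> ('k \<Rightarrow> 'b::plus \<Rightarrow> 'b) \<Rightarrow> ('k \<Rightarrow> 'v::plus \<Rightarrow> 'v) \<Rightarrow> ('a \<Rightarrow> 'b \<Rightarrow> 'v) \<Rightarrow> bool"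
  where "bilin s1 s2 t F \<longleftrightarrow> (\<forall>b. lin s1 t (\<lambda>a. F a b)) \<and> (\<forall>a. lin s2 t (\<lambda>b. F a b))"

definition trilin ::
  "('k \<Rightarrow> 'a::plus \<Rightarrow> 'a) \<Rightarrow> ('k \<Rightarrow> 'b::plus \<Rightarrow> 'b) \<Rightarrow> ('k \<Rightarrow> 'c::plus \<Rightarrow> 'c) \<Rightarrow> ('k \<Rightarrow> 'v::plus \<Rightarrow> 'v)
    \<Rightarrow> ('a \<Rightarrow> 'b \<Rightarrow> 'c \<Rightarrow> 'v) \<Rightarrow> bool"
  where "trilin s1 s2 s3 t F \<longleftrightarrow> (\<forall>b c. lin s1 t (\<lambda>a. F a b c)) \<and> (\<forall>a c. lin s2 t (\<lambda>b. F a b c))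
    \<and> (\<forall>a b. lin s3 t (\<lambda>c. F a b c))"

text \<open>
  The Sweedler sum: a list of pairs stands for the sum of the corresponding pure tensors, and \<open>ssum\<close>
  evaluates the linear map that a bilinear \<open>F\<close> induces on the tensor product.
\<close>
definition ssum :: "('a \<times> 'b) list \<Rightarrow> ('a \<Rightarrow> 'b \<Rightarrow> 'v::comm_monoid_add) \<Rightarrow> 'v"
  where "ssum L F = (\<Sum>(a, b)\<leftarrow>L. F a b)"

lemma sum_swap_inner: "(\<Sum>i\<in>A. \<Sum>j\<in>B. \<Sum>k\<in>C. f i j k) = (\<Sum>i\<in>A. \<Sum>k\<in>C. \<Sum>j\<in>B. f i j k)"
  by (rule sum.cong[OF refl], rule sum.swap)

lemma sum_rotate3: "(\<Sum>i\<in>A. \<Sum>j\<in>B. \<Sum>k\<in>C. f i j k) = (\<Sum>j\<in>B. \<Sum>k\<in>C. \<Sum>i\<in>A. f i j k)"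
  by (subst sum.swap, rule sum_swap_inner)

lemma sum_rotate4:
  "(\<Sum>i\<in>A. \<Sum>j\<in>B. \<Sum>k\<in>C. \<Sum>l\<in>D. f i j k l) = (\<Sum>j\<in>B. \<Sum>k\<in>C. \<Sum>l\<in>D. \<Sum>i\<in>A. f i j k l)"
  by (subst sum.swap, rule sum.cong[OF refl], rule sum_rotate3)

lemma sum_swap_pairs:
  "(\<Sum>i\<in>A. \<Sum>j\<in>B. \<Sum>k\<in>C. \<Sum>l\<in>D. f i j k l) = (\<Sum>k\<in>C. \<Sum>l\<in>D. \<Sum>i\<in>A. \<Sum>j\<in>B. f i j k l)"
  by (subst sum_rotate4, rule sum_rotate4)

lemma bilinI [lin_intros]:
  "(\<And>b. lin s1 t (\<lambda>a. F a b)) \<Longrightarrow> (\<And>a. lin s2 t (\<lambda>b. F a b)) \<Longrightarrow> bilin s1 s2 t F"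
  by (simp add: bilin_def)

lemma trilinI [lin_intros]:
  "(\<And>b c. lin s1 t (\<lambda>a. F a b c)) \<Longrightarrow> (\<And>a c. lin s2 t (\<lambda>b. F a b c)) \<Longrightarrow>
   (\<And>a b. lin s3 t (\<lambda>c. F a b c)) \<Longrightarrow> trilin s1 s2 s3 t F"
  by (simp add: trilin_def)

lemma bilin_left: "bilin s1 s2 t F \<Longrightarrow> lin s1 t (\<lambda>a. F a b)"
  and bilin_right: "bilin s1 s2 t F \<Longrightarrow> lin s2 t (\<lambda>b. F a b)"
  by (simp_all add: bilin_def)

lemma lin_id [lin_intros]: "lin s s (\<lambda>x. x)"
  by (simp add: lin_def)

lemma lin_comp: "lin t u f \<Longrightarrow> lin s t g \<Longrightarrow> lin s u (\<lambda>x. f (g x))"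
  by (simp add: lin_def)

lemma bilin_comp_left: "bilin s1 s2 t F \<Longrightarrow> lin s s1 g \<Longrightarrow> lin s t (\<lambda>x. F (g x) b)"
  by (simp add: lin_def bilin_def)

lemma bilin_comp_right: "bilin s1 s2 t F \<Longrightarrow> lin s s2 g \<Longrightarrow> lin s t (\<lambda>x. F a (g x))"
  by (simp add: lin_def bilin_def)

lemma trilin_comp1: "trilin s1 s2 s3 t F \<Longrightarrow> lin s s1 g \<Longrightarrow> lin s t (\<lambda>x. F (g x) b c)"
  by (simp add: lin_def trilin_def)

lemma trilin_comp2: "trilin s1 s2 s3 t F \<Longrightarrow> lin s s2 g \<Longrightarrow> lin s t (\<lambda>x. F a (g x) c)"
  by (simp add: lin_def trilin_def)

lemma trilin_comp3: "trilin s1 s2 s3 t F \<Longrightarrow> lin s s3 g \<Longrightarrow> lin s t (\<lambda>x. F a b (g x))"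
  by (simp add: lin_def trilin_def)

lemmas trilin_comps = trilin_comp1 trilin_comp2 trilin_comp3
lemmas bilin_comps = bilin_comp_left bilin_comp_right

lemma lin_add: "lin s t f \<Longrightarrow> f (x + y) = f x + f y"
  and lin_scale: "lin s t f \<Longrightarrow> f (s c x) = t c (f x)"
  by (simp_all add: lin_def)

lemma lin_zero: "lin s t f \<Longrightarrow> f 0 = 0"
  for s :: "'k \<Rightarrow> 'a::ab_group_add \<Rightarrow> 'a" and t :: "'k \<Rightarrow> 'b::ab_group_add \<Rightarrow> 'b"
  using lin_add[of s t f 0 0] by simp

lemma lin_diff: "lin s t f \<Longrightarrow> f (x - y) = f x - f y"
  for s :: "'k \<Rightarrow> 'a::ab_group_add \<Rightarrow> 'a" and t :: "'k \<Rightarrow> 'b::ab_group_add \<Rightarrow> 'b"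
  using lin_add[of s t f "x - y" y] by simp

lemma lin_sum: "lin s t f \<Longrightarrow> f (\<Sum>i\<in>I. g i) = (\<Sum>i\<in>I. f (g i))"
  for s :: "'k \<Rightarrow> 'a::ab_group_add \<Rightarrow> 'a" and t :: "'k \<Rightarrow> 'b::ab_group_add \<Rightarrow> 'b"
  by (induction I rule: infinite_finite_induct) (simp_all add: lin_zero lin_add)

lemma ssum_Nil [simp]: "ssum [] F = 0"
  and ssum_Cons [simp]: "ssum ((a, b) # L) F = F a b + ssum L F"
  by (simp_all add: ssum_def)

lemma lin_ssum_out: "lin s t f \<Longrightarrow> f (ssum L F) = ssum L (\<lambda>a b. f (F a b))"
  for s :: "'k \<Rightarrow> 'a::ab_group_add \<Rightarrow> 'a" and t :: "'k \<Rightarrow> 'b::ab_group_add \<Rightarrow> 'b"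
  by (induction L) (auto simp: lin_zero lin_add)

lemma ssum_add: "ssum L (\<lambda>a b. F a b + G a b) = ssum L F + ssum L G"
  by (induction L) (auto simp: algebra_simps)

lemma ssum_diff: "ssum L (\<lambda>a b. F a b - G a b) = ssum L F - (ssum L G :: 'v::ab_group_add)"
  by (induction L) (auto simp: algebra_simps)

lemma ssum_zero [simp]: "ssum L (\<lambda>a b. 0) = 0"
  by (induction L) auto

lemma ssum_sum: "ssum L (\<lambda>a b. \<Sum>i\<in>I. F i a b) = (\<Sum>i\<in>I. ssum L (F i))"
  by (induction L) (auto simp: sum.distrib)

lemma ssum_swap: "ssum L (\<lambda>a b. ssum M (\<lambda>c d. F a b c d)) = ssum M (\<lambda>c d. ssum L (\<lambda>a b. F a b c d))"
  by (induction L) (auto simp: ssum_add)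

lemma ssum_cong: "(\<And>a b. (a, b) \<in> set L \<Longrightarrow> F a b = G a b) \<Longrightarrow> ssum L F = ssum L G"
  by (induction L) auto

lemma ssum_flip: "ssum (map prod.swap L) F = ssum L (\<lambda>a b. F b a)"
  by (induction L) auto

lemma vector_space_field [lin_intros]: "vector_space ((*) :: 'k::field \<Rightarrow> 'k \<Rightarrow> 'k)"
  by unfold_locales (simp_all add: algebra_simps)

lemma linear_iff_lin:
  assumes "vector_space s" "vector_space t"
  shows "Vector_Spaces.linear s t f \<longleftrightarrow> lin s t f"
  using assms by (simp add: Vector_Spaces.linear_iff lin_def)

lemma linear_imp_lin: "Vector_Spaces.linear s t f \<Longrightarrow> lin s t f"
  by (simp add: Vector_Spaces.linear_iff lin_def)

lemma lin_ssum [lin_intros]: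
  assumes "vector_space t" "\<And>a b. lin s t (\<lambda>x. F x a b)"
  shows "lin s t (\<lambda>x. ssum L (F x))"
proof -
  interpret t: vector_space t by fact
  show ?thesis
    using assms(2) by (induction L) (auto simp: lin_def t.scale_right_distrib algebra_simps)
qed

lemma lin_sum_fun [lin_intros]:
  assumes "vector_space t" "\<And>i. lin s t (\<lambda>x. F x i)"
  shows "lin s t (\<lambda>x. \<Sum>i\<in>I. F x i)"
proof -
  interpret t: vector_space t by fact
  show ?thesis
    using assms(2) by (simp add: lin_def t.scale_sum_right sum.distrib)
qed

lemma lin_mult_const_right [lin_intros]: "lin s (*) f \<Longrightarrow> lin s (*) (\<lambda>x. f x * c)"
  and lin_mult_const_left [lin_intros]: "lin s (*) f \<Longrightarrow> lin s (*) (\<lambda>x. c * f x)"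
  for c :: "'k::field"
  by (simp_all add: lin_def algebra_simps)

lemma lin_scale_left [lin_intros]:
  "vector_space t \<Longrightarrow> lin s (*) f \<Longrightarrow> lin s t (\<lambda>x. t (f x) v)" for f :: "_ \<Rightarrow> 'k::field"
  by (simp add: lin_def vector_space_def)

lemma lin_scale_right [lin_intros]:
  "vector_space t \<Longrightarrow> lin s t f \<Longrightarrow> lin s t (\<lambda>x. t c (f x))"
  by (simp add: lin_def vector_space_def mult.commute)

text \<open>
  Identities in vector spaces are tested with linear forms. This is what allows axioms of coalgebras
  and comodules to be stated for forms with values in the field only and to be used for maps with
  values in any vector space.
\<close>
lemma separating_forms:
  fixes s :: "'k::field \<Rightarrow> 'a::ab_group_add \<Rightarrow> 'a"
  assumes "vector_space s" and "\<And>f. lin s (*) f \<Longrightarrow> f x = f y"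
  shows "x = y"
proof (rule ccontr)
  interpret vector_space s by fact
  interpret p: vector_space_pair s "(*) :: 'k \<Rightarrow> 'k \<Rightarrow> 'k"
    by (simp add: vector_space_pair_def assms vector_space_field)
  assume "x \<noteq> y"
  then have "independent {x - y}"
    by simp
  then obtain g where g: "Vector_Spaces.linear s (*) g" "g (x - y) = 1"
    using p.linear_independent_extend[of "{x - y}" "\<lambda>_. 1"] by auto
  have "lin s (*) g"
    using g(1) by (rule linear_imp_lin)
  then show False
    using assms(2)[of g] g(2) by (simp add: lin_diff)
qed

lemma (in vector_space) finite_basis_expansion:
  assumes "independent C" "span C = UNIV" "finite F"
  shows "\<exists>K. finite K \<and> (\<forall>x\<in>F. x = (\<Sum>c\<in>K. scale (representation C x c) c))"
proof (intro exI conjI ballI)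
  let ?K = "\<Union>x\<in>F. {c. representation C x c \<noteq> 0}"
  show fin: "finite ?K"
    using assms(3) by (simp add: finite_representation)
  fix x assume x: "x \<in> F"
  have "(\<Sum>c\<in>?K. scale (representation C x c) c) =
      (\<Sum>c | representation C x c \<noteq> 0. scale (representation C x c) c)"
    using fin x by (intro sum.mono_neutral_right) auto
  also have "\<dots> = x"
    using assms by (intro sum_nonzero_representation_eq) auto
  finally show "x = (\<Sum>c\<in>?K. scale (representation C x c) c)" ..
qed

lemma lin_pairs_family:
  assumes C: "\<And>F. bilin s1 s2 (*) F \<Longrightarrow> lin sV (*) (\<lambda>v. ssum (C v) F)"
    and t: "vector_space t" and F: "bilin s1 s2 t F" and g: "lin r sV g"
  shows "lin r t (\<lambda>x. ssum (C (g x)) F)"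
proof -
  have "lin sV t (\<lambda>v. ssum (C v) F)"
    unfolding lin_def
  proof (intro conjI allI separating_forms[OF t])
    fix x y c f assume f: "lin t (*) f"
    have "bilin s1 s2 (*) (\<lambda>a b. f (F a b))"
      by (intro lin_intros lin_comp[OF f] bilin_left[OF F] bilin_right[OF F])
    from C[OF this]
    show "f (ssum (C (x + y)) F) = f (ssum (C x) F + ssum (C y) F)"
      and "f (ssum (C (sV c x)) F) = f (t c (ssum (C x) F))"
      using f by (simp_all add: lin_ssum_out[OF f] lin_def)
  qed
  then show ?thesis
    using g by (rule lin_comp)
qed

section \<open>Formal tensors as lists of pairs\<close>

text \<open>
  The sum of a function over a formal integer combination. On the relations that define the tensor
  product it vanishes for multilinear functions, which is the universal property in the form used
  here.
\<close>

definition fsum :: "('k::ring_1 \<Rightarrow> 'v::ab_group_add \<Rightarrow> 'v) \<Rightarrow> ('t \<Rightarrow> 'v) \<Rightarrow> ('t \<Rightarrow>\<^sub>0 int) \<Rightarrow> 'v"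
  where "fsum t F p = (\<Sum>x\<in>Poly_Mapping.keys p. t (of_int (Poly_Mapping.lookup p x)) (F x))"

context vector_space begin

lemma fsum_superset:
  assumes "finite K" "Poly_Mapping.keys p \<subseteq> K"
  shows "fsum scale F p = (\<Sum>x\<in>K. scale (of_int (Poly_Mapping.lookup p x)) (F x))"
  unfolding fsum_def using assms by (intro sum.mono_neutral_left) (auto simp: in_keys_iff)

lemma fsum_add: "fsum scale F (p + q) = fsum scale F p + fsum scale F q"
proof -
  let ?K = "Poly_Mapping.keys p \<union> Poly_Mapping.keys q"
  have "Poly_Mapping.keys (p + q) \<subseteq> ?K"
    by (rule Poly_Mapping.keys_add)
  then show ?thesis
    by (simp add: fsum_superset[of ?K] lookup_add scale_left_distrib sum.distrib)
qed

lemma fsum_zero [simp]: "fsum scale F 0 = 0"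
  by (simp add: fsum_def)

lemma fsum_cmul: "fsum scale F (frag_cmul c q) = scale (of_int c) (fsum scale F q)"
proof -
  have "Poly_Mapping.keys (frag_cmul c q) \<subseteq> Poly_Mapping.keys q"
    by (rule keys_cmul)
  then show ?thesis
    by (simp add: fsum_superset[of "Poly_Mapping.keys q"] scale_sum_right)
qed

lemma fsum_diff: "fsum scale F (p - q) = fsum scale F p - fsum scale F q"
proof -
  have "p - q = p + frag_cmul (-1) q" by simp
  then show ?thesis
    unfolding \<open>p - q = _\<close> fsum_add fsum_cmul by (simp add: scale_minus_left)
qed

lemma fsum_frag_of [simp]: "fsum scale F (frag_of x) = F x"
  by (simp add: fsum_def)

lemma fsum_sum: "fsum scale F (\<Sum>i\<in>I. p i) = (\<Sum>i\<in>I. fsum scale F (p i))"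
  by (induction I rule: infinite_finite_induct) (simp_all add: fsum_add)

lemma fsum_frag_extend: "fsum scale F (frag_extend g p) = fsum scale (\<lambda>x. fsum scale F (g x)) p"
  by (simp add: frag_extend_def fsum_sum fsum_cmul) (simp add: fsum_def)

end

lemma fsum_tensor_null:
  assumes "vector_space t" "p \<in> tensor_null s1 s2" "bilin s1 s2 t F"
  shows "fsum t (\<lambda>(a, b). F a b) p = 0"
proof -
  interpret t: vector_space t by fact
  show ?thesis
    using assms(2)
    by induction (use assms(3) in \<open>auto simp: t.fsum_diff bilin_def lin_def\<close>)
qed

lemma fsum_tensor3_null:
  assumes "vector_space t" "p \<in> tensor3_null s1 s2 s3" "trilin s1 s2 s3 t F"
  shows "fsum t (\<lambda>(a, b, c). F a b c) p = 0"
proof -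
  interpret t: vector_space t by fact
  show ?thesis
    using assms(2)
    by induction (use assms(3) in \<open>auto simp: t.fsum_diff trilin_def lin_def\<close>)
qed

text \<open>
  The integer coefficients of the chosen representative are absorbed into the first factor.
\<close>
definition tensor_pairs ::
  "('k::ring_1 \<Rightarrow> 'a \<Rightarrow> 'a) \<Rightarrow> ('a \<times> 'b \<Rightarrow>\<^sub>0 int) set \<Rightarrow> ('a \<times> 'b) list"
  where "tensor_pairs s T =
    (let p = tensor_rep T in
      map (\<lambda>(a, b). (s (of_int (Poly_Mapping.lookup p (a, b))) a, b))
        (SOME xs. distinct xs \<and> set xs = Poly_Mapping.keys p))"

lemma ssum_tensor_pairs:
  assumes "bilin s1 s2 t F"
  shows "ssum (tensor_pairs s1 T) F = fsum t (\<lambda>(a, b). F a b) (tensor_rep T)"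
proof -
  let ?p = "tensor_rep T"
  obtain xs where xs: "xs = (SOME xs. distinct xs \<and> set xs = Poly_Mapping.keys ?p)" by blast
  have *: "distinct xs \<and> set xs = Poly_Mapping.keys ?p"
    unfolding xs by (rule someI_ex) (metis finite_distinct_list finite_keys)
  have "ssum (tensor_pairs s1 T) F =
    (\<Sum>(a, b)\<leftarrow>xs. t (of_int (Poly_Mapping.lookup ?p (a, b))) (F a b))"
    using assms
    by (simp add: tensor_pairs_def ssum_def xs[symmetric] o_def bilin_def lin_def case_prod_unfold)
  also have "\<dots> = fsum t (\<lambda>(a, b). F a b) ?p"
    using * by (simp add: fsum_def sum_list_distinct_conv_sum_set case_prod_unfold)
  finally show ?thesis .
qed

lemma contract_eq_ssum:
  "bilin s1 s2 t F \<Longrightarrow> contract t (\<lambda>(a, b). F a b) T = ssum (tensor_pairs s1 T) F"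
  by (simp add: contract_def ssum_tensor_pairs fsum_def)

lemma tensor_rep_class: "p - tensor_rep (tensor_class s1 s2 p) \<in> tensor_null s1 s2"
proof -
  have "p \<in> tensor_class s1 s2 p"
    by (simp add: tensor_class_def tensor_rel_def tensor_null.zero)
  then have "tensor_rep (tensor_class s1 s2 p) \<in> tensor_class s1 s2 p"
    unfolding tensor_rep_def by (rule someI)
  then show ?thesis
    by (simp add: tensor_class_def tensor_rel_def)
qed

lemma ssum_tensor_class:
  assumes "vector_space t" "bilin s1 s2 t F" "T = tensor_class s1 s2 p"
  shows "ssum (tensor_pairs s1 T) F = fsum t (\<lambda>(a, b). F a b) p"
proof -
  interpret t: vector_space t by fact
  show ?thesis
    using fsum_tensor_null[OF assms(1) tensor_rep_class assms(2), of p] assms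
    by (simp add: t.fsum_diff ssum_tensor_pairs)
qed

lemma tensor3_class_eqD:
  assumes "vector_space t" "tensor3_class s1 s2 s3 p = tensor3_class s1 s2 s3 q" "trilin s1 s2 s3 t F"
  shows "fsum t (\<lambda>(a, b, c). F a b c) p = fsum t (\<lambda>(a, b, c). F a b c) q"
proof -
  interpret t: vector_space t by fact
  have "q \<in> tensor3_class s1 s2 s3 q"
    by (simp add: tensor3_class_def tensor3_null.zero)
  then have "p - q \<in> tensor3_null s1 s2 s3"
    unfolding assms(2)[symmetric] by (simp add: tensor3_class_def)
  from fsum_tensor3_null[OF assms(1) this assms(3)] show ?thesis
    by (simp add: t.fsum_diff)
qed

lemma fsum_sweedler:
  assumes "vector_space t" "bilin s1 s2 t (\<lambda>a b. fsum t F (g (a, b)))"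
  shows "fsum t F (sweedler T g) = ssum (tensor_pairs s1 T) (\<lambda>a b. fsum t F (g (a, b)))"
proof -
  interpret t: vector_space t by fact
  show ?thesis
    unfolding sweedler_def t.fsum_frag_extend ssum_tensor_pairs[OF assms(2)]
    by (simp add: case_prod_unfold)
qed

lemma tensor_linear_lin:
  assumes "vector_space t" "tensor_linear sV s1 s2 C" "bilin s1 s2 t F"
  shows "lin sV t (\<lambda>x. ssum (tensor_pairs s1 (C x)) F)"
proof -
  interpret t: vector_space t by fact
  have 1: "ssum (tensor_pairs s1 (C (x + y))) F =
      ssum (tensor_pairs s1 (C x)) F + ssum (tensor_pairs s1 (C y)) F" for x y
  proof -
    have "C (x + y) = tensor_class s1 s2 (tensor_rep (C x) + tensor_rep (C y))"
      using assms(2) by (simp add: tensor_linear_def)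
    from ssum_tensor_class[OF assms(1,3) this] show ?thesis
      by (simp add: t.fsum_add ssum_tensor_pairs[OF assms(3)])
  qed
  have 2: "ssum (tensor_pairs s1 (C (sV c x))) F = t c (ssum (tensor_pairs s1 (C x)) F)" for c x
  proof -
    have "C (sV c x) = tensor_class s1 s2 (sweedler (C x) (\<lambda>(a, b). frag_of (s1 c a, b)))"
      using assms(2) by (simp add: tensor_linear_def)
    from ssum_tensor_class[OF assms(1,3) this]
    have "ssum (tensor_pairs s1 (C (sV c x))) F = 
      fsum t (\<lambda>(a, b). F a b) (sweedler (C x) (\<lambda>(a, b). frag_of (s1 c a, b)))" .
    also have "\<dots> = fsum t (\<lambda>(a, b). t c (F a b)) (tensor_rep (C x))"
      unfolding sweedler_def t.fsum_frag_extend using assms(3)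
      by (simp add: case_prod_unfold bilin_def lin_def)
    also have "\<dots> = t c (ssum (tensor_pairs s1 (C x)) F)"
      unfolding ssum_tensor_pairs[OF assms(3)]
      by (simp add: fsum_def t.scale_sum_right case_prod_unfold mult.commute)
    finally show ?thesis .
  qed
  show ?thesis using 1 2 by (simp add: lin_def)
qed

section \<open>Coalgebras and their simple subcoalgebras\<close>

text \<open>
  A coalgebra with a chosen list of pairs for every comultiplication. The choice is not linear, only
  its Sweedler sums with bilinear maps are; all axioms are therefore stated in terms of such sums.
  Exchanging the factors of every pair yields the co-opposite coalgebra (\<open>flip\<close>), through which right
  versions of statements follow from left ones.
\<close>
locale pair_coalgebra = vector_space s
  for s :: "'k::field \<Rightarrow> 'a::ab_group_add \<Rightarrow> 'a" +
  fixes D :: "'a \<Rightarrow> ('a \<times> 'a) list"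
    and eps :: "'a \<Rightarrow> 'k"
  assumes comul_lin: "bilin s s (*) F \<Longrightarrow> lin s (*) (\<lambda>x. ssum (D x) F)"
    and comul_coassoc: "trilin s s s (*) T \<Longrightarrow>
      ssum (D x) (\<lambda>a b. ssum (D a) (\<lambda>a1 a2. T a1 a2 b)) =
      ssum (D x) (\<lambda>a b. ssum (D b) (\<lambda>b1 b2. T a b1 b2))"
    and eps_lin: "lin s (*) eps"
    and counit_left: "lin s (*) f \<Longrightarrow> ssum (D x) (\<lambda>a b. eps a * f b) = f x"
    and counit_right: "lin s (*) f \<Longrightarrow> ssum (D x) (\<lambda>a b. f a * eps b) = f x"
begin

lemma is_vector_space: "vector_space s" ..

lemma lin_comul:
  assumes t: "vector_space t" and F: "bilin s s t F" and g: "lin r s g"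
  shows "lin r t (\<lambda>x. ssum (D (g x)) F)"
  using comul_lin t F g by (rule lin_pairs_family)

lemma flip: "pair_coalgebra s (\<lambda>x. map prod.swap (D x)) eps"
proof unfold_locales
  fix T :: "'a \<Rightarrow> 'a \<Rightarrow> 'a \<Rightarrow> 'k" and x assume T: "trilin s s s (*) T"
  have "trilin s s s (*) (\<lambda>a b c. T c b a)"
    by (intro lin_intros trilin_comps[OF T])
  from comul_coassoc[OF this, of x]
  show "ssum (map prod.swap (D x)) (\<lambda>a b. ssum (map prod.swap (D a)) (\<lambda>a1 a2. T a1 a2 b)) =
      ssum (map prod.swap (D x)) (\<lambda>a b. ssum (map prod.swap (D b)) (\<lambda>b1 b2. T a b1 b2))"
    by (simp add: ssum_flip)
next
  fix F :: "'a \<Rightarrow> 'a \<Rightarrow> 'k" assume F: "bilin s s (*) F"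
  show "lin s (*) (\<lambda>x. ssum (map prod.swap (D x)) F)"
    unfolding ssum_flip by (intro comul_lin lin_intros bilin_comps[OF F])
next
  fix f x assume "lin s (*) f"
  then show "ssum (map prod.swap (D x)) (\<lambda>a b. eps a * f b) = f x"
    "ssum (map prod.swap (D x)) (\<lambda>a b. f a * eps b) = f x"
    using counit_left[of f x] counit_right[of f x] by (simp_all add: ssum_flip mult.commute)
qed (rule eps_lin)

definition conv :: "('a \<Rightarrow> 'k) \<Rightarrow> ('a \<Rightarrow> 'k) \<Rightarrow> 'a \<Rightarrow> 'k"
  where "conv f g x = ssum (D x) (\<lambda>a b. f a * g b)"

text \<open>
  The two actions of the convolution algebra on the coalgebra, \<open>f(x\<^sub>1) x\<^sub>2\<close> and \<open>x\<^sub>1 f(x\<^sub>2)\<close>. Subspaces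
  closed under both are the subcoalgebras (\<open>subcoalgebra_iff_stable\<close>), which spares all
  considerations about subspaces of tensor products.
\<close>
definition lslice :: "('a \<Rightarrow> 'k) \<Rightarrow> 'a \<Rightarrow> 'a"
  where "lslice f x = ssum (D x) (\<lambda>a b. s (f a) b)"

definition rslice :: "('a \<Rightarrow> 'k) \<Rightarrow> 'a \<Rightarrow> 'a"
  where "rslice f x = ssum (D x) (\<lambda>a b. s (f b) a)"

lemma lin_lslice: "lin s (*) f \<Longrightarrow> lin s s (lslice f)"
  unfolding lslice_def by (intro lin_comul lin_intros is_vector_space)

lemma lin_rslice: "lin s (*) f \<Longrightarrow> lin s s (rslice f)"
  unfolding rslice_def by (intro lin_comul lin_intros is_vector_space)

lemma lin_conv: "lin s (*) f \<Longrightarrow> lin s (*) g \<Longrightarrow> lin s (*) (conv f g)"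
  unfolding conv_def by (intro lin_comul lin_intros)

lemma form_lslice: "lin s (*) g \<Longrightarrow> g (lslice f x) = conv f g x"
  by (simp add: lslice_def conv_def lin_ssum_out lin_scale)

lemma form_rslice: "lin s (*) g \<Longrightarrow> g (rslice f x) = conv g f x"
  by (simp add: rslice_def conv_def lin_ssum_out lin_scale mult.commute)

lemma conv_eps [simp]: "lin s (*) f \<Longrightarrow> conv eps f = f" "lin s (*) f \<Longrightarrow> conv f eps = f"
  by (rule ext, simp add: conv_def counit_left counit_right)+

lemma conv_assoc:
  assumes "lin s (*) f" "lin s (*) g" "lin s (*) h"
  shows "conv (conv f g) h = conv f (conv g h)"
proof
  fix x
  have "trilin s s s (*) (\<lambda>a b c. f a * g b * h c)"
    using assms by (intro lin_intros)
  from comul_coassoc[OF this, of x]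
  show "conv (conv f g) h x = conv f (conv g h) x"
    by (simp add: conv_def lin_ssum_out[OF lin_mult_const_left[OF lin_id]]
      lin_ssum_out[OF lin_mult_const_right[OF lin_id]] mult.assoc)
qed

lemma rslice_rslice:
  assumes "lin s (*) e" "lin s (*) f"
  shows "rslice e (rslice f x) = rslice (conv e f) x"
  by (rule separating_forms[OF is_vector_space]) (simp add: form_rslice conv_assoc lin_conv assms)

lemma lslice_lslice:
  assumes "lin s (*) e" "lin s (*) f"
  shows "lslice e (lslice f x) = lslice (conv f e) x"
  by (rule separating_forms[OF is_vector_space]) (simp add: form_lslice conv_assoc lin_conv assms)

lemma lslice_rslice:
  assumes "lin s (*) e" "lin s (*) f"
  shows "lslice e (rslice f x) = rslice f (lslice e x)"
  by (rule separating_forms[OF is_vector_space])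
    (simp add: form_lslice form_rslice conv_assoc lin_conv assms)

lemma slice_eps [simp]: "rslice eps x = x" "lslice eps x = x"
  by (rule separating_forms[OF is_vector_space], simp add: form_lslice form_rslice)+

definition stable :: "'a set \<Rightarrow> bool"
  where "stable V \<longleftrightarrow> subspace V \<and> (\<forall>f x. lin s (*) f \<longrightarrow> x \<in> V \<longrightarrow> lslice f x \<in> V \<and> rslice f x \<in> V)"

definition simple_stable :: "'a set \<Rightarrow> bool"
  where "simple_stable V \<longleftrightarrow> stable V \<and> V \<noteq> {0} \<and> (\<forall>E. stable E \<and> E \<subseteq> V \<longrightarrow> E = {0} \<or> E = V)"

definition corad :: "'a set"
  where "corad = span (\<Union>{V. simple_stable V})"

lemma stable_subspace: "stable V \<Longrightarrow> subspace V"
  and stable_lslice: "stable V \<Longrightarrow> lin s (*) f \<Longrightarrow> x \<in> V \<Longrightarrow> lslice f x \<in> V"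
  and stable_rslice: "stable V \<Longrightarrow> lin s (*) f \<Longrightarrow> x \<in> V \<Longrightarrow> rslice f x \<in> V"
  by (simp_all add: stable_def)

lemma stable_Int: "stable V \<Longrightarrow> stable W \<Longrightarrow> stable (V \<inter> W)"
  by (auto simp: stable_def subspace_inter)

lemma lin_image_span:
  assumes "lin s s f" "\<And>x. x \<in> X \<Longrightarrow> f x \<in> span Y" "x \<in> span X"
  shows "f x \<in> span Y"
  using assms(3)
  by (induction rule: span_induct_alt)
    (auto simp: lin_zero[OF assms(1)] lin_add[OF assms(1)] lin_scale[OF assms(1)] span_zero
      intro!: span_add span_scale assms(2))

lemma stable_span:
  assumes "\<And>f x. lin s (*) f \<Longrightarrow> x \<in> X \<Longrightarrow> lslice f x \<in> span X"
    and "\<And>f x. lin s (*) f \<Longrightarrow> x \<in> X \<Longrightarrow> rslice f x \<in> span X"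
  shows "stable (span X)"
  unfolding stable_def
  using lin_image_span[OF lin_lslice assms(1)] lin_image_span[OF lin_rslice assms(2)]
  by blast

lemma stable_span_Union:
  assumes "\<And>V. V \<in> \<V> \<Longrightarrow> stable V"
  shows "stable (span (\<Union>\<V>))"
  using assms by (intro stable_span) (blast intro: span_base stable_lslice stable_rslice)+

lemma ssum_in_subspace:
  "subspace V \<Longrightarrow> (\<And>a b. (a, b) \<in> set L \<Longrightarrow> F a b \<in> V) \<Longrightarrow> ssum L F \<in> V"
  by (induction L) (auto simp: subspace_0 subspace_add)

lemma lslice_in_span: "lslice f x \<in> span (snd ` set (D x))"
  unfolding lslice_def by (intro ssum_in_subspace span_scale span_base) force+

lemma rslice_in_span: "rslice f x \<in> span (fst ` set (D x))"
  unfolding rslice_def by (intro ssum_in_subspace span_scale span_base) force+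

text \<open>
  The finiteness theorem for coalgebras: the elements \<open>f(x\<^sub>1) x\<^sub>2 g(x\<^sub>3)\<close> span a subcoalgebra, and they
  all lie in the span of the finitely many middle factors of one expansion of \<open>x\<close>.
\<close>
lemma stable_generated:
  "\<exists>V B. stable V \<and> x \<in> V \<and> finite B \<and> V \<subseteq> span B \<and> (\<forall>W. stable W \<and> x \<in> W \<longrightarrow> V \<subseteq> W)"
proof -
  let ?X = "{rslice g (lslice f x) | f g. lin s (*) f \<and> lin s (*) g}"
  let ?B = "\<Union>y\<in>snd ` set (D x). fst ` set (D y)"
  have "rslice g (lslice f x) \<in> span ?B" if "lin s (*) g" for f g
    by (rule lin_image_span[OF lin_rslice[OF that] _ lslice_in_span])
      (meson UN_upper rslice_in_span span_mono subsetD)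
  then have "?X \<subseteq> span ?B" by blast
  then have "span ?X \<subseteq> span ?B"
    by (intro span_minimal) auto
  moreover have "stable (span ?X)"
  proof (rule stable_span)
    fix h z assume h: "lin s (*) h" and "z \<in> ?X"
    then obtain f g where fg: "lin s (*) f" "lin s (*) g" and z: "z = rslice g (lslice f x)" by blast
    have "lslice h z = rslice g (lslice (conv f h) x)"
      unfolding z lslice_rslice[OF h fg(2)] lslice_lslice[OF h fg(1)] ..
    moreover have "rslice h z = rslice (conv h g) (lslice f x)"
      unfolding z rslice_rslice[OF h fg(2)] ..
    moreover have "lin s (*) (conv f h)" "lin s (*) (conv h g)"
      using fg h by (auto intro: lin_conv)
    ultimately show "lslice h z \<in> span ?X" "rslice h z \<in> span ?X"
      using fg by (auto intro!: span_base)
  qed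
  moreover have "x \<in> span ?X"
    by (rule span_base) (metis (mono_tags, lifting) eps_lin mem_Collect_eq slice_eps)
  moreover have "span ?X \<subseteq> W" if "stable W" "x \<in> W" for W
    using that by (intro span_minimal) (auto intro: stable_lslice stable_rslice stable_subspace)
  ultimately show ?thesis
    by (intro exI[of _ "span ?X"] exI[of _ ?B]) auto
qed

lemma simple_stable_finite:
  assumes "simple_stable V"
  shows "\<exists>B. finite B \<and> V \<subseteq> span B"
proof -
  have V: "stable V" "V \<noteq> {0}" "\<And>E. stable E \<Longrightarrow> E \<subseteq> V \<Longrightarrow> E = {0} \<or> E = V"
    using assms by (auto simp: simple_stable_def)
  then obtain x where x: "x \<in> V" "x \<noteq> 0"
    using subspace_0[OF stable_subspace] by blast
  obtain W B where "stable W" "x \<in> W" "finite B" "W \<subseteq> span B" "\<forall>U. stable U \<and> x \<in> U \<longrightarrow> W \<subseteq> U"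
    using stable_generated[of x] by (elim exE conjE)
  moreover from this have "W \<subseteq> V"
    using V(1) x by simp
  ultimately have "W = V"
    using V(3)[of W] x by blast
  then show ?thesis
    using \<open>finite B\<close> \<open>W \<subseteq> span B\<close> by blast
qed

text \<open>Forms supported on one of two independent subspaces replace projections.\<close>
lemma form_extension:
  assumes A: "subspace A" and B: "subspace B" and AB: "A \<inter> B \<subseteq> {0}" and g: "lin s (*) g"
  shows "\<exists>f. lin s (*) f \<and> (\<forall>x\<in>A. f x = g x) \<and> (\<forall>x\<in>B. f x = 0)"
proof -
  interpret p: vector_space_pair s "(*) :: 'k \<Rightarrow> 'k \<Rightarrow> 'k"
    by (simp add: vector_space_pair_def is_vector_space vector_space_field)
  obtain X where X: "X \<subseteq> B" "independent X" "B \<subseteq> span X"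
    using maximal_independent_subset[of B] by blast
  obtain Y where Y: "X \<subseteq> Y" "Y \<subseteq> X \<union> A" "independent Y" "X \<union> A \<subseteq> span Y"
    using maximal_independent_subset_extend[of X "X \<union> A"] X(2) by blast
  obtain f where f: "Vector_Spaces.linear s (*) f" "\<forall>x\<in>Y. f x = (if x \<in> X then 0 else g x)"
    using p.linear_independent_extend[OF Y(3), of "\<lambda>x. if x \<in> X then 0 else g x"] by blast
  have f_lin: "lin s (*) f" using f(1) by (rule linear_imp_lin)
  have fB: "f x = 0" if "x \<in> span X" for x
    using that
    by (induction rule: span_induct_alt)
      (use f(2) Y(1) in \<open>auto simp: lin_zero[OF f_lin] lin_add[OF f_lin] lin_scale[OF f_lin]\<close>)
  have "f x = g x" if x: "x \<in> A" for x
  proof -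
    have "x \<in> span (X \<union> (Y - X))"
    proof -
      have "X \<union> (Y - X) = Y" using Y(1) by blast
      then show ?thesis using x Y(4) by auto
    qed
    then obtain q p where qp: "q \<in> span X" "p \<in> span (Y - X)" "x = q + p"
      unfolding span_Un by blast
    have "span X \<subseteq> B" "span (Y - X) \<subseteq> A"
      using X(1) Y(2) span_minimal[OF _ B, of X] span_minimal[OF _ A, of "Y - X"] by blast+
    then have "q \<in> B" "p \<in> A" using qp by auto
    moreover have "q \<in> A"
      using subspace_diff[OF A x \<open>p \<in> A\<close>] qp(3) by simp
    ultimately have "q = 0" using AB by blast
    have "f p = g p"
      using qp(2)
      by (induction rule: span_induct_alt)
        (use f(2) Y(1) g in \<open>auto simp: lin_zero[OF f_lin] lin_add[OF f_lin] lin_scale[OF f_lin]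
          lin_zero[OF g] lin_add[OF g] lin_scale[OF g]\<close>)
    then show ?thesis using qp(3) \<open>q = 0\<close> by simp
  qed
  then show ?thesis
    using f_lin fB X(3) by blast
qed

lemma subspace_by_forms:
  assumes "subspace V" "\<And>g. lin s (*) g \<Longrightarrow> (\<And>y. y \<in> V \<Longrightarrow> g y = 0) \<Longrightarrow> g x = 0"
  shows "x \<in> V"
proof (rule ccontr)
  interpret p: vector_space_pair s "(*) :: 'k \<Rightarrow> 'k \<Rightarrow> 'k"
    by (simp add: vector_space_pair_def is_vector_space vector_space_field)
  assume x: "x \<notin> V"
  then have "x \<noteq> 0" using assms(1) subspace_0 by blast
  then have "independent {x}" by simp
  then obtain h where h: "Vector_Spaces.linear s (*) h" "h x = 1"
    using p.linear_independent_extend[of "{x}" "\<lambda>_. 1"] by auto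
  have "span {x} \<inter> V \<subseteq> {0}"
  proof safe
    fix y assume "y \<in> span {x}" "y \<in> V"
    then obtain c where c: "y = s c x" unfolding span_singleton by blast
    show "y = 0"
    proof (cases "c = 0")
      case False
      then have "x = s (inverse c) y" by (simp add: c)
      then show ?thesis using x \<open>y \<in> V\<close> subspace_scale[OF assms(1)] by metis
    qed (simp add: c)
  qed
  from form_extension[OF subspace_span assms(1) this linear_imp_lin[OF h(1)]]
  obtain f where "lin s (*) f" "\<forall>y\<in>span {x}. f y = h y" "\<forall>y\<in>V. f y = 0" by blast
  then show False using assms(2)[of f] h(2) span_base[of x "{x}"] by simp
qed

text \<open>
  A simple subcoalgebra \<open>V\<close> inside \<open>E + F\<close> meets \<open>E\<close> or \<open>F\<close>. Otherwise there are forms \<open>\<alpha>\<close>, \<open>\<beta>\<close> that agree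
  with the counit on \<open>V\<close> and vanish on \<open>E\<close> and on \<open>F\<close>, respectively; their product vanishes on
  \<open>E + F\<close> but is the counit on \<open>V\<close>, which forces \<open>V = 0\<close>.
\<close>
lemma simple_stable_in_finite_sum:
  assumes "finite \<E>" "\<And>E. E \<in> \<E> \<Longrightarrow> simple_stable E" "simple_stable V"
    and "z \<in> V" "z \<in> span (\<Union>\<E>)" "z \<noteq> 0"
  shows "V \<in> \<E>"
  using assms
proof (induction arbitrary: z)
  case empty
  then show ?case by simp
next
  case (insert E \<E>)
  have V: "stable V" "V \<noteq> {0}" "\<And>E. stable E \<Longrightarrow> E \<subseteq> V \<Longrightarrow> E = {0} \<or> E = V"
    using insert.prems(2) by (auto simp: simple_stable_def)
  have E: "stable E" "E \<noteq> {0}" "\<And>F. stable F \<Longrightarrow> F \<subseteq> E \<Longrightarrow> F = {0} \<or> F = E"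
    using insert.prems(1)[of E] by (auto simp: simple_stable_def)
  let ?F = "span (\<Union>\<E>)"
  have F: "stable ?F"
    using insert.prems(1) by (intro stable_span_Union) (auto simp: simple_stable_def)
  have "stable (V \<inter> span (\<Union>(insert E \<E>)))"
    using insert.prems(1) by (intro stable_Int stable_span_Union V) (auto simp: simple_stable_def)
  then have VE: "V \<subseteq> span (\<Union>(insert E \<E>))"
    using V(3)[of "V \<inter> span (\<Union>(insert E \<E>))"] insert.prems by blast
  show ?case
  proof (rule ccontr)
    assume neg: "V \<notin> insert E \<E>"
    have "V \<inter> ?F \<subseteq> {0}"
      using insert.IH insert.prems neg by blast
    then obtain \<beta> where \<beta>: "lin s (*) \<beta>" "\<forall>x\<in>V. \<beta> x = eps x" "\<forall>x\<in>?F. \<beta> x = 0"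
      using form_extension[OF _ _ _ eps_lin] V(1) F stable_subspace by meson
    have "V \<inter> E \<subseteq> {0}"
      using V(3)[OF stable_Int[OF V(1) E(1)]] E(3)[OF V(1)] V(2) neg by blast
    then obtain \<alpha> where \<alpha>: "lin s (*) \<alpha>" "\<forall>x\<in>V. \<alpha> x = eps x" "\<forall>x\<in>E. \<alpha> x = 0"
      using form_extension[OF _ _ _ eps_lin] V(1) E(1) stable_subspace by meson
    have eps0: "eps x = 0" if x: "x \<in> V" for x
    proof -
      have "x \<in> span (E \<union> \<Union>\<E>)" using VE x by auto
      then obtain e y where ey: "x = e + y" "e \<in> E" "y \<in> ?F"
        unfolding span_Un using stable_subspace[OF E(1)] by (auto simp: span_eq_iff[THEN iffD2])
      have "conv \<alpha> \<beta> e = 0"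
        using \<alpha> \<beta> ey(2) stable_rslice[OF E(1)] by (simp flip: form_rslice)
      moreover have "conv \<alpha> \<beta> y = 0"
        using \<alpha> \<beta> ey(3) stable_lslice[OF F] by (simp flip: form_lslice)
      moreover have "conv \<alpha> \<beta> x = eps x"
      proof -
        have "conv \<alpha> \<beta> x = eps (rslice \<beta> x)"
          using \<alpha> \<beta> x stable_rslice[OF V(1)] by (simp flip: form_rslice)
        also have "\<dots> = eps x"
          using \<beta> x by (simp add: form_rslice eps_lin)
        finally show ?thesis .
      qed
      ultimately show ?thesis
        unfolding ey(1) using lin_add[OF lin_conv[OF \<alpha>(1) \<beta>(1)]] by simp
    qed
    have "x = 0" if x: "x \<in> V" for x
    proof (rule separating_forms[OF is_vector_space])
      fix f assume f: "lin s (*) f"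
      have "f x = eps (lslice f x)"
        using f by (simp add: form_lslice eps_lin)
      also have "\<dots> = 0"
        using eps0 stable_lslice[OF V(1) f x] by simp
      finally show "f x = f 0" by (simp add: lin_zero[OF f])
    qed
    then show False using V(2) insert.prems by blast
  qed
qed

lemma span_Union_decomposition:
  assumes "y \<in> span (\<Union>\<S>)" "\<And>V. V \<in> \<S> \<Longrightarrow> subspace V"
  shows "\<exists>\<E> d. finite \<E> \<and> \<E> \<subseteq> \<S> \<and> (\<forall>V\<in>\<E>. d V \<in> V) \<and> y = (\<Sum>V\<in>\<E>. d V)"
  using assms(1)
proof (induction rule: span_induct_alt)
  case base
  then show ?case by (intro exI[of _ "{}"]) auto
next
  case (step c x y)
  then obtain \<E> d V where \<E>: "finite \<E>" "\<E> \<subseteq> \<S>" "\<forall>V\<in>\<E>. d V \<in> V" "y = (\<Sum>V\<in>\<E>. d V)"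
    and V: "x \<in> V" "V \<in> \<S>" by blast
  let ?d = "d(V := s c x + (if V \<in> \<E> then d V else 0))"
  have "(\<Sum>W\<in>insert V \<E>. ?d W) = ?d V + (\<Sum>W\<in>\<E> - {V}. d W)"
    using \<E>(1) by (subst sum.insert_remove) (auto intro!: sum.cong)
  also have "\<dots> = s c x + y"
    using \<E>(1) by (auto simp: \<E>(4) sum.remove add.assoc)
  finally show ?case
    using \<E> V assms(2)[OF V(2)]
    by (intro exI[of _ "insert V \<E>"] exI[of _ ?d]) (auto intro: subspace_add subspace_scale)
qed

lemma simple_stable_disjoint_others:
  assumes "simple_stable V"
  shows "V \<inter> span (\<Union>{E. simple_stable E \<and> E \<noteq> V}) \<subseteq> {0}"
proof safe
  fix z assume z: "z \<in> V" "z \<in> span (\<Union>{E. simple_stable E \<and> E \<noteq> V})"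
  from span_Union_decomposition[OF z(2)]
  obtain \<E> d where \<E>: "finite \<E>" "\<E> \<subseteq> {E. simple_stable E \<and> E \<noteq> V}"
    "\<forall>E\<in>\<E>. d E \<in> E" "z = (\<Sum>E\<in>\<E>. d E)"
    by (auto simp: simple_stable_def stable_def)
  have "z \<in> span (\<Union>\<E>)"
    unfolding \<E>(4) using \<E>(3) by (intro span_sum span_base) auto
  then show "z = 0"
    using simple_stable_in_finite_sum[OF \<E>(1) _ assms z(1)] \<E>(2) by blast
qed

text \<open>
  The map \<open>x \<mapsto> x\<^sub>1 f(x\<^sub>2)\<close> takes values in the coradical because the forms that vanish on the coradical
  annihilate \<open>f\<close>. Decompose one value with non-zero counit into components in simple subcoalgebras and
  pick a component \<open>V\<close> with non-zero counit. If \<open>e\<close> is the counit on \<open>V\<close> and zero on the other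
  simple subcoalgebras, then \<open>e f\<close> is non-zero and \<open>x\<^sub>1 (e f)(x\<^sub>2)\<close> stays in \<open>V\<close>.
\<close>
lemma finite_image_functional:
  assumes f: "lin s (*) f" "f x0 \<noteq> 0"
    and kill: "\<And>g. lin s (*) g \<Longrightarrow> (\<And>x. x \<in> corad \<Longrightarrow> g x = 0) \<Longrightarrow> conv g f = (\<lambda>x. 0)"
  shows "\<exists>f' V B x. lin s (*) f' \<and> f' x \<noteq> 0 \<and> stable V \<and> finite B \<and> V \<subseteq> span B
    \<and> (\<forall>x. rslice f' x \<in> V)"
proof -
  have corad: "rslice f x \<in> corad" for x
  proof (rule subspace_by_forms)
    fix g assume "lin s (*) g" "\<And>y. y \<in> corad \<Longrightarrow> g y = 0"
    then show "g (rslice f x) = 0"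
      using kill[of g] by (simp add: form_rslice)
  qed (simp add: corad_def)
  let ?y = "rslice f x0"
  obtain \<E> d where \<E>: "finite \<E>" "\<E> \<subseteq> {E. simple_stable E}" "\<forall>E\<in>\<E>. d E \<in> E" "?y = (\<Sum>E\<in>\<E>. d E)"
    using span_Union_decomposition[OF corad[of x0, unfolded corad_def]]
    by (metis mem_Collect_eq simple_stable_def stable_subspace)
  have "(\<Sum>E\<in>\<E>. eps (d E)) = f x0"
    using f(1) by (simp add: form_rslice eps_lin flip: lin_sum[OF eps_lin] \<E>(4))
  then obtain V where V: "V \<in> \<E>" "eps (d V) \<noteq> 0"
    using f(2) by (metis sum.neutral)
  then have simple: "simple_stable V" and VS: "stable V" using \<E>(2) by (auto simp: simple_stable_def)
  let ?F = "span (\<Union>{E. simple_stable E \<and> E \<noteq> V})"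
  obtain e where e: "lin s (*) e" "\<forall>x\<in>V. e x = eps x" "\<forall>x\<in>?F. e x = 0"
    using form_extension[OF stable_subspace[OF VS] subspace_span simple_stable_disjoint_others[OF simple] eps_lin]
    by blast
  have "conv e f x0 = e ?y"
    using e(1) by (simp add: form_rslice)
  also have "\<dots> = (\<Sum>E\<in>\<E>. e (d E))"
    unfolding \<E>(4) by (rule lin_sum[OF e(1)])
  also have "\<dots> = e (d V) + (\<Sum>E\<in>\<E> - {V}. e (d E))"
    using \<E>(1) V(1) by (rule sum.remove)
  also have "(\<Sum>E\<in>\<E> - {V}. e (d E)) = 0"
    using \<E>(2,3) e(3) by (intro sum.neutral) (auto intro!: span_base)
  finally have nz: "conv e f x0 \<noteq> 0"
    using V \<E>(3) e(2) by simp
  have "rslice e z \<in> V" if "z \<in> corad" for z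
    using that unfolding corad_def
  proof (induction rule: span_induct_alt)
    case base
    then show ?case by (simp add: lin_zero[OF lin_rslice[OF e(1)]] subspace_0[OF stable_subspace[OF VS]])
  next
    case (step c x y)
    then obtain E where E: "simple_stable E" "x \<in> E" by blast
    have "rslice e x \<in> V"
    proof (cases "E = V")
      case True
      then show ?thesis using E stable_rslice[OF VS e(1)] by simp
    next
      case False
      have "rslice e x = 0"
      proof (rule separating_forms[OF is_vector_space])
        fix g assume g: "lin s (*) g"
        have "lslice g x \<in> E"
          using E g by (auto simp: simple_stable_def intro: stable_lslice)
        then have "e (lslice g x) = 0"
          using False E(1) e(3) by (auto intro!: span_base)
        then show "g (rslice e x) = g 0"
          using g e(1) by (simp add: form_lslice form_rslice lin_zero[OF g])
      qed
      then show ?thesis using subspace_0[OF stable_subspace[OF VS]] by simp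
    qed
    then show ?case
      using step stable_subspace[OF VS] lin_rslice[OF e(1)]
      by (simp add: lin_def subspace_add subspace_scale)
  qed
  then have "rslice (conv e f) x \<in> V" for x
    using corad rslice_rslice[OF e(1) f(1)] by metis
  moreover obtain B where "finite B" "V \<subseteq> span B"
    using simple_stable_finite[OF simple] by blast
  ultimately show ?thesis
    using nz lin_conv[OF e(1) f(1)] VS by blast
qed

lemma finite_image_functional_right:
  assumes f: "lin s (*) f" "f x0 \<noteq> 0"
    and kill: "\<And>g. lin s (*) g \<Longrightarrow> (\<And>x. x \<in> corad \<Longrightarrow> g x = 0) \<Longrightarrow> conv f g = (\<lambda>x. 0)"
  shows "\<exists>f' V B x. lin s (*) f' \<and> f' x \<noteq> 0 \<and> stable V \<and> finite B \<and> V \<subseteq> span B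
    \<and> (\<forall>x. lslice f' x \<in> V)"
proof -
  interpret fl: pair_coalgebra s "\<lambda>x. map prod.swap (D x)" eps by (rule flip)
  have slices: "fl.lslice = rslice" "fl.rslice = lslice"
    by (simp_all add: fun_eq_iff fl.lslice_def fl.rslice_def lslice_def rslice_def ssum_flip)
  have stable: "fl.stable = stable"
    by (auto simp: fun_eq_iff fl.stable_def stable_def slices)
  have "fl.corad = corad"
    by (simp add: fl.corad_def corad_def fl.simple_stable_def simple_stable_def stable)
  moreover have "fl.conv g f = conv f g" for g
    by (simp add: fun_eq_iff fl.conv_def conv_def ssum_flip mult.commute)
  ultimately show ?thesis
    using fl.finite_image_functional[OF f] kill by (simp add: stable slices)
qed

end

section \<open>Comatrices of operators\<close>

text \<open>
  Mutually inverse matrices of operators. Since operators do not commute, inverting the transposes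
  is a different condition; it is expressed by exchanging the indices.
\<close>
definition op_inverse :: "'i set \<Rightarrow> ('i \<Rightarrow> 'i \<Rightarrow> 'a \<Rightarrow> 'a::comm_monoid_add) \<Rightarrow> ('i \<Rightarrow> 'i \<Rightarrow> 'a \<Rightarrow> 'a) \<Rightarrow> bool"
  where "op_inverse I a c \<longleftrightarrow> (\<forall>i\<in>I. \<forall>j\<in>I. \<forall>x.
    (\<Sum>k\<in>I. a i k (c k j x)) = (if i = j then x else 0) \<and>
    (\<Sum>k\<in>I. c i k (a k j x)) = (if i = j then x else 0))"

lemma op_inverseD:
  assumes "op_inverse I a c" "i \<in> I" "j \<in> I"
  shows "(\<Sum>k\<in>I. a i k (c k j x)) = (if i = j then x else 0)"
    and "(\<Sum>k\<in>I. c i k (a k j x)) = (if i = j then x else 0)"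
  using assms by (auto simp: op_inverse_def)

context pair_coalgebra begin

text \<open>
  Operators that act like the matrix coefficients of a comodule over a Hopf algebra for which the
  coalgebra is a module coalgebra: \<open>\<Delta>(a\<^sub>i\<^sub>j x) = \<Sum>\<^sub>k a\<^sub>i\<^sub>k x\<^sub>1 \<otimes> a\<^sub>k\<^sub>j x\<^sub>2\<close>.
\<close>
definition comatrix :: "'i set \<Rightarrow> ('i \<Rightarrow> 'i \<Rightarrow> 'a \<Rightarrow> 'a) \<Rightarrow> bool"
  where "comatrix I a \<longleftrightarrow> (\<forall>i j. lin s s (a i j)) \<and>
    (\<forall>F i j x. bilin s s (*) F \<longrightarrow> i \<in> I \<longrightarrow> j \<in> I \<longrightarrow>
      ssum (D (a i j x)) F = (\<Sum>k\<in>I. ssum (D x) (\<lambda>u v. F (a i k u) (a k j v))))"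

lemma comatrixD:
  assumes "comatrix I a" "bilin s s (*) F" "i \<in> I" "j \<in> I"
  shows "ssum (D (a i j x)) F = (\<Sum>k\<in>I. ssum (D x) (\<lambda>u v. F (a i k u) (a k j v)))"
  using assms by (simp add: comatrix_def)

text \<open>
  This plays the part of the anticomultiplicativity of the antipode: applying the comultiplication to
  \<open>\<Sum>\<^sub>k a\<^sub>k\<^sub>j (c\<^sub>k\<^sub>i x) = \<delta>\<^sub>i\<^sub>j x\<close> and cancelling the two factors \<open>a\<close> expresses \<open>\<Delta>(c\<^sub>m\<^sub>i x)\<close> by \<open>c\<close>.
\<close>
lemma comatrix_inverse:
  assumes fin: "finite I" and a: "comatrix I a" and c: "\<And>i j. lin s s (c i j)"
    and inv: "op_inverse I (\<lambda>i j. a j i) c"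
  shows "comatrix I c"
  unfolding comatrix_def
proof (intro conjI allI impI c)
  fix F :: "'a \<Rightarrow> 'a \<Rightarrow> 'k" and m i x
  assume F: "bilin s s (*) F" and m: "m \<in> I" and i: "i \<in> I"
  have la: "lin s s (a i j)" for i j using a by (simp add: comatrix_def)
  have F': "bilin s s (*) (\<lambda>u v. F (f u) (g v))" if "lin s s f" "lin s s g" for f g
    by (intro lin_intros bilin_comps[OF F] that)
  note F0 = lin_zero[OF bilin_left[OF F]] lin_zero[OF bilin_right[OF F]]
  have D_lin: "lin s (*) (\<lambda>x. ssum (D x) (\<lambda>u v. F (f u) (g v)))" if "lin s s f" "lin s s g" for f g
    by (intro comul_lin F' that)
  have sum_left: "ssum L (\<lambda>u v. F (\<Sum>n\<in>I. f n u) v) = (\<Sum>n\<in>I. ssum L (\<lambda>u v. F (f n u) v))" for L f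
    by (induction L) (auto simp: sum.distrib lin_sum[OF bilin_left[OF F]])
  let ?t = "\<lambda>j k l n. ssum (D (c k i x)) (\<lambda>u v. F (c m n (a k l u)) (c n j (a l j v)))"
  have "(\<Sum>n\<in>I. ssum (D x) (\<lambda>u v. F (c m n u) (c n i v))) =
    (\<Sum>n\<in>I. \<Sum>j\<in>I. if j = i then ssum (D x) (\<lambda>u v. F (c m n u) (c n j v)) else 0)"
    using fin i by simp
  also have "\<dots> = (\<Sum>n\<in>I. \<Sum>j\<in>I. ssum (D (\<Sum>k\<in>I. a k j (c k i x))) (\<lambda>u v. F (c m n u) (c n j v)))"
    using op_inverseD(1)[OF inv _ i] by (intro sum.cong) (auto simp: lin_zero[OF D_lin[OF c c]])
  also have "\<dots> = (\<Sum>n\<in>I. \<Sum>j\<in>I. \<Sum>k\<in>I. ssum (D (a k j (c k i x))) (\<lambda>u v. F (c m n u) (c n j v)))"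
    by (simp add: lin_sum[OF D_lin[OF c c]])
  also have "\<dots> = (\<Sum>n\<in>I. \<Sum>j\<in>I. \<Sum>k\<in>I. \<Sum>l\<in>I.
      ?t j k l n)"
    by (intro sum.cong refl comatrixD[OF a F'] c)
  also have "\<dots> = (\<Sum>n\<in>I. \<Sum>k\<in>I. \<Sum>j\<in>I. \<Sum>l\<in>I.
      ?t j k l n)"
    by (rule sum_swap_inner)
  also have "\<dots> = (\<Sum>n\<in>I. \<Sum>k\<in>I. \<Sum>l\<in>I. \<Sum>j\<in>I.
      ?t j k l n)"
    by (rule sum.cong[OF refl], rule sum.cong[OF refl], rule sum.swap)
  also have "\<dots> = (\<Sum>n\<in>I. \<Sum>k\<in>I. \<Sum>l\<in>I.
      ssum (D (c k i x)) (\<lambda>u v. F (c m n (a k l u)) (\<Sum>j\<in>I. c n j (a l j v))))"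
    by (simp add: lin_sum[OF bilin_right[OF F]] ssum_sum)
  also have "\<dots> = (\<Sum>n\<in>I. \<Sum>k\<in>I. \<Sum>l\<in>I.
      if l = n then ssum (D (c k i x)) (\<lambda>u v. F (c m n (a k l u)) v) else 0)"
    using op_inverseD(2)[OF inv] by (intro sum.cong refl) (auto simp: F0)
  also have "\<dots> = (\<Sum>n\<in>I. \<Sum>k\<in>I. ssum (D (c k i x)) (\<lambda>u v. F (c m n (a k n u)) v))"
    using fin by simp
  also have "\<dots> = (\<Sum>k\<in>I. ssum (D (c k i x)) (\<lambda>u v. F (\<Sum>n\<in>I. c m n (a k n u)) v))"
    by (subst sum.swap) (simp only: sum_left)
  also have "\<dots> = (\<Sum>k\<in>I. if k = m then ssum (D (c k i x)) F else 0)"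
    using op_inverseD(2)[OF inv m] by (intro sum.cong refl) (auto simp: F0)
  also have "\<dots> = ssum (D (c m i x)) F"
    using fin m by simp
  finally show "ssum (D (c m i x)) F = (\<Sum>k\<in>I. ssum (D x) (\<lambda>u v. F (c m k u) (c k i v)))" ..
qed

text \<open>
  The passage from comodule maps to integrals. In \<open>r\<^sub>1 l\<^sub>j(r\<^sub>2) = \<Sum>\<^sub>i r\<^sub>1 G\<^sub>i(b\<^sub>i\<^sub>j r\<^sub>2)\<close> insert \<open>c b = 1\<close> in front of
  \<open>r\<^sub>1\<close>. The comatrix property of \<open>b\<close> turns the sum into \<open>\<Sum>\<^sub>i\<^sub>k c\<^sub>i\<^sub>k (s\<^sub>1 G\<^sub>i(s\<^sub>2))\<close> with \<open>s = b\<^sub>k\<^sub>j r\<close>, the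
  hypothesis on \<open>G\<close> replaces \<open>s\<^sub>1 G\<^sub>i(s\<^sub>2)\<close> by \<open>\<Sum>\<^sub>m G\<^sub>m(s) a\<^sub>m\<^sub>i 1\<close>, and \<open>c\<close> cancels \<open>a\<close>. Conversely the \<open>G\<^sub>i\<close> are
  recovered from the \<open>l\<^sub>j\<close> by means of \<open>b c = 1\<close>, so not all \<open>l\<^sub>j\<close> vanish.
\<close>
lemma twisted_integral:
  assumes fin: "finite I" and a: "comatrix I a"
    and c: "\<And>i j. lin s s (c i j)" and b: "\<And>i j. lin s s (b i j)"
    and ac: "op_inverse I (\<lambda>i j. a j i) (\<lambda>i j. c j i)" and cb: "op_inverse I c b"
    and G: "\<And>i. lin s (*) (G i)"
    and Gcom: "\<And>\<psi> i r. lin s (*) \<psi> \<Longrightarrow> i \<in> I \<Longrightarrow>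
      ssum (D r) (\<lambda>u v. \<psi> u * G i v) = (\<Sum>j\<in>I. G j r * \<psi> (a j i one))"
    and nz: "i0 \<in> I" "G i0 r0 \<noteq> 0"
  shows "\<exists>l. lin s (*) l \<and> (\<exists>r. l r \<noteq> 0) \<and>
    (\<forall>\<psi> r. lin s (*) \<psi> \<longrightarrow> ssum (D r) (\<lambda>u v. \<psi> u * l v) = \<psi> one * l r)"
proof -
  define l where "l = (\<lambda>j r. \<Sum>i\<in>I. G i (b i j r))"
  have cT: "comatrix I (\<lambda>i j. c j i)"
    by (rule comatrix_inverse[OF fin a c ac])
  have bc: "comatrix I b"
    by (rule comatrix_inverse[OF fin cT b]) (use cb in simp)
  have integral: "ssum (D r) (\<lambda>u v. \<psi> u * l j v) = \<psi> one * l j r"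
    if \<psi>: "lin s (*) \<psi>" and j: "j \<in> I" for \<psi> j r
  proof -
    let ?t = "\<lambda>i k m. G m (b k j r) * \<psi> (c i k (a m i one))"
    have "ssum (D r) (\<lambda>u v. \<psi> u * l j v) = (\<Sum>i\<in>I. ssum (D r) (\<lambda>u v. \<psi> u * G i (b i j v)))"
      by (simp add: l_def sum_distrib_left ssum_sum)
    \<comment> \<open>Insert \<open>c b = 1\<close> in front of the first tensor factor.\<close>
    also have "\<dots> = (\<Sum>i\<in>I. \<Sum>m\<in>I. if m = i then ssum (D r) (\<lambda>u v. \<psi> u * G i (b m j v)) else 0)"
      using fin by simp
    also have "\<dots> = (\<Sum>i\<in>I. \<Sum>m\<in>I. ssum (D r) (\<lambda>u v. \<psi> (\<Sum>k\<in>I. c i k (b k m u)) * G i (b m j v)))"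
      using op_inverseD(1)[OF cb] by (intro sum.cong refl) (auto simp: lin_zero[OF \<psi>])
    also have "\<dots> = (\<Sum>i\<in>I. \<Sum>m\<in>I. \<Sum>k\<in>I. ssum (D r) (\<lambda>u v. \<psi> (c i k (b k m u)) * G i (b m j v)))"
      by (simp add: lin_sum[OF \<psi>] sum_distrib_right ssum_sum)
    also have "\<dots> = (\<Sum>i\<in>I. \<Sum>k\<in>I. \<Sum>m\<in>I. ssum (D r) (\<lambda>u v. \<psi> (c i k (b k m u)) * G i (b m j v)))"
      by (rule sum_swap_inner)
    also have "\<dots> = (\<Sum>i\<in>I. \<Sum>k\<in>I. ssum (D (b k j r)) (\<lambda>u v. \<psi> (c i k u) * G i v))"
    proof (intro sum.cong refl)
      fix i k assume "k \<in> I"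
      have "bilin s s (*) (\<lambda>u v. \<psi> (c i k u) * G i v)"
        by (intro lin_intros lin_comp[OF \<psi>] c G)
      from comatrixD[OF bc this \<open>k \<in> I\<close> j, of r]
      show "(\<Sum>m\<in>I. ssum (D r) (\<lambda>u v. \<psi> (c i k (b k m u)) * G i (b m j v))) =
        ssum (D (b k j r)) (\<lambda>u v. \<psi> (c i k u) * G i v)" ..
    qed
    also have "\<dots> = (\<Sum>i\<in>I. \<Sum>k\<in>I. \<Sum>m\<in>I. ?t i k m)"
      by (intro sum.cong refl Gcom lin_comp[OF \<psi> c])
    also have "\<dots> = (\<Sum>k\<in>I. \<Sum>m\<in>I. \<Sum>i\<in>I. ?t i k m)"
      by (rule sum_rotate3)
    also have "\<dots> = (\<Sum>k\<in>I. \<Sum>m\<in>I. G m (b k j r) * \<psi> (\<Sum>i\<in>I. c i k (a m i one)))"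
      by (simp add: lin_sum[OF \<psi>] sum_distrib_left)
    also have "\<dots> = (\<Sum>k\<in>I. \<Sum>m\<in>I. if m = k then G m (b k j r) * \<psi> one else 0)"
      using op_inverseD(2)[OF ac] by (intro sum.cong refl) (auto simp: lin_zero[OF \<psi>])
    also have "\<dots> = \<psi> one * l j r"
      using fin by (simp add: l_def sum_distrib_left mult.commute)
    finally show ?thesis .
  qed
  have "\<exists>j\<in>I. \<exists>r. l j r \<noteq> 0"
  proof (rule ccontr)
    assume "\<not> ?thesis"
    then have 0: "l j r = 0" if "j \<in> I" for j r using that by blast
    have "G i0 r0 = (\<Sum>i\<in>I. if i = i0 then G i r0 else 0)"
      using fin nz(1) by simp
    also have "\<dots> = (\<Sum>i\<in>I. G i (\<Sum>k\<in>I. b i k (c k i0 r0)))"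
      using op_inverseD(2)[OF cb _ nz(1)] by (intro sum.cong refl) (auto simp: lin_zero[OF G])
    also have "\<dots> = (\<Sum>k\<in>I. l k (c k i0 r0))"
      unfolding l_def lin_sum[OF G] by (rule sum.swap)
    also have "\<dots> = 0" using 0 by simp
    finally show False using nz(2) by simp
  qed
  then obtain j r where j: "j \<in> I" "l j r \<noteq> 0" by blast
  have "lin s (*) (l j)"
    unfolding l_def by (intro lin_intros lin_comp[OF G] b)
  then show ?thesis
    using integral[OF _ j(1)] j(2) by blast
qed

end

section \<open>Comodules in coordinates\<close>

text \<open>
  A tensor is zero if all its slices by linear forms on the first factor are: expand the first
  factors in a basis.
\<close>
lemma ssum_zero_if_slices_zero:
  fixes s1 :: "'k::field \<Rightarrow> 'a::ab_group_add \<Rightarrow> 'a" and s2 :: "'k \<Rightarrow> 'b::ab_group_add \<Rightarrow> 'b"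
  assumes "vector_space s1" "vector_space s2" "vector_space t"
    and slices: "\<And>\<phi>. lin s1 (*) \<phi> \<Longrightarrow> ssum L (\<lambda>x y. s2 (\<phi> x) y) = 0"
    and F: "bilin s1 s2 t F"
  shows "ssum L F = 0"
proof -
  interpret v1: vector_space s1 by fact
  interpret v2: vector_space s2 by fact
  interpret vt: vector_space t by fact
  obtain C where C: "v1.independent C" "v1.span C = UNIV"
    using v1.maximal_independent_subset[of UNIV] by (metis top.extremum_uniqueI)
  define r where "r = v1.representation C"
  have r_lin: "lin s1 (*) (\<lambda>x. r x c)" for c
    unfolding r_def by (rule linear_imp_lin) (rule v1.linear_representation[OF C])
  obtain K where K: "\<forall>x\<in>fst ` set L. x = (\<Sum>c\<in>K. s1 (r x c) c)"
    using v1.finite_basis_expansion[OF C, of "fst ` set L"] by (auto simp: r_def)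
  then have expand: "x = (\<Sum>c\<in>K. s1 (r x c) c)" if "(x, y) \<in> set L" for x y
    using that by force
  have "ssum L F = ssum L (\<lambda>x y. \<Sum>c\<in>K. F c (s2 (r x c) y))"
  proof (rule ssum_cong)
    fix x y assume "(x, y) \<in> set L"
    have "F x y = F (\<Sum>c\<in>K. s1 (r x c) c) y"
      using expand[OF \<open>(x, y) \<in> set L\<close>] by simp
    also have "\<dots> = (\<Sum>c\<in>K. F c (s2 (r x c) y))"
      unfolding lin_sum[OF bilin_left[OF F]] lin_scale[OF bilin_left[OF F]]
        lin_scale[OF bilin_right[OF F]] ..
    finally show "F x y = (\<Sum>c\<in>K. F c (s2 (r x c) y))" .
  qed
  also have "\<dots> = (\<Sum>c\<in>K. F c (ssum L (\<lambda>x y. s2 (r x c) y)))"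
    by (simp add: ssum_sum lin_ssum_out[OF bilin_right[OF F]])
  also have "\<dots> = 0"
    using slices[OF r_lin] by (simp add: lin_zero[OF bilin_right[OF F]])
  finally show ?thesis .
qed

text \<open>
  A basis \<open>B\<close> of a finite-dimensional subspace, used as its own index set, and linear forms on the
  whole space that extend the dual basis.
\<close>

locale coordinates = vector_space s
  for s :: "'k::field \<Rightarrow> 'a::ab_group_add \<Rightarrow> 'a" +
  fixes B :: "'a set" and \<kappa> :: "'a \<Rightarrow> 'a \<Rightarrow> 'k"
  assumes finite_B: "finite B"
    and \<kappa>_lin: "lin s (*) (\<kappa> b)"
    and \<kappa>_basis: "b \<in> B \<Longrightarrow> c \<in> B \<Longrightarrow> \<kappa> b c = (if b = c then 1 else 0)"
begin

lemma sum_coordinate: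
  assumes "vector_space t" "b \<in> B"
  shows "(\<Sum>c\<in>B. t (\<kappa> b c) (G c)) = G b"
proof -
  interpret t: vector_space t by fact
  have "(\<Sum>c\<in>B. t (\<kappa> b c) (G c)) = (\<Sum>c\<in>B. if c = b then G c else 0)"
    using assms(2) by (intro sum.cong) (auto simp: \<kappa>_basis)
  then show ?thesis using assms(2) finite_B by simp
qed

lemma expansion: "v \<in> span B \<Longrightarrow> (\<Sum>b\<in>B. s (\<kappa> b v) b) = v"
proof (induction rule: span_induct_alt)
  case base
  then show ?case by (simp add: lin_zero[OF \<kappa>_lin])
next
  case (step c x y)
  have "(\<Sum>b\<in>B. s (\<kappa> b x) b) = (\<Sum>b\<in>B. if b = x then b else 0)"
    using step by (intro sum.cong) (auto simp: \<kappa>_basis)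
  also have "\<dots> = x" using step finite_B by simp
  finally show ?case
    using step by (simp add: lin_add[OF \<kappa>_lin] lin_scale[OF \<kappa>_lin] scale_left_distrib sum.distrib
      flip: scale_scale scale_sum_right)
qed

lemma ssum_expand_right:
  assumes s1: "vector_space s1" and t: "vector_space t"
    and slices: "\<And>\<phi>. lin s1 (*) \<phi> \<Longrightarrow> ssum L (\<lambda>x y. s (\<phi> x) y) \<in> span B"
    and F: "bilin s1 s t F"
  shows "ssum L F = (\<Sum>b\<in>B. F (ssum L (\<lambda>x y. s1 (\<kappa> b y) x)) b)"
proof -
  let ?P = "\<lambda>y. y - (\<Sum>b\<in>B. s (\<kappa> b y) b)"
  have P_lin: "lin s s ?P"
    by (auto simp: lin_def lin_add[OF \<kappa>_lin] lin_scale[OF \<kappa>_lin] scale_left_distrib sum.distrib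
      scale_right_diff_distrib scale_sum_right)
  have "ssum (map (\<lambda>(x, y). (x, ?P y)) L) F = 0"
  proof (rule ssum_zero_if_slices_zero[OF s1 _ t _ F])
    fix \<phi> assume "lin s1 (*) \<phi>"
    have "ssum (map (\<lambda>(x, y). (x, ?P y)) L) (\<lambda>x y. s (\<phi> x) y) = ssum L (\<lambda>x y. ?P (s (\<phi> x) y))"
      by (simp add: ssum_def o_def case_prod_unfold lin_scale[OF P_lin])
    also have "\<dots> = ?P (ssum L (\<lambda>x y. s (\<phi> x) y))"
      by (rule lin_ssum_out[OF P_lin, symmetric])
    also have "\<dots> = 0"
      using slices[OF \<open>lin s1 (*) \<phi>\<close>] by (simp add: expansion)
    finally show "ssum (map (\<lambda>(x, y). (x, ?P y)) L) (\<lambda>x y. s (\<phi> x) y) = 0" .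
  qed unfold_locales
  moreover have "ssum (map (\<lambda>(x, y). (x, ?P y)) L) F = ssum L (\<lambda>x y. F x (?P y))"
    by (simp add: ssum_def o_def case_prod_unfold)
  moreover have "F x (?P y) = F x y - (\<Sum>b\<in>B. F (s1 (\<kappa> b y) x) b)" for x y
    by (simp add: lin_diff[OF bilin_right[OF F]] lin_sum[OF bilin_right[OF F]]
      lin_scale[OF bilin_right[OF F]] lin_scale[OF bilin_left[OF F]])
  ultimately have "ssum L F = ssum L (\<lambda>x y. \<Sum>b\<in>B. F (s1 (\<kappa> b y) x) b)"
    by (simp add: ssum_diff)
  then show ?thesis
    by (simp add: ssum_sum lin_ssum_out[OF bilin_left[OF F]])
qed

end

lemma coordinates_exist:
  fixes s :: "'k::field \<Rightarrow> 'a::ab_group_add \<Rightarrow> 'a"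
  assumes "vector_space s" "module.subspace s V" "finite X" "V \<subseteq> module.span s X"
  shows "\<exists>B \<kappa>. coordinates s B \<kappa> \<and> V = module.span s B"
proof -
  interpret vector_space s by fact
  interpret p: vector_space_pair s "(*) :: 'k \<Rightarrow> 'k \<Rightarrow> 'k"
    by (simp add: vector_space_pair_def assms vector_space_field)
  obtain B where B: "B \<subseteq> V" "independent B" "V \<subseteq> span B"
    using maximal_independent_subset[of V] by blast
  then have "finite B" "V = span B"
    using independent_span_bound[OF assms(3) B(2)] assms(2,4) span_minimal[OF B(1)] by auto
  moreover have "\<exists>g. Vector_Spaces.linear s (*) g \<and> (\<forall>c\<in>B. g c = (if b = c then 1 else 0))" for b
    using p.linear_independent_extend[OF B(2), of "\<lambda>c. if b = c then 1 else 0"] by blast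
  then obtain \<kappa> where "\<And>b. Vector_Spaces.linear s (*) (\<kappa> b)"
    "\<And>b c. c \<in> B \<Longrightarrow> \<kappa> b c = (if b = c then 1 else 0)"
    by metis
  ultimately show ?thesis
    by (intro exI[of _ B] exI[of _ \<kappa>]) (auto intro!: coordinates.intro coordinates_axioms.intro
      linear_imp_lin assms(1))
qed

text \<open>
  A coalgebra is a left comodule over itself, so the coefficients of a coaction of \<open>H\<close> and those of
  the comultiplication of \<open>R\<close> are treated together.
\<close>
locale left_comodule =
  H: pair_coalgebra sH dH epsH + V: vector_space sV
  for sH :: "'k::field \<Rightarrow> 'h::ab_group_add \<Rightarrow> 'h" and dH epsH
    and sV :: "'k \<Rightarrow> 'v::ab_group_add \<Rightarrow> 'v" +
  fixes dC :: "'v \<Rightarrow> ('h \<times> 'v) list"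
  assumes coact_lin: "bilin sH sV (*) F \<Longrightarrow> lin sV (*) (\<lambda>v. ssum (dC v) F)"
    and coact_coassoc: "trilin sH sH sV (*) T \<Longrightarrow>
      ssum (dC v) (\<lambda>h w. ssum (dH h) (\<lambda>h1 h2. T h1 h2 w)) =
      ssum (dC v) (\<lambda>h w. ssum (dC w) (\<lambda>g u. T h g u))"
    and coact_counit: "lin sV (*) f \<Longrightarrow> ssum (dC v) (\<lambda>h w. epsH h * f w) = f v"
begin

lemma lin_coact:
  "vector_space t \<Longrightarrow> bilin sH sV t F \<Longrightarrow> lin r sV g \<Longrightarrow> lin r t (\<lambda>x. ssum (dC (g x)) F)"
  using coact_lin by (rule lin_pairs_family)

lemma coact_coassoc_vec:
  assumes t: "vector_space t" and T: "trilin sH sH sV t T"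
  shows "ssum (dC v) (\<lambda>h w. ssum (dH h) (\<lambda>h1 h2. T h1 h2 w)) =
      ssum (dC v) (\<lambda>h w. ssum (dC w) (\<lambda>g u. T h g u))"
proof (rule separating_forms[OF t])
  fix f assume f: "lin t (*) f"
  have "trilin sH sH sV (*) (\<lambda>a b c. f (T a b c))"
    by (intro lin_intros lin_comp[OF f] trilin_comps[OF T])
  from coact_coassoc[OF this]
  show "f (ssum (dC v) (\<lambda>h w. ssum (dH h) (\<lambda>h1 h2. T h1 h2 w))) =
      f (ssum (dC v) (\<lambda>h w. ssum (dC w) (\<lambda>g u. T h g u)))"
    by (simp add: lin_ssum_out[OF f])
qed

lemma coact_counit_vec:
  assumes t: "vector_space t" and g: "lin sV t g"
  shows "ssum (dC v) (\<lambda>h w. t (epsH h) (g w)) = g v"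
proof (rule separating_forms[OF t])
  fix f assume f: "lin t (*) f"
  show "f (ssum (dC v) (\<lambda>h w. t (epsH h) (g w))) = f (g v)"
    using coact_counit[OF lin_comp[OF f g]] by (simp add: lin_ssum_out[OF f] lin_scale[OF f])
qed

end

text \<open>
  The span of \<open>B\<close> is a subcomodule, hence \<open>v \<mapsto> \<Sum>\<^sub>c coeff v c \<otimes> c\<close> describes the coaction on \<open>B\<close>.
\<close>
locale comodule_coordinates = left_comodule sH dH epsH sV dC + coordinates sV B \<kappa>
  for sH :: "'k::field \<Rightarrow> 'h::ab_group_add \<Rightarrow> 'h" and dH epsH
    and sV :: "'k \<Rightarrow> 'v::ab_group_add \<Rightarrow> 'v" and dC B \<kappa> +
  assumes closed: "b \<in> B \<Longrightarrow> lin sH (*) \<phi> \<Longrightarrow> ssum (dC b) (\<lambda>h w. sV (\<phi> h) w) \<in> V.span B"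
begin

definition coeff :: "'v \<Rightarrow> 'v \<Rightarrow> 'h"
  where "coeff b c = ssum (dC b) (\<lambda>h w. sH (\<kappa> c w) h)"

lemma coact_expand:
  assumes "vector_space t" "b \<in> B" "bilin sH sV t F"
  shows "ssum (dC b) F = (\<Sum>c\<in>B. F (coeff b c) c)"
  unfolding coeff_def
  by (rule ssum_expand_right[OF H.is_vector_space assms(1) closed[OF assms(2)] assms(3)])

lemma comul_coeff:
  assumes t: "vector_space t" and b: "b \<in> B" and c: "c \<in> B" and F: "bilin sH sH t F"
  shows "ssum (dH (coeff b c)) F = (\<Sum>k\<in>B. F (coeff b k) (coeff k c))"
proof -
  note delta = sum_coordinate[OF t c]
  \<comment> \<open>Coassociativity is evaluated with \<open>\<kappa> c\<close> on the last factor, which picks out one column of coefficients.\<close>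
  have T: "trilin sH sH sV t (\<lambda>x y v. t (\<kappa> c v) (F x y))"
    by (intro lin_intros \<kappa>_lin t bilin_comps[OF F])
  have F2: "lin sH t (\<lambda>x. ssum (dH x) F)"
    by (intro H.lin_comul F t lin_intros)
  have "ssum (dC b) (\<lambda>h w. ssum (dH h) (\<lambda>h1 h2. t (\<kappa> c w) (F h1 h2))) =
    ssum (dC b) (\<lambda>h w. t (\<kappa> c w) (ssum (dH h) F))"
    by (simp add: lin_ssum_out[OF lin_scale_right[OF t lin_id]])
  also have "\<dots> = (\<Sum>k\<in>B. t (\<kappa> c k) (ssum (dH (coeff b k)) F))"
    by (rule coact_expand[OF t b]) (intro lin_intros \<kappa>_lin t F2)
  also have "\<dots> = ssum (dH (coeff b c)) F" by (rule delta)
  finally have 1: "ssum (dC b) (\<lambda>h w. ssum (dH h) (\<lambda>h1 h2. t (\<kappa> c w) (F h1 h2))) =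
    ssum (dH (coeff b c)) F" .
  have "ssum (dC b) (\<lambda>h w. ssum (dC w) (\<lambda>g u. t (\<kappa> c u) (F h g))) =
    (\<Sum>k\<in>B. ssum (dC k) (\<lambda>g u. t (\<kappa> c u) (F (coeff b k) g)))"
    by (rule coact_expand[OF t b]) (intro lin_intros lin_coact \<kappa>_lin t bilin_comps[OF F])
  also have "\<dots> = (\<Sum>k\<in>B. \<Sum>l\<in>B. t (\<kappa> c l) (F (coeff b k) (coeff k l)))"
    by (rule sum.cong[OF refl], rule coact_expand[OF t])
      (assumption, intro lin_intros \<kappa>_lin t bilin_comps[OF F])
  also have "\<dots> = (\<Sum>k\<in>B. F (coeff b k) (coeff k c))"
    by (simp only: delta)
  finally show ?thesis
    using 1 coact_coassoc_vec[OF t T, of b] by simp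
qed

lemma counit_coeff:
  assumes b: "b \<in> B" and c: "c \<in> B"
  shows "epsH (coeff b c) = (if b = c then 1 else 0)"
proof -
  have "epsH (coeff b c) = ssum (dC b) (\<lambda>h w. epsH h * \<kappa> c w)"
    by (simp add: coeff_def lin_ssum_out[OF H.eps_lin] lin_scale[OF H.eps_lin] mult.commute)
  also have "\<dots> = \<kappa> c b"
    by (rule coact_counit[OF \<kappa>_lin])
  finally show ?thesis using b c by (simp add: \<kappa>_basis)
qed

end

lemma (in pair_coalgebra) regular_comodule: "left_comodule s D eps s D"
  by unfold_locales (rule comul_lin comul_coassoc counit_left | assumption)+

context pair_coalgebra begin

lemma counit_left_vec:
  assumes t: "vector_space t" and g: "lin s t g"
  shows "ssum (D x) (\<lambda>a b. t (eps a) (g b)) = g x"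
  by (rule left_comodule.coact_counit_vec[OF regular_comodule t g])

lemma coassoc_vec:
  assumes t: "vector_space t" and T: "trilin s s s t T"
  shows "ssum (D x) (\<lambda>a b. ssum (D a) (\<lambda>a1 a2. T a1 a2 b)) =
      ssum (D x) (\<lambda>a b. ssum (D b) (\<lambda>b1 b2. T a b1 b2))"
  by (rule left_comodule.coact_coassoc_vec[OF regular_comodule t T])

lemma counit_right_vec:
  assumes t: "vector_space t" and g: "lin s t g"
  shows "ssum (D x) (\<lambda>a b. t (eps b) (g a)) = g x"
  using pair_coalgebra.counit_left_vec[OF flip t g, of x] by (simp add: ssum_flip)

end

text \<open>
  The coordinates \<open>G\<^sub>i\<close> of the comodule map \<open>x \<mapsto> x\<^sub>1 f(x\<^sub>2)\<close> satisfy the hypothesis of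
  \<open>twisted_integral\<close> because the comodule map commutes with the coaction on its image.
\<close>
lemma (in pair_coalgebra) integral_from_matrices:
  assumes coord: "comodule_coordinates s D eps s D B \<kappa>"
    and f: "lin s (*) f" "f x0 \<noteq> 0" and image: "\<And>x. rslice f x \<in> span B"
    and a: "comatrix B a"
    and c: "\<And>i j. lin s s (c i j)" and b: "\<And>i j. lin s s (b i j)"
    and ac: "op_inverse B (\<lambda>i j. a j i) (\<lambda>i j. c j i)" and cb: "op_inverse B c b"
    and a_one: "\<And>i j. i \<in> B \<Longrightarrow> j \<in> B \<Longrightarrow> a i j one = comodule_coordinates.coeff s D \<kappa> i j"
  shows "\<exists>l. lin s (*) l \<and> (\<exists>r. l r \<noteq> 0) \<and>
    (\<forall>\<psi> r. lin s (*) \<psi> \<longrightarrow> ssum (D r) (\<lambda>u v. \<psi> u * l v) = \<psi> one * l r)"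
proof -
  interpret co: comodule_coordinates s D eps s D B \<kappa> by (rule coord)
  define G where "G = (\<lambda>i. conv (\<kappa> i) f)"
  have G_slice: "G i x = \<kappa> i (rslice f x)" for i x
    by (simp add: G_def form_rslice co.\<kappa>_lin)
  have G_lin: "lin s (*) (G i)" for i
    unfolding G_def by (intro lin_conv co.\<kappa>_lin f)
  have Gcom: "ssum (D r) (\<lambda>u v. \<psi> u * G i v) = (\<Sum>j\<in>B. G j r * \<psi> (a j i one))"
    if \<psi>: "lin s (*) \<psi>" and i: "i \<in> B" for \<psi> i r
  proof -
    have lin_conv: "lin s (*) (conv \<psi> (\<kappa> i))" by (intro lin_conv \<psi> co.\<kappa>_lin)
    have "ssum (D r) (\<lambda>u v. \<psi> u * G i v) = conv \<psi> (G i) r"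
      by (simp add: conv_def)
    also have "\<dots> = conv \<psi> (\<kappa> i) (rslice f r)"
      unfolding form_rslice[OF lin_conv] by (simp add: G_def conv_assoc \<psi> co.\<kappa>_lin f)
    also have "\<dots> = (\<Sum>j\<in>B. G j r * conv \<psi> (\<kappa> i) j)"
      by (subst co.expansion[OF image, symmetric])
        (simp add: lin_sum[OF lin_conv] lin_scale[OF lin_conv] G_slice)
    also have "\<dots> = (\<Sum>j\<in>B. G j r * \<psi> (a j i one))"
      using i by (intro sum.cong refl)
        (simp add: a_one co.coeff_def lin_ssum_out[OF \<psi>] lin_scale[OF \<psi>] conv_def mult.commute)
    finally show ?thesis .
  qed
  have "\<exists>i\<in>B. G i x0 \<noteq> 0"
  proof (rule ccontr)
    assume "\<not> ?thesis"
    then have "rslice f x0 = 0"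
      using co.expansion[OF image[of x0]] by (simp add: G_slice)
    then have "f x0 = 0"
      using form_rslice[OF eps_lin, of f x0] f(1) by (simp add: lin_zero[OF eps_lin])
    then show False using f(2) by simp
  qed
  then obtain i0 where "i0 \<in> B" "G i0 x0 \<noteq> 0" by blast
  from twisted_integral[OF co.finite_B a c b ac cb G_lin Gcom this]
  show ?thesis .
qed

section \<open>Subcoalgebras and the coradical filtration\<close>

context coalgebra begin

abbreviation "pairs x \<equiv> tensor_pairs scale (comul x)"

lemma is_vector_space: "vector_space scale" ..

lemma lin_pairs:
  "vector_space t \<Longrightarrow> bilin scale scale t F \<Longrightarrow> lin r scale g \<Longrightarrow> lin r t (\<lambda>x. ssum (pairs (g x)) F)"
  using lin_comp[OF tensor_linear_lin[OF _ comul_linear]] by metis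

lemma coassoc_pairs:
  assumes t: "vector_space t" and T: "trilin scale scale scale t T"
  shows "ssum (pairs x) (\<lambda>a b. ssum (pairs a) (\<lambda>a1 a2. T a1 a2 b)) =
      ssum (pairs x) (\<lambda>a b. ssum (pairs b) (\<lambda>b1 b2. T a b1 b2))"
proof -
  interpret t: vector_space t by fact
  let ?T = "\<lambda>(a, b, c). T a b c"
  have B: "bilin scale scale t (\<lambda>a1 a2. T a1 a2 b)" "bilin scale scale t (\<lambda>b1 b2. T a b1 b2)" for a b
    by (intro lin_intros trilin_comps[OF T])+
  have L: "fsum t ?T (sweedler (comul a) (\<lambda>(a1, a2). frag_of (a1, a2, b))) =
      ssum (pairs a) (\<lambda>a1 a2. T a1 a2 b)" for a b
    using B by (subst fsum_sweedler[OF t]) simp_all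
  have R: "fsum t ?T (sweedler (comul b) (\<lambda>(b1, b2). frag_of (a, b1, b2))) =
      ssum (pairs b) (\<lambda>b1 b2. T a b1 b2)" for a b
    using B by (subst fsum_sweedler[OF t]) simp_all
  have "ssum (pairs x) (\<lambda>a b. ssum (pairs a) (\<lambda>a1 a2. T a1 a2 b)) = fsum t ?T
    (sweedler (comul x) (\<lambda>(a, b). sweedler (comul a) (\<lambda>(a1, a2). frag_of (a1, a2, b))))"
    by (subst fsum_sweedler[OF t, where ?s1.0=scale and ?s2.0=scale]; simp add: L)
      (intro lin_intros lin_pairs t trilin_comps[OF T])
  also have "\<dots> = fsum t ?T
    (sweedler (comul x) (\<lambda>(a, b). sweedler (comul b) (\<lambda>(b1, b2). frag_of (a, b1, b2))))"
    by (rule tensor3_class_eqD[OF t comul_coassoc T])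
  also have "\<dots> = ssum (pairs x) (\<lambda>a b. ssum (pairs b) (\<lambda>b1 b2. T a b1 b2))"
    by (subst fsum_sweedler[OF t, where ?s1.0=scale and ?s2.0=scale]; simp add: R)
      (intro lin_intros lin_pairs t trilin_comps[OF T])
  finally show ?thesis .
qed

lemma counit_lin: "lin scale (*) counit"
  using counit_linear by (rule linear_imp_lin)

sublocale pc: pair_coalgebra scale pairs counit
proof unfold_locales
  fix f x assume f: "lin scale (*) f"
  have "ssum (pairs x) (\<lambda>a b. scale (counit a) b) = x"
    by (subst counit_left[symmetric], subst contract_eq_ssum[of scale scale])
      (intro lin_intros counit_lin is_vector_space | simp)+
  then have "f x = f (ssum (pairs x) (\<lambda>a b. scale (counit a) b))" by simp
  then show "ssum (pairs x) (\<lambda>a b. counit a * f b) = f x"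
    by (simp add: lin_ssum_out[OF f] lin_scale[OF f])
  have "ssum (pairs x) (\<lambda>a b. scale (counit b) a) = x"
    by (subst counit_right[symmetric], subst contract_eq_ssum[of scale scale])
      (intro lin_intros counit_lin is_vector_space | simp)+
  then have "f x = f (ssum (pairs x) (\<lambda>a b. scale (counit b) a))" by simp
  then show "ssum (pairs x) (\<lambda>a b. f a * counit b) = f x"
    by (simp add: lin_ssum_out[OF f] lin_scale[OF f] mult.commute)
qed (rule counit_lin | rule lin_pairs, rule vector_space_field, assumption, rule lin_id |
    rule coassoc_pairs, rule vector_space_field, assumption)+

end

text \<open>Equality of the tensors represented by two formal combinations.\<close>

context
  fixes s1 :: "'k::field \<Rightarrow> 'a::ab_group_add \<Rightarrow> 'a" and s2 :: "'k \<Rightarrow> 'b::ab_group_add \<Rightarrow> 'b"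
begin

definition teq :: "('a \<times> 'b \<Rightarrow>\<^sub>0 int) \<Rightarrow> ('a \<times> 'b \<Rightarrow>\<^sub>0 int) \<Rightarrow> bool"
  where "teq p q \<longleftrightarrow> p - q \<in> tensor_null s1 s2"

lemma teq_refl: "teq p p"
  by (simp add: teq_def tensor_null.zero)

lemma teq_sym: "teq p q \<Longrightarrow> teq q p"
  unfolding teq_def using tensor_null.diff[OF tensor_null.zero, of "p - q" s1 s2] by simp

lemma teq_trans [trans]: "teq p q \<Longrightarrow> teq q r \<Longrightarrow> teq p r"
  unfolding teq_def
  using tensor_null.diff[of "p - q" s1 s2 "r - q"] teq_sym[of q r] by (simp add: teq_def)

lemma teq_add: "teq p q \<Longrightarrow> teq p' q' \<Longrightarrow> teq (p + p') (q + q')"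
proof -
  assume a: "teq p q" "teq p' q'"
  then have "teq q' p'" by (simp add: teq_sym)
  then have "(p - q) - (q' - p') \<in> tensor_null s1 s2"
    using a(1) tensor_null.diff unfolding teq_def by blast
  then show ?thesis by (simp add: teq_def algebra_simps)
qed

lemma teq_sum: "(\<And>i. i \<in> I \<Longrightarrow> teq (f i) (g i)) \<Longrightarrow> teq (sum f I) (sum g I)"
  by (induction I rule: infinite_finite_induct) (simp_all add: teq_refl teq_add)

lemma teq_add_left: "teq (frag_of (a + a', b)) (frag_of (a, b) + frag_of (a', b))"
  using tensor_null.add1[of a a' b s1 s2] by (simp add: teq_def algebra_simps)

lemma teq_add_right: "teq (frag_of (a, b + b')) (frag_of (a, b) + frag_of (a, b'))"
  using tensor_null.add2[of a b b' s1 s2] by (simp add: teq_def algebra_simps)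

lemma teq_balance: "teq (frag_of (s1 c a, b)) (frag_of (a, s2 c b))"
  by (simp add: teq_def tensor_null.balance)

lemma teq_cancel: "teq p (p + q) \<Longrightarrow> teq q 0"
  using tensor_null.diff[OF tensor_null.zero, of "- q" s1 s2] by (simp add: teq_def)

lemma teq_zero_left: "teq (frag_of (0, b)) 0"
  using teq_add_left[of 0 0 b] by (auto intro: teq_cancel)

lemma teq_zero_right: "teq (frag_of (a, 0)) 0"
  using teq_add_right[of a 0 0] by (auto intro: teq_cancel)

lemma teq_sum_left: "teq (frag_of (\<Sum>i\<in>I. f i, b)) (\<Sum>i\<in>I. frag_of (f i, b))"
proof (induction I rule: infinite_finite_induct)
  case (insert i I)
  then show ?case
    using teq_trans[OF teq_add_left teq_add[OF teq_refl insert.IH]] by simp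
qed (simp_all add: teq_zero_left)

lemma teq_sum_right: "teq (frag_of (a, \<Sum>i\<in>I. f i)) (\<Sum>i\<in>I. frag_of (a, f i))"
proof (induction I rule: infinite_finite_induct)
  case (insert i I)
  then show ?case
    using teq_trans[OF teq_add_right teq_add[OF teq_refl insert.IH]] by simp
qed (simp_all add: teq_zero_right)

lemma teq_of_int:
  assumes "vector_space s2"
  shows "teq (frag_cmul n (frag_of (a, b))) (frag_of (a, s2 (of_int n) b))"
proof -
  interpret vector_space s2 by fact
  show ?thesis
  proof (induction n rule: int_induct[where k = 0])
    case base
    then show ?case by (simp add: teq_sym[OF teq_zero_right])
  next
    case (step1 n)
    have "teq (frag_cmul n (frag_of (a, b)) + frag_of (a, b)) (frag_of (a, s2 (of_int n) b) + frag_of (a, b))"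
      by (intro teq_add step1 teq_refl)
    also have "teq \<dots> (frag_of (a, s2 (of_int n) b + b))"
      by (rule teq_sym[OF teq_add_right])
    finally show ?case by (simp add: frag_cmul_distrib scale_left_distrib)
  next
    case (step2 n)
    have "teq (frag_cmul (n - 1) (frag_of (a, b)) + frag_of (a, b)) (frag_of (a, s2 (of_int (n - 1)) b) + frag_of (a, b))"
    proof -
      have "teq (frag_cmul (n - 1) (frag_of (a, b)) + frag_of (a, b)) (frag_cmul n (frag_of (a, b)))"
        by (simp add: frag_cmul_diff_distrib teq_refl)
      also have "teq \<dots> (frag_of (a, s2 (of_int n) b))" by (rule step2)
      also have "frag_of (a, s2 (of_int n) b) = frag_of (a, s2 (of_int (n - 1)) b + b)"
        by (simp add: scale_left_diff_distrib)
      also have "teq \<dots> (frag_of (a, s2 (of_int (n - 1)) b) + frag_of (a, b))" by (rule teq_add_right)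
      finally show ?thesis .
    qed
    then show ?case by (simp add: teq_def)
  qed
qed

end

context coalgebra begin

lemma mem_comul_iff: "p \<in> comul x \<longleftrightarrow> teq scale scale (tensor_rep (comul x)) p"
proof -
  have "comul x \<in> tensor scale scale"
    using comul_linear by (simp add: tensor_linear_def)
  then obtain q where q: "comul x = tensor_class scale scale q"
    unfolding tensor_def tensor_class_def by (elim quotientE)
  have 1: "p \<in> comul x \<longleftrightarrow> teq scale scale q p" for p
    by (simp add: q tensor_class_def tensor_rel_def teq_def)
  have "teq scale scale q (tensor_rep (comul x))"
    using tensor_rep_class[of q scale scale] by (simp add: q teq_def)
  then show ?thesis
    unfolding 1 using teq_trans teq_sym by blast
qed

lemma ssum_pairs_mem:
  assumes "p \<in> comul x" "vector_space t" "bilin scale scale t F"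
  shows "ssum (pairs x) F = fsum t (\<lambda>(a, b). F a b) p"
proof -
  interpret t: vector_space t by fact
  have "tensor_rep (comul x) - p \<in> tensor_null scale scale"
    using assms(1) by (simp add: mem_comul_iff teq_def)
  from fsum_tensor_null[OF assms(2) this assms(3)] show ?thesis
    by (simp add: ssum_tensor_pairs[OF assms(3)] t.fsum_diff)
qed

lemma fsum_in_subspace:
  assumes "subspace V" "\<And>t. t \<in> Poly_Mapping.keys p \<Longrightarrow> F t \<in> V"
  shows "fsum scale F p \<in> V"
  unfolding fsum_def using assms by (intro subspace_sum subspace_scale)

lemma subcoalgebra_imp_stable:
  assumes "subcoalgebra scale comul V"
  shows "pc.stable V"
  unfolding pc.stable_def
proof (intro conjI allI impI)
  show V: "subspace V" using assms by (simp add: subcoalgebra_def)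
  fix f x assume f: "lin scale (*) f" and x: "x \<in> V"
  obtain p where p: "p \<in> comul x" "Poly_Mapping.keys p \<subseteq> V \<times> V"
    using assms x by (auto simp: subcoalgebra_def)
  have "pc.lslice f x = fsum scale (\<lambda>(a, b). scale (f a) b) p"
    unfolding pc.lslice_def by (intro ssum_pairs_mem p is_vector_space lin_intros f)
  also have "\<dots> \<in> V"
    using p V by (intro fsum_in_subspace) (auto intro: subspace_scale)
  finally show "pc.lslice f x \<in> V" .
  have "pc.rslice f x = fsum scale (\<lambda>(a, b). scale (f b) a) p"
    unfolding pc.rslice_def by (intro ssum_pairs_mem p is_vector_space lin_intros f)
  also have "\<dots> \<in> V"
    using p V by (intro fsum_in_subspace) (auto intro: subspace_scale)
  finally show "pc.rslice f x \<in> V" .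
qed

text \<open>
  Extend a basis \<open>C\<close> of \<open>V\<close> to a basis of the coalgebra and expand the first factors of the
  comultiplication of \<open>x\<close> in it. The second factor that belongs to a basis vector \<open>c\<close> is a slice of \<open>x\<close>,
  so it lies in \<open>V\<close>, and it vanishes unless \<open>c\<close> belongs to \<open>C\<close>.
\<close>
lemma stable_imp_subcoalgebra:
  assumes "pc.stable V"
  shows "subcoalgebra scale comul V"
  unfolding subcoalgebra_def
proof (intro conjI ballI)
  show V: "subspace V" using assms by (rule pc.stable_subspace)
  fix x assume x: "x \<in> V"
  obtain C where C: "C \<subseteq> V" "independent C" "V \<subseteq> span C"
    using maximal_independent_subset[of V] by blast
  obtain C' where C': "C \<subseteq> C'" "independent C'" "span C' = UNIV"
    using maximal_independent_subset_extend[OF subset_UNIV C(2)] by (metis top.extremum_uniqueI)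
  define r where "r = representation C'"
  have r_lin: "lin scale (*) (\<lambda>x. r x c)" for c
    unfolding r_def by (rule linear_imp_lin) (rule linear_representation[OF C'(2,3)])
  have r0: "r v c = 0" if "v \<in> V" "c \<notin> C" for v c
  proof -
    have "representation C' v = representation C v"
      using C C' that by (intro representation_extend) auto
    then show ?thesis
      using that representation_ne_zero[of C v c] by (auto simp: r_def)
  qed
  let ?q = "tensor_rep (comul x)"
  let ?n = "Poly_Mapping.lookup ?q"
  obtain K where finK: "finite K" and K: "\<forall>a\<in>fst ` Poly_Mapping.keys ?q. a = (\<Sum>c\<in>K. scale (r a c) c)"
    using finite_basis_expansion[OF C'(2,3), of "fst ` Poly_Mapping.keys ?q"] by (auto simp: r_def)
  then have expand: "a = (\<Sum>c\<in>K. scale (r a c) c)" if "(a, b) \<in> Poly_Mapping.keys ?q" for a b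
    using that by force
  have slice: "(\<Sum>t\<in>Poly_Mapping.keys ?q. scale (of_int (?n t)) (scale (r (fst t) c) (snd t)))
      = pc.lslice (\<lambda>x. r x c) x" for c
    unfolding pc.lslice_def
    by (subst ssum_tensor_pairs[of scale scale scale]) (intro lin_intros r_lin is_vector_space, simp add: fsum_def case_prod_unfold)
  have "teq scale scale ?q (\<Sum>t\<in>Poly_Mapping.keys ?q. frag_cmul (?n t) (frag_of t))"
    using frag_expansion[of ?q] by (simp add: frag_extend_def teq_refl)
  also have "teq scale scale \<dots> (\<Sum>t\<in>Poly_Mapping.keys ?q. \<Sum>c\<in>K.
      frag_of (c, scale (of_int (?n t)) (scale (r (fst t) c) (snd t))))"
  proof (rule teq_sum)
    fix t assume "t \<in> Poly_Mapping.keys ?q"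
    then obtain a b where t: "t = (a, b)" "(a, b) \<in> Poly_Mapping.keys ?q" by (cases t) auto
    have "teq scale scale (frag_cmul (?n t) (frag_of t)) (frag_of (a, scale (of_int (?n t)) b))"
      unfolding t(1) by (rule teq_of_int[OF is_vector_space])
    also have "frag_of (a, scale (of_int (?n t)) b) =
        frag_of (\<Sum>c\<in>K. scale (r a c) c, scale (of_int (?n t)) b)"
      using expand[OF t(2)] by simp
    also have "teq scale scale \<dots> (\<Sum>c\<in>K. frag_of (scale (r a c) c, scale (of_int (?n t)) b))"
      by (rule teq_sum_left)
    also have "teq scale scale \<dots> (\<Sum>c\<in>K. frag_of (c, scale (r a c) (scale (of_int (?n t)) b)))"
      by (intro teq_sum teq_balance)
    finally show "teq scale scale (frag_cmul (?n t) (frag_of t))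
        (\<Sum>c\<in>K. frag_of (c, scale (of_int (?n t)) (scale (r (fst t) c) (snd t))))"
      by (simp add: t(1) mult.commute)
  qed
  also have "(\<Sum>t\<in>Poly_Mapping.keys ?q. \<Sum>c\<in>K.
      frag_of (c, scale (of_int (?n t)) (scale (r (fst t) c) (snd t)))) =
    (\<Sum>c\<in>K. \<Sum>t\<in>Poly_Mapping.keys ?q. frag_of (c, scale (of_int (?n t)) (scale (r (fst t) c) (snd t))))"
    by (rule sum.swap)
  also have "teq scale scale \<dots> (\<Sum>c\<in>K. frag_of (c, pc.lslice (\<lambda>x. r x c) x))"
    unfolding slice[symmetric] by (intro teq_sum teq_sym[OF teq_sum_right])
  also have "(\<Sum>c\<in>K. frag_of (c, pc.lslice (\<lambda>x. r x c) x)) =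
      (\<Sum>c\<in>K \<inter> C. frag_of (c, pc.lslice (\<lambda>x. r x c) x)) + (\<Sum>c\<in>K - C. frag_of (c, pc.lslice (\<lambda>x. r x c) x))"
    using finK by (subst sum.union_disjoint[symmetric]) (auto intro!: sum.cong)
  also have "teq scale scale \<dots> ((\<Sum>c\<in>K \<inter> C. frag_of (c, pc.lslice (\<lambda>x. r x c) x)) + (\<Sum>c\<in>K - C. 0))"
  proof (intro teq_add teq_refl teq_sum)
    fix c assume c: "c \<in> K - C"
    have "pc.lslice (\<lambda>x. r x c) x = 0"
    proof (rule separating_forms[OF is_vector_space])
      fix g assume g: "lin scale (*) g"
      have "g (pc.lslice (\<lambda>x. r x c) x) = r (pc.rslice g x) c"
        using g by (simp add: pc.form_lslice pc.form_rslice[OF r_lin])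
      also have "\<dots> = 0"
        using c r0 pc.stable_rslice[OF assms g x] by simp
      finally show "g (pc.lslice (\<lambda>x. r x c) x) = g 0" by (simp add: lin_zero[OF g])
    qed
    then show "teq scale scale (frag_of (c, pc.lslice (\<lambda>x. r x c) x)) 0"
      by (simp add: teq_zero_right)
  qed
  finally have "(\<Sum>c\<in>K \<inter> C. frag_of (c, pc.lslice (\<lambda>x. r x c) x)) \<in> comul x"
    by (simp add: mem_comul_iff)
  moreover have "Poly_Mapping.keys (\<Sum>c\<in>K \<inter> C. frag_of (c, pc.lslice (\<lambda>x. r x c) x)) \<subseteq> V \<times> V"
  proof -
    have "Poly_Mapping.keys (\<Sum>c\<in>K \<inter> C. frag_of (c, pc.lslice (\<lambda>x. r x c) x)) \<subseteq>
        (\<Union>c\<in>K \<inter> C. Poly_Mapping.keys (frag_of (c, pc.lslice (\<lambda>x. r x c) x)))"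
      by (rule keys_sum)
    also have "\<dots> \<subseteq> V \<times> V"
      using C(1) pc.stable_lslice[OF assms r_lin x] by auto
    finally show ?thesis .
  qed
  ultimately show "\<exists>p\<in>comul x. Poly_Mapping.keys p \<subseteq> V \<times> V" by blast
qed

lemma subcoalgebra_iff_stable: "subcoalgebra scale comul V \<longleftrightarrow> pc.stable V"
  using subcoalgebra_imp_stable stable_imp_subcoalgebra by blast

lemma coradical_eq: "coradical scale comul = pc.corad"
  by (simp add: coradical_def pc.corad_def simple_subcoalgebra_def pc.simple_stable_def
    subcoalgebra_iff_stable)

definition radical_form :: "('a \<Rightarrow> 'k) \<Rightarrow> bool"
  where "radical_form g \<longleftrightarrow> lin scale (*) g \<and> (\<forall>x\<in>pc.corad. g x = 0)"

lemma lin_foldr_conv: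
  assumes "\<forall>g\<in>set gs. radical_form g"
  shows "lin scale (*) (foldr pc.conv gs counit)"
  using assms by (induction gs) (auto simp: radical_form_def counit_lin intro: pc.lin_conv)

lemma foldr_conv_snoc:
  assumes "\<forall>g\<in>set gs. radical_form g" "radical_form h"
  shows "pc.conv (foldr pc.conv gs counit) h = foldr pc.conv (gs @ [h]) counit"
  using assms(1)
proof (induction gs)
  case Nil
  then show ?case using assms(2) by (simp add: radical_form_def)
next
  case (Cons g gs)
  then show ?case
    using assms(2) by (simp add: pc.conv_assoc lin_foldr_conv radical_form_def)
qed

text \<open>
  A product \<open>g h\<close> evaluated on the wedge of the coradical and \<open>R\<^sub>n\<close> vanishes if \<open>g\<close> kills the coradical
  and \<open>h\<close> kills \<open>R\<^sub>n\<close>.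
\<close>
lemma radical_products_vanish:
  assumes "length gs = Suc n" "\<forall>g\<in>set gs. radical_form g" "x \<in> coradical_filtration scale comul n"
  shows "foldr pc.conv gs counit x = 0"
  using assms
proof (induction n arbitrary: gs x)
  case 0
  then obtain g where "gs = [g]" by (cases gs) auto
  with 0 show ?case by (auto simp: radical_form_def coradical_eq)
next
  case (Suc n)
  then obtain g hs where gs: "gs = g # hs" "length hs = Suc n" by (cases gs) auto
  let ?h = "foldr pc.conv hs counit"
  have h: "lin scale (*) ?h" and g: "lin scale (*) g" "\<forall>x\<in>pc.corad. g x = 0"
    using Suc.prems(2) gs by (auto simp: radical_form_def intro: lin_foldr_conv)
  obtain p where p: "p \<in> comul x" "Poly_Mapping.keys p \<subseteq>
      pc.corad \<times> UNIV \<union> UNIV \<times> coradical_filtration scale comul n"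
    using Suc.prems(3) by (auto simp: wedge_def coradical_eq)
  have "pc.conv g ?h x = fsum (*) (\<lambda>(a, b). g a * ?h b) p"
    unfolding pc.conv_def[of g] by (intro ssum_pairs_mem p lin_intros g h)
  also have "\<dots> = 0"
    unfolding fsum_def
  proof (intro sum.neutral ballI)
    fix t assume "t \<in> Poly_Mapping.keys p"
    moreover have "?h b = 0" if "b \<in> coradical_filtration scale comul n" for b
      using Suc.IH[OF gs(2) _ that] Suc.prems(2) gs(1) by simp
    ultimately show "of_int (Poly_Mapping.lookup p t) * (case t of (a, b) \<Rightarrow> g a * ?h b) = 0"
      using p(2) g(2) by (cases t) auto
  qed
  finally show ?case by (simp add: gs(1))
qed

text \<open>
  The empty product of radical forms is the counit, which is not zero, and long products vanish. So
  there is a non-zero product that vanishes after multiplication by any further radical form.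
\<close>
lemma radical_annihilated_form:
  assumes fin: "finite_coradical_filtration scale comul" and nz: "counit x0 \<noteq> 0"
  shows "\<exists>f x. lin scale (*) f \<and> f x \<noteq> 0 \<and>
    (\<forall>g. radical_form g \<longrightarrow> pc.conv g f = (\<lambda>x. 0) \<and> pc.conv f g = (\<lambda>x. 0))"
proof -
  define P where "P = (\<lambda>n. \<exists>gs x. length gs = n \<and> (\<forall>g\<in>set gs. radical_form g) \<and> foldr pc.conv gs counit x \<noteq> 0)"
  obtain N where N: "coradical_filtration scale comul N = UNIV"
    using fin by (auto simp: finite_coradical_filtration_def)
  have "\<not> P (Suc N)"
    using radical_products_vanish[of _ N] N by (auto simp: P_def)
  moreover have "P 0" using nz by (auto simp: P_def)
  ultimately obtain n where n: "P n" "\<not> P (Suc n)"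
    by (metis nat_induct)
  then obtain gs x where gs: "length gs = n" "\<forall>g\<in>set gs. radical_form g" "foldr pc.conv gs counit x \<noteq> 0"
    by (auto simp: P_def)
  have "pc.conv g (foldr pc.conv gs counit) = (\<lambda>x. 0)" "pc.conv (foldr pc.conv gs counit) g = (\<lambda>x. 0)"
    if g: "radical_form g" for g
  proof -
    have "foldr pc.conv (g # gs) counit y = 0" for y
      using n(2) gs(1,2) g unfolding P_def by (metis length_Cons set_ConsD)
    then show "pc.conv g (foldr pc.conv gs counit) = (\<lambda>x. 0)" by (simp add: fun_eq_iff)
    have "foldr pc.conv (gs @ [g]) counit y = 0" for y
      using n(2) gs(1,2) g unfolding P_def
      by (metis length_append_singleton rotate1.simps(2) set_ConsD set_rotate1)
    then show "pc.conv (foldr pc.conv gs counit) g = (\<lambda>x. 0)"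
      using foldr_conv_snoc[OF gs(2) g] by (simp add: fun_eq_iff)
  qed
  then show ?thesis
    using gs(3) lin_foldr_conv[OF gs(2)] by blast
qed

end

section \<open>Antipodes reverse products\<close>
context unital_algebra begin

lemma is_vector_space_alg: "vector_space scale" ..

lemma lin_times_left: "lin s scale f \<Longrightarrow> lin s scale (\<lambda>x. f x * c)"
  by (simp add: lin_def algebra_simps scale_mult_left)

lemma lin_times_right: "lin s scale f \<Longrightarrow> lin s scale (\<lambda>x. c * f x)"
  by (simp add: lin_def algebra_simps scale_mult_right)

lemma ssum_times_left: "ssum L F * c = ssum L (\<lambda>a b. F a b * c)" for c :: 'a
  by (induction L) (auto simp: algebra_simps)

lemma ssum_times_right: "c * ssum L F = ssum L (\<lambda>a b. c * F a b)" for c :: 'a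
  by (induction L) (auto simp: algebra_simps)

end

context hopf_algebra begin

lemma antipode_lin: "lin scale scale antipode"
  using antipode_linear by (rule linear_imp_lin)

lemmas hopf_lins = is_vector_space_alg lin_times_left lin_times_right lin_comp[OF antipode_lin] lin_comp[OF counit_lin]
  lin_pairs

lemma ssum_comul_mult:
  assumes t: "vector_space t" and F: "bilin scale scale t F"
  shows "ssum (pairs (x * y)) F = ssum (pairs x) (\<lambda>a b. ssum (pairs y) (\<lambda>c d. F (a * c) (b * d)))"
proof -
  interpret t: vector_space t by fact
  let ?F = "\<lambda>(a, b). F a b"
  have 1: "fsum t ?F (sweedler (comul y) (\<lambda>(c, d). frag_of (a * c, b * d))) =
      ssum (pairs y) (\<lambda>c d. F (a * c) (b * d))" for a b
    by (subst fsum_sweedler[OF t, where ?s1.0=scale and ?s2.0=scale]; simp)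
      (intro lin_intros hopf_lins bilin_comps[OF F])
  show ?thesis
    unfolding ssum_tensor_class[OF t F comul_mult]
    by (subst fsum_sweedler[OF t, where ?s1.0=scale and ?s2.0=scale]; simp add: 1)
      (intro lin_intros hopf_lins t bilin_comps[OF F])
qed

lemma ssum_antipode_left: "ssum (pairs x) (\<lambda>a b. antipode a * b) = scale (counit x) 1"
  by (subst antipode_left[symmetric], subst contract_eq_ssum[of scale scale])
    (intro lin_intros hopf_lins, rule refl)

lemma ssum_antipode_right: "ssum (pairs x) (\<lambda>a b. a * antipode b) = scale (counit x) 1"
  by (subst antipode_right[symmetric], subst contract_eq_ssum[of scale scale])
    (intro lin_intros hopf_lins, rule refl)

lemma antipode_one: "antipode 1 = 1"
proof -
  have "ssum (pairs 1) (\<lambda>a b. antipode a * b) = antipode 1 * 1"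
    by (subst ssum_tensor_class[OF is_vector_space_alg _ comul_one]) (intro lin_intros hopf_lins, simp)
  then show ?thesis
    using ssum_antipode_left[of 1] by (simp add: counit_one)
qed

text \<open>
  The antipode is the convolution inverse of the identity. Evaluate
  \<open>S(x\<^sub>1 y) x\<^sub>2 S(x\<^sub>3)\<close> in two ways: cancelling \<open>x\<^sub>2 S(x\<^sub>3)\<close> gives \<open>S(x y)\<close>, and the identity
  \<open>S(x\<^sub>1 y) x\<^sub>2 = \<epsilon>(x) S(y)\<close> gives \<open>S(y) S(x)\<close>. That identity follows from the antipode axiom for the
  product \<open>x y\<close>, multiplied on the right by \<open>S(y)\<close>. The same scheme works in the braided case.
\<close>

lemma antipode_mult: "antipode (x * y) = antipode y * antipode x"
proof -
  let ?S = antipode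
  note lins = lin_intros hopf_lins
  have star: "ssum (pairs x) (\<lambda>x1 x2. ssum (pairs y) (\<lambda>y1 y2. ?S (x1 * y1) * x2 * y2)) =
      scale (counit x) (scale (counit y) 1)" for x y
    using ssum_antipode_left[of "x * y"]
    by (subst (asm) ssum_comul_mult[OF is_vector_space_alg]) (intro lins, simp add: counit_mult mult.assoc)
  have star2: "ssum (pairs x) (\<lambda>x1 x2. ?S (x1 * y) * x2) = scale (counit x) (?S y)" for x y
  proof -
    have "ssum (pairs x) (\<lambda>x1 x2. ?S (x1 * y) * x2) =
      ssum (pairs y) (\<lambda>y1 y'. scale (counit y') (ssum (pairs x) (\<lambda>x1 x2. ?S (x1 * y1) * x2)))"
      by (rule pc.counit_right_vec[symmetric]) (intro lins)+
    also have "\<dots> = ssum (pairs y) (\<lambda>y1 y'. ssum (pairs y') (\<lambda>y2 y3.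
        ssum (pairs x) (\<lambda>x1 x2. ?S (x1 * y1) * x2 * y2) * ?S y3))"
    proof (rule ssum_cong)
      fix y1 y'
      have "ssum (pairs y') (\<lambda>y2 y3. ssum (pairs x) (\<lambda>x1 x2. ?S (x1 * y1) * x2 * y2) * ?S y3) =
        ssum (pairs x) (\<lambda>x1 x2. ?S (x1 * y1) * x2 * ssum (pairs y') (\<lambda>y2 y3. y2 * ?S y3))"
        by (simp add: ssum_times_left ssum_times_right mult.assoc ssum_swap[of "pairs y'"])
      then show "scale (counit y') (ssum (pairs x) (\<lambda>x1 x2. ?S (x1 * y1) * x2)) =
        ssum (pairs y') (\<lambda>y2 y3. ssum (pairs x) (\<lambda>x1 x2. ?S (x1 * y1) * x2 * y2) * ?S y3)"
        by (simp add: ssum_antipode_right scale_mult_right lin_ssum_out[OF lin_scale_right[OF is_vector_space_alg lin_id]])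
    qed
    also have "\<dots> = ssum (pairs y) (\<lambda>y' y3. ssum (pairs y') (\<lambda>y1 y2.
        ssum (pairs x) (\<lambda>x1 x2. ?S (x1 * y1) * x2 * y2) * ?S y3))"
      by (rule pc.coassoc_vec[OF is_vector_space_alg, symmetric]) (intro lins)+
    also have "\<dots> = ssum (pairs y) (\<lambda>y' y3. scale (counit x) (scale (counit y') (?S y3)))"
    proof (rule ssum_cong)
      fix y' y3
      have "ssum (pairs y') (\<lambda>y1 y2. ssum (pairs x) (\<lambda>x1 x2. ?S (x1 * y1) * x2 * y2)) =
          scale (counit x) (scale (counit y') 1)"
        unfolding star[symmetric] by (rule ssum_swap)
      then show "ssum (pairs y') (\<lambda>y1 y2. ssum (pairs x) (\<lambda>x1 x2. ?S (x1 * y1) * x2 * y2) * ?S y3) =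
          scale (counit x) (scale (counit y') (?S y3))"
        by (simp add: scale_mult_left flip: ssum_times_left)
    qed
    also have "\<dots> = scale (counit x) (?S y)"
      by (subst lin_ssum_out[OF lin_scale_right[OF is_vector_space_alg lin_id], symmetric],
        subst pc.counit_left_vec[OF is_vector_space_alg antipode_lin], rule refl)
    finally show ?thesis .
  qed
  have "?S (x * y) = ssum (pairs x) (\<lambda>x1 x'. scale (counit x') (?S (x1 * y)))"
    by (rule pc.counit_right_vec[symmetric]) (intro lins)+
  also have "\<dots> = ssum (pairs x) (\<lambda>x1 x'. ssum (pairs x') (\<lambda>x2 x3. ?S (x1 * y) * x2 * ?S x3))"
    by (simp add: mult.assoc ssum_antipode_right scale_mult_right flip: ssum_times_right)
  also have "\<dots> = ssum (pairs x) (\<lambda>x' x3. ssum (pairs x') (\<lambda>x1 x2. ?S (x1 * y) * x2 * ?S x3))"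
    by (rule pc.coassoc_vec[OF is_vector_space_alg, symmetric]) (intro lins)+
  also have "\<dots> = ssum (pairs x) (\<lambda>x' x3. scale (counit x') (?S y * ?S x3))"
    by (simp add: star2 scale_mult_left flip: ssum_times_left)
  also have "\<dots> = ?S y * ?S x"
    by (rule pc.counit_left_vec) (intro lins)+
  finally show ?thesis .
qed

end

context yetter_drinfeld_module begin

abbreviation "dC v \<equiv> tensor_pairs sH (coact v)"

lemma lin_act_left: "lin s sH g \<Longrightarrow> lin s sV (\<lambda>x. act (g x) v)"
  using linear_imp_lin[OF act_linear_left] by (rule lin_comp)

lemma lin_act_right: "lin s sV g \<Longrightarrow> lin s sV (\<lambda>x. act h (g x))"
  using linear_imp_lin[OF act_linear] by (rule lin_comp)

lemma is_vector_space_mod: "vector_space sV" ..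

lemma lin_dC: "vector_space t \<Longrightarrow> bilin sH sV t F \<Longrightarrow> lin r sV g \<Longrightarrow> lin r t (\<lambda>x. ssum (dC (g x)) F)"
  using lin_comp[OF tensor_linear_lin[OF _ coact_linear]] by metis

lemmas yd_lins = H.hopf_lins lin_act_left lin_act_right is_vector_space_mod lin_dC

sublocale com: left_comodule sH H.pairs counitH sV "\<lambda>v. tensor_pairs sH (coact v)"
proof unfold_locales
  fix F :: "'h \<Rightarrow> 'v \<Rightarrow> 'k" assume "bilin sH sV (*) F"
  then show "lin sV (*) (\<lambda>v. ssum (dC v) F)"
    by (rule lin_dC[OF vector_space_field _ lin_id])
next
  fix T :: "'h \<Rightarrow> 'h \<Rightarrow> 'v \<Rightarrow> 'k" and v assume T: "trilin sH sH sV (*) T"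
  note t = vector_space_field
  let ?T = "\<lambda>(a, b, c). T a b c"
  have L: "fsum (*) ?T (sweedler (comulH h) (\<lambda>(h1, h2). frag_of (h1, h2, w))) =
      ssum (H.pairs h) (\<lambda>h1 h2. T h1 h2 w)" for h w
    by (subst fsum_sweedler[OF t, where ?s1.0=sH and ?s2.0=sH]; simp add: vector_space.fsum_frag_of[OF t])
      (intro lin_intros trilin_comps[OF T])
  have R: "fsum (*) ?T (sweedler (coact w) (\<lambda>(g, u). frag_of (h, g, u))) =
      ssum (dC w) (\<lambda>g u. T h g u)" for h w
    by (subst fsum_sweedler[OF t, where ?s1.0=sH and ?s2.0=sV]; simp add: vector_space.fsum_frag_of[OF t])
      (intro lin_intros trilin_comps[OF T])
  have "ssum (dC v) (\<lambda>h w. ssum (H.pairs h) (\<lambda>h1 h2. T h1 h2 w)) = fsum (*) ?T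
     (sweedler (coact v) (\<lambda>(h, w). sweedler (comulH h) (\<lambda>(h1, h2). frag_of (h1, h2, w))))"
    by (subst fsum_sweedler[OF t, where ?s1.0=sH and ?s2.0=sV]; simp add: L)
      (intro lin_intros yd_lins trilin_comps[OF T])
  also have "\<dots> = fsum (*) ?T
     (sweedler (coact v) (\<lambda>(h, w). sweedler (coact w) (\<lambda>(g, u). frag_of (h, g, u))))"
    by (rule tensor3_class_eqD[OF t coact_coassoc T])
  also have "\<dots> = ssum (dC v) (\<lambda>h w. ssum (dC w) (\<lambda>g u. T h g u))"
    by (subst fsum_sweedler[OF t, where ?s1.0=sH and ?s2.0=sV]; simp add: R)
      (intro lin_intros yd_lins trilin_comps[OF T])
  finally show "ssum (dC v) (\<lambda>h w. ssum (H.pairs h) (\<lambda>h1 h2. T h1 h2 w)) =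
    ssum (dC v) (\<lambda>h w. ssum (dC w) (\<lambda>g u. T h g u))" .
next
  fix f :: "'v \<Rightarrow> 'k" and v assume f: "lin sV (*) f"
  have "ssum (dC v) (\<lambda>h w. sV (counitH h) w) = v"
    by (subst coact_counit[symmetric], subst contract_eq_ssum[of sH sV])
      (intro lin_intros H.counit_lin yd_lins, rule refl)
  then have "f v = f (ssum (dC v) (\<lambda>h w. sV (counitH h) w))" by simp
  then show "ssum (dC v) (\<lambda>h w. counitH h * f w) = f v"
    by (simp add: lin_ssum_out[OF f] lin_scale[OF f])
qed

end

context braided_hopf_algebra begin

abbreviation "dH h \<equiv> tensor_pairs sH (comulH h)"
abbreviation "dR x \<equiv> tensor_pairs sR (comul x)"

lemma antipode_lin: "lin sR sR antipode"
  using antipode_linear by (rule linear_imp_lin)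

lemmas blins = yd_lins R.is_vector_space_alg R.lin_times_left R.lin_times_right lin_comp[OF antipode_lin]
  lin_comp[OF R.counit_lin] R.lin_pairs

lemma ssum_comul_mult:
  assumes t: "vector_space t" and F: "bilin sR sR t F"
  shows "ssum (dR (x * y)) F = ssum (dR x) (\<lambda>a b. ssum (dR y) (\<lambda>c d.
    ssum (dC b) (\<lambda>h b0. F (a * act h c) (b0 * d))))"
proof -
  interpret t: vector_space t by fact
  let ?F = "\<lambda>(a, b). F a b"
  have 1: "fsum t (\<lambda>(c', b'). F (a * c') (b' * d)) (sweedler (coact b) (\<lambda>(h, v0). frag_of (act h c, v0))) =
      ssum (dC b) (\<lambda>h b0. F (a * act h c) (b0 * d))" for a b c d
    by (subst fsum_sweedler[OF t, where ?s1.0=sH and ?s2.0=sR]; simp)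
      (intro lin_intros blins bilin_comps[OF F])
  have 2: "fsum t ?F (frag_extend (\<lambda>(c', b'). frag_of (a * c', b' * d)) (braiding act coact b c)) =
      ssum (dC b) (\<lambda>h b0. F (a * act h c) (b0 * d))" for a b c d
    unfolding t.fsum_frag_extend braiding_def using 1[of a d b c] by (simp add: case_prod_unfold)
  have 3: "fsum t ?F (sweedler (comul y) (\<lambda>(c, d).
          frag_extend (\<lambda>(c', b'). frag_of (a * c', b' * d)) (braiding act coact b c))) =
      ssum (dR y) (\<lambda>c d. ssum (dC b) (\<lambda>h b0. F (a * act h c) (b0 * d)))" for a b
    by (subst fsum_sweedler[OF t, where ?s1.0=sR and ?s2.0=sR]; simp add: 2)
      (intro lin_intros blins t bilin_comps[OF F])
  show ?thesis
    unfolding ssum_tensor_class[OF t F comul_mult]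
    by (subst fsum_sweedler[OF t, where ?s1.0=sR and ?s2.0=sR]; simp add: 3)
      (intro lin_intros blins t bilin_comps[OF F])
qed

lemma ssum_comul_act:
  assumes t: "vector_space t" and F: "bilin sR sR t F"
  shows "ssum (dR (act h x)) F = ssum (dH h) (\<lambda>h1 h2. ssum (dR x) (\<lambda>a b. F (act h1 a) (act h2 b)))"
proof -
  interpret t: vector_space t by fact
  let ?F = "\<lambda>(a, b). F a b"
  have 1: "fsum t ?F (sweedler (comul x) (\<lambda>(a, b). frag_of (act h1 a, act h2 b))) =
      ssum (dR x) (\<lambda>a b. F (act h1 a) (act h2 b))" for h1 h2
    by (subst fsum_sweedler[OF t, where ?s1.0=sR and ?s2.0=sR]; simp)
      (intro lin_intros blins bilin_comps[OF F])
  show ?thesis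
    unfolding ssum_tensor_class[OF t F comul_act]
    by (subst fsum_sweedler[OF t, where ?s1.0=sH and ?s2.0=sH]; simp add: 1)
      (intro lin_intros blins t bilin_comps[OF F])
qed

lemma ssum_comul_coact:
  assumes t: "vector_space t" and T: "trilin sH sR sR t T"
  shows "ssum (dC x) (\<lambda>h w. ssum (dR w) (\<lambda>a b. T h a b)) =
    ssum (dR x) (\<lambda>a b. ssum (dC a) (\<lambda>g a0. ssum (dC b) (\<lambda>h b0. T (g * h) a0 b0)))"
proof -
  interpret t: vector_space t by fact
  let ?T = "\<lambda>(a, b, c). T a b c"
  have 1: "fsum t ?T (sweedler (comul w) (\<lambda>(a, b). frag_of (h, a, b))) =
      ssum (dR w) (\<lambda>a b. T h a b)" for h w
    by (subst fsum_sweedler[OF t, where ?s1.0=sR and ?s2.0=sR]; simp)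
      (intro lin_intros blins trilin_comps[OF T])
  have 2: "fsum t ?T (sweedler (coact b) (\<lambda>(h, b0). frag_of (g * h, a0, b0))) =
      ssum (dC b) (\<lambda>h b0. T (g * h) a0 b0)" for g a0 b
    by (subst fsum_sweedler[OF t, where ?s1.0=sH and ?s2.0=sR]; simp)
      (intro lin_intros blins trilin_comps[OF T])
  have 3: "fsum t ?T (sweedler (coact a) (\<lambda>(g, a0). sweedler (coact b) (\<lambda>(h, b0). frag_of (g * h, a0, b0)))) =
      ssum (dC a) (\<lambda>g a0. ssum (dC b) (\<lambda>h b0. T (g * h) a0 b0))" for a b
    by (subst fsum_sweedler[OF t, where ?s1.0=sH and ?s2.0=sR]; simp add: 2)
      (intro lin_intros blins t trilin_comps[OF T])
  have "ssum (dC x) (\<lambda>h w. ssum (dR w) (\<lambda>a b. T h a b)) = fsum t ?T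
      (sweedler (coact x) (\<lambda>(h, x0). sweedler (comul x0) (\<lambda>(a, b). frag_of (h, a, b))))"
    by (subst fsum_sweedler[OF t, where ?s1.0=sH and ?s2.0=sR]; simp add: 1)
      (intro lin_intros blins t trilin_comps[OF T])
  also have "\<dots> = fsum t ?T (sweedler (comul x) (\<lambda>(a, b).
           sweedler (coact a) (\<lambda>(g, a0). sweedler (coact b) (\<lambda>(h, b0). frag_of (g * h, a0, b0)))))"
    by (rule tensor3_class_eqD[OF t comul_coact T])
  also have "\<dots> = ssum (dR x) (\<lambda>a b. ssum (dC a) (\<lambda>g a0. ssum (dC b) (\<lambda>h b0. T (g * h) a0 b0)))"
    by (subst fsum_sweedler[OF t, where ?s1.0=sR and ?s2.0=sR]; simp add: 3)
      (intro lin_intros blins t trilin_comps[OF T])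
  finally show ?thesis .
qed

lemma ssum_coact_antipode:
  assumes t: "vector_space t" and F: "bilin sH sR t F"
  shows "ssum (dC (antipode x)) F = ssum (dC x) (\<lambda>h w. F h (antipode w))"
proof -
  interpret t: vector_space t by fact
  show ?thesis
    unfolding ssum_tensor_class[OF t F antipode_coact]
    by (subst fsum_sweedler[OF t, where ?s1.0=sH and ?s2.0=sR]; simp)
      (intro lin_intros blins t bilin_comps[OF F])
qed

lemma ssum_mult_act: "act h (x * y) = ssum (dH h) (\<lambda>h1 h2. act h1 x * act h2 y)"
  by (subst mult_act, subst contract_eq_ssum[of sH sH]) (intro lin_intros blins, rule refl)

lemma ssum_antipode_left: "ssum (dR x) (\<lambda>a b. antipode a * b) = sR (counit x) 1"
  by (subst antipode_left[symmetric], subst contract_eq_ssum[of sR sR])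
    (intro lin_intros blins, rule refl)

lemma ssum_antipode_right: "ssum (dR x) (\<lambda>a b. a * antipode b) = sR (counit x) 1"
  by (subst antipode_right[symmetric], subst contract_eq_ssum[of sR sR])
    (intro lin_intros blins, rule refl)

lemma ssum_counit_coact: "ssum (dC x) (\<lambda>h w. sH (counit w) h) = sH (counit x) 1"
  by (subst counit_coact[symmetric], subst contract_eq_ssum[of sH sR])
    (intro lin_intros blins, rule refl)

lemma antipode_one: "antipode 1 = 1"
proof -
  have "ssum (dR 1) (\<lambda>a b. antipode a * b) = antipode 1 * 1"
    by (subst ssum_tensor_class[OF R.is_vector_space_alg _ comul_one])
      (intro lin_intros blins, simp add: vector_space.fsum_frag_of[OF R.is_vector_space_alg])
  then show ?thesis
    using ssum_antipode_left[of 1] by (simp add: counit_one)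
qed

text \<open>
  Braided version of the previous argument: compute
  \<open>S(x\<^sub>1 (x\<^sub>2\<^sub>(\<^sub>-\<^sub>1\<^sub>) x\<^sub>3\<^sub>(\<^sub>-\<^sub>1\<^sub>) \<cdot> y)) x\<^sub>2\<^sub>(\<^sub>0\<^sub>) S(x\<^sub>3\<^sub>(\<^sub>0\<^sub>))\<close> in two ways. That the comultiplication of \<open>R\<close>
  is a comodule map collects both coactions into the one of \<open>x\<^sub>2 \<otimes> x\<^sub>3\<close>, after which \<open>x\<^sub>2 S(x\<^sub>3)\<close> cancels.
\<close>

lemma antipode_mult:
  "antipode (x * y) = ssum (dC x) (\<lambda>h w. antipode (act h y) * antipode w)"
proof -
  let ?S = antipode
  note lins = lin_intros blins
  note out = lin_ssum_out[OF lin_scale_right[OF R.is_vector_space_alg lin_id]]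
  have star: "ssum (dR x) (\<lambda>x1 x2. ssum (dR y) (\<lambda>y1 y2.
      ssum (dC x2) (\<lambda>h w. ?S (x1 * act h y1) * w * y2))) =
      sR (counit x) (sR (counit y) 1)" for x y
    using ssum_antipode_left[of "x * y"]
    by (subst (asm) ssum_comul_mult[OF R.is_vector_space_alg]) (intro lins, simp add: counit_mult mult.assoc)
  define A where "A = (\<lambda>x y. ssum (dR x) (\<lambda>x1 x2. ssum (dC x2) (\<lambda>h w. ?S (x1 * act h y) * w)))"
  have A_lin: "lin s sR (\<lambda>u. A x (f u))" if "lin s sR f" for f x and s :: "'k \<Rightarrow> 'z::ab_group_add \<Rightarrow> 'z"
    unfolding A_def using that by (intro lins)
  \<comment> \<open>The counit axiom for \<open>y\<close>, written as \<open>y\<^sub>2 S(y\<^sub>3)\<close>, makes \<open>star\<close> applicable.\<close>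
  have star2: "A x y = sR (counit x) (?S y)" for x y
  proof -
    have "A x y = ssum (dR y) (\<lambda>y1 y'. sR (counit y') (A x y1))"
      by (rule R.pc.counit_right_vec[symmetric]) (intro lins A_lin)+
    also have "\<dots> = ssum (dR y) (\<lambda>y1 y'. ssum (dR y') (\<lambda>y2 y3. A x y1 * y2 * ?S y3))"
      by (simp add: mult.assoc ssum_antipode_right R.scale_mult_right flip: R.ssum_times_right)
    also have "\<dots> = ssum (dR y) (\<lambda>y' y3. ssum (dR y') (\<lambda>y1 y2. A x y1 * y2 * ?S y3))"
      by (rule R.pc.coassoc_vec[OF R.is_vector_space_alg, symmetric]) (intro lins A_lin)
    also have "\<dots> = ssum (dR y) (\<lambda>y' y3. sR (counit x) (sR (counit y') (?S y3)))"
    proof (rule ssum_cong)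
      fix y' y3
      have "ssum (dR y') (\<lambda>y1 y2. A x y1 * y2) = sR (counit x) (sR (counit y') 1)"
        unfolding star[symmetric] A_def R.ssum_times_left by (rule ssum_swap)
      then show "ssum (dR y') (\<lambda>y1 y2. A x y1 * y2 * ?S y3) = sR (counit x) (sR (counit y') (?S y3))"
        by (simp add: R.scale_mult_left flip: R.ssum_times_left)
    qed
    also have "\<dots> = sR (counit x) (?S y)"
      by (subst out[symmetric], subst R.pc.counit_left_vec[OF R.is_vector_space_alg antipode_lin], rule refl)
    finally show ?thesis .
  qed
  have "ssum (dC x) (\<lambda>h w. ?S (act h y) * ?S w) =
      ssum (dR x) (\<lambda>x' x3. sR (counit x') (ssum (dC x3) (\<lambda>g u. ?S (act g y) * ?S u)))"
    by (rule R.pc.counit_left_vec[symmetric]) (intro lins)+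
  also have "\<dots> = ssum (dR x) (\<lambda>x' x3. ssum (dR x') (\<lambda>x1 x2. ssum (dC x3) (\<lambda>g u.
      ssum (dC x2) (\<lambda>h w. ?S (x1 * act h (act g y)) * w * ?S u))))"
  proof (rule ssum_cong)
    fix x' x3
    have "sR (counit x') (ssum (dC x3) (\<lambda>g u. ?S (act g y) * ?S u)) =
        ssum (dC x3) (\<lambda>g u. A x' (act g y) * ?S u)"
      by (simp add: star2 R.scale_mult_left out)
    also have "\<dots> = ssum (dR x') (\<lambda>x1 x2. ssum (dC x3) (\<lambda>g u.
        ssum (dC x2) (\<lambda>h w. ?S (x1 * act h (act g y)) * w * ?S u)))"
      unfolding A_def R.ssum_times_left by (rule ssum_swap)
    finally show "sR (counit x') (ssum (dC x3) (\<lambda>g u. ?S (act g y) * ?S u)) = \<dots>" .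
  qed
  also have "\<dots> = ssum (dR x) (\<lambda>x1 x'. ssum (dR x') (\<lambda>x2 x3. ssum (dC x3) (\<lambda>g u.
      ssum (dC x2) (\<lambda>h w. ?S (x1 * act h (act g y)) * w * ?S u))))"
    by (rule R.pc.coassoc_vec[OF R.is_vector_space_alg]) (intro lins)
  also have "\<dots> = ssum (dR x) (\<lambda>x1 x'. ssum (dR x') (\<lambda>x2 x3. ssum (dC x2) (\<lambda>h w.
      ssum (dC x3) (\<lambda>g u. ?S (x1 * act (h * g) y) * (w * ?S u)))))"
    by (intro ssum_cong, subst ssum_swap) (simp add: act_mult mult.assoc)
  also have "\<dots> = ssum (dR x) (\<lambda>x1 x'. ssum (dC x') (\<lambda>h v. ssum (dR v) (\<lambda>w u.
      ?S (x1 * act h y) * (w * ?S u))))"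
    by (intro ssum_cong ssum_comul_coact[OF R.is_vector_space_alg, symmetric] lins)
  also have "\<dots> = ssum (dR x) (\<lambda>x1 x'. ?S (x1 * act (ssum (dC x') (\<lambda>h v. sH (counit v) h)) y))"
  proof (rule ssum_cong)
    fix x1 x'
    have 1: "lin sH sR (\<lambda>h. ?S (x1 * act h y))" by (intro lins)
    show "ssum (dC x') (\<lambda>h v. ssum (dR v) (\<lambda>w u. ?S (x1 * act h y) * (w * ?S u))) =
        ?S (x1 * act (ssum (dC x') (\<lambda>h v. sH (counit v) h)) y)"
      by (simp add: lin_ssum_out[OF 1] lin_scale[OF 1] ssum_antipode_right R.scale_mult_right
        flip: R.ssum_times_right)
  qed
  also have "\<dots> = ssum (dR x) (\<lambda>x1 x'. sR (counit x') (?S (x1 * y)))"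
  proof (rule ssum_cong)
    fix x1 x'
    have 1: "lin sH sR (\<lambda>h. ?S (x1 * act h y))" by (intro lins)
    show "?S (x1 * act (ssum (dC x') (\<lambda>h v. sH (counit v) h)) y) = sR (counit x') (?S (x1 * y))"
      by (simp add: ssum_counit_coact lin_scale[OF 1] act_one)
  qed
  also have "\<dots> = ?S (x * y)"
    by (rule R.pc.counit_right_vec) (intro lins)+
  finally show ?thesis ..
qed

end

section \<open>Operators attached to a finite-dimensional coaction\<close>

text \<open>
  The counterpart of \<open>comatrix_inverse\<close> for a multiplication: an inverse matrix distributes over
  products in the opposite order.
\<close>

lemma mult_inverse:
  fixes h N :: "'i \<Rightarrow> 'i \<Rightarrow> 'a::ring \<Rightarrow> 'a"
  assumes fin: "finite I" and inv: "op_inverse I (\<lambda>i j. h j i) (\<lambda>i j. N j i)"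
    and h: "\<And>i j. lin s s (h i j)" and N: "\<And>i j. lin s s (N i j)"
    and mult: "\<And>i j x y. i \<in> I \<Longrightarrow> j \<in> I \<Longrightarrow> h i j (x * y) = (\<Sum>k\<in>I. h i k x * h k j y)"
    and i: "i \<in> I" and j: "j \<in> I"
  shows "N i j (x * y) = (\<Sum>k\<in>I. N k j x * N i k y)"
proof -
  \<comment> \<open>The claimed value; applying \<open>h\<close> and then \<open>N\<close> to it gives it back and also gives the left-hand side.\<close>
  define Z where "Z = (\<lambda>j. \<Sum>p\<in>I. N p j x * N i p y)"
  have hZ: "(\<Sum>k\<in>I. h k l (Z k)) = (if i = l then x * y else 0)" if l: "l \<in> I" for l
  proof -
    have "(\<Sum>k\<in>I. h k l (Z k)) = (\<Sum>k\<in>I. \<Sum>p\<in>I. \<Sum>q\<in>I. h k q (N p k x) * h q l (N i p y))"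
      unfolding Z_def lin_sum[OF h] using l by (intro sum.cong refl mult)
    also have "\<dots> = (\<Sum>p\<in>I. \<Sum>q\<in>I. (\<Sum>k\<in>I. h k q (N p k x)) * h q l (N i p y))"
      unfolding sum_distrib_right by (rule sum_rotate3)
    also have "\<dots> = (\<Sum>p\<in>I. \<Sum>q\<in>I. if q = p then x * h q l (N i p y) else 0)"
      using op_inverseD(1)[OF inv] by (intro sum.cong refl) auto
    also have "\<dots> = x * (\<Sum>p\<in>I. h p l (N i p y))"
      using fin by (simp add: sum_distrib_left)
    also have "\<dots> = (if i = l then x * y else 0)"
      using op_inverseD(1)[OF inv l i] by simp
    finally show ?thesis .
  qed
  have "Z j = (\<Sum>k\<in>I. if k = j then Z k else 0)"
    using fin j by simp
  also have "\<dots> = (\<Sum>k\<in>I. \<Sum>l\<in>I. N l j (h k l (Z k)))"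
    using op_inverseD(2)[OF inv j] by (intro sum.cong refl) auto
  also have "\<dots> = (\<Sum>l\<in>I. N l j (\<Sum>k\<in>I. h k l (Z k)))"
    unfolding lin_sum[OF N] by (rule sum.swap)
  also have "\<dots> = (\<Sum>l\<in>I. if l = i then N l j (x * y) else 0)"
    by (intro sum.cong refl) (auto simp: hZ lin_zero[OF N])
  also have "\<dots> = N i j (x * y)"
    using fin i by simp
  finally show ?thesis by (simp add: Z_def)
qed

locale bijective_braided_hopf_algebra =
  braided_hopf_algebra sH comulH counitH antipodeH sR act coact comul counit antipode
  for sH :: "'k::field \<Rightarrow> 'h::ring_1 \<Rightarrow> 'h" and comulH counitH antipodeH
    and sR :: "'k \<Rightarrow> 'r::ring_1 \<Rightarrow> 'r" and act coact comul counit antipode +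
  fixes SHi :: "'h \<Rightarrow> 'h" and SRi :: "'r \<Rightarrow> 'r"
  assumes SHi [simp]: "antipodeH (SHi h) = h" "SHi (antipodeH h) = h"
    and SRi [simp]: "antipode (SRi x) = x" "SRi (antipode x) = x"
begin

lemma SHi_mult: "SHi (g * h) = SHi h * SHi g"
  by (metis SHi H.antipode_mult)

lemma SHi_one [simp]: "SHi 1 = 1"
  by (metis SHi(2) H.antipode_one)

lemma SHi_lin: "lin sH sH SHi"
  using H.antipode_lin unfolding lin_def by (metis SHi)

lemma SRi_lin: "lin sR sR SRi"
  using antipode_lin unfolding lin_def by (metis SRi)

lemmas bilins = blins lin_comp[OF SHi_lin] lin_comp[OF SRi_lin]

lemma SRi_act: "SRi (act h x) = act h (SRi x)"
  by (metis SRi antipode_act)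

lemma SRi_one [simp]: "SRi 1 = 1"
  by (metis SRi(2) antipode_one)

lemma ssum_coact_SRi:
  assumes t: "vector_space t" and F: "bilin sH sR t F"
  shows "ssum (dC (SRi x)) F = ssum (dC x) (\<lambda>h w. F h (SRi w))"
  using ssum_coact_antipode[OF t, of "\<lambda>h w. F h (SRi w)" "SRi x"]
  by (simp add: lin_intros bilins bilin_comps[OF F])

lemma ssum_inverse_antipode:
  "ssum (dH h) (\<lambda>h1 h2. h2 * SHi h1) = sH (counitH h) 1"
  "ssum (dH h) (\<lambda>h1 h2. SHi h2 * h1) = sH (counitH h) 1"
proof -
  have "antipodeH (ssum (dH h) (\<lambda>h1 h2. h2 * SHi h1)) = antipodeH (sH (counitH h) 1)"
    by (simp add: lin_ssum_out[OF H.antipode_lin] lin_scale[OF H.antipode_lin] H.antipode_mult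
      H.antipode_one H.ssum_antipode_right)
  then show "ssum (dH h) (\<lambda>h1 h2. h2 * SHi h1) = sH (counitH h) 1" by (metis SHi(2))
  have "antipodeH (ssum (dH h) (\<lambda>h1 h2. SHi h2 * h1)) = antipodeH (sH (counitH h) 1)"
    by (simp add: lin_ssum_out[OF H.antipode_lin] lin_scale[OF H.antipode_lin] H.antipode_mult
      H.antipode_one H.ssum_antipode_left)
  then show "ssum (dH h) (\<lambda>h1 h2. SHi h2 * h1) = sH (counitH h) 1" by (metis SHi(2))
qed

text \<open>Apply the antipode to the right-hand side and use \<open>antipode_mult\<close>.\<close>
lemma SRi_mult: "SRi (x * y) = ssum (dC y) (\<lambda>h w. SRi w * act (SHi h) (SRi x))"
proof -
  have "antipode (ssum (dC y) (\<lambda>h w. SRi w * act (SHi h) (SRi x))) =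
      ssum (dC y) (\<lambda>h w. ssum (dC (SRi w)) (\<lambda>g u. act g (act (SHi h) x) * antipode u))"
    by (simp add: lin_ssum_out[OF antipode_lin] antipode_mult antipode_act)
  also have "\<dots> = ssum (dC y) (\<lambda>h w. ssum (dC w) (\<lambda>g u. act (g * SHi h) x * u))"
    by (subst ssum_coact_SRi[OF R.is_vector_space_alg]) (intro lin_intros bilins, simp add: act_mult)
  also have "\<dots> = ssum (dC y) (\<lambda>h w. ssum (dH h) (\<lambda>h1 h2. act (h2 * SHi h1) x * w))"
    by (rule com.coact_coassoc_vec[OF R.is_vector_space_alg, symmetric]) (intro lin_intros bilins)
  also have "\<dots> = ssum (dC y) (\<lambda>h w. sR (counitH h) (x * w))"
  proof (rule ssum_cong)
    fix h w
    have 1: "lin sH sR (\<lambda>h. act h x * w)" by (intro lin_intros bilins)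
    show "ssum (dH h) (\<lambda>h1 h2. act (h2 * SHi h1) x * w) = sR (counitH h) (x * w)"
      by (simp add: ssum_inverse_antipode act_one lin_scale[OF 1] flip: lin_ssum_out[OF 1])
  qed
  also have "\<dots> = x * y"
    by (rule com.coact_counit_vec[OF R.is_vector_space_alg]) (intro lin_intros bilins)
  finally show ?thesis by (metis SRi(2))
qed

end

locale coaction_matrix =
  bijective_braided_hopf_algebra sH comulH counitH antipodeH sR act coact comul counit antipode SHi SRi +
  coordinates sR B \<kappa>
  for sH :: "'k::field \<Rightarrow> 'h::ring_1 \<Rightarrow> 'h" and comulH counitH antipodeH
    and sR :: "'k \<Rightarrow> 'r::ring_1 \<Rightarrow> 'r" and act coact comul counit antipode SHi SRi B \<kappa> +
  assumes coact_closed: "b \<in> B \<Longrightarrow> lin sH (*) \<phi> \<Longrightarrow> ssum (dC b) (\<lambda>h w. sR (\<phi> h) w) \<in> V.span B"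
begin

sublocale cc: comodule_coordinates sH dH counitH sR "\<lambda>v. tensor_pairs sH (coact v)" B \<kappa>
  by unfold_locales (rule coact_closed)

text \<open>
  The coefficients of the coaction acting on \<open>R\<close>, after application of the powers \<open>0\<close>, \<open>-1\<close>, \<open>-2\<close>, \<open>1\<close> of
  the antipode of \<open>H\<close>. Passing from one power to the next alternates between inverting a matrix and
  inverting its transpose.
\<close>
definition "h i j = act (cc.coeff i j)"
definition "N i j = act (SHi (cc.coeff i j))"
definition "M i j = act (SHi (SHi (cc.coeff i j)))"
definition "L i j = act (antipodeH (cc.coeff i j))"

lemma lin_ops: "lin sR sR (h i j)" "lin sR sR (N i j)" "lin sR sR (M i j)" "lin sR sR (L i j)"
  unfolding h_def N_def M_def L_def by (intro lin_act_right lin_id)+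

lemmas op_sum = lin_ops[THEN lin_sum]
lemmas op_zero [simp] = lin_ops[THEN lin_zero]
lemmas opl = lin_ops[THEN lin_comp]

lemma ops_commute:
  "antipode (h i j x) = h i j (antipode x)" "antipode (N i j x) = N i j (antipode x)"
  "antipode (M i j x) = M i j (antipode x)" "antipode (L i j x) = L i j (antipode x)"
  "SRi (h i j x) = h i j (SRi x)" "SRi (N i j x) = N i j (SRi x)"
  "SRi (M i j x) = M i j (SRi x)" "SRi (L i j x) = L i j (SRi x)"
  by (simp_all add: h_def N_def M_def L_def antipode_act SRi_act)

text \<open>
  Each form of the antipode axiom of \<open>H\<close>, applied to a coefficient, becomes an inversion of matrices of
  operators.
\<close>
lemma contract_coeff:
  assumes i: "i \<in> B" and j: "j \<in> B" and F: "bilin sH sH sH F"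
    and eq: "\<And>h. ssum (dH h) F = sH (counitH h) 1"
  shows "(\<Sum>k\<in>B. act (F (cc.coeff i k) (cc.coeff k j)) x) = (if i = j then x else 0)"
proof -
  have 1: "lin sH sR (\<lambda>h. act h x)" by (intro lin_act_left lin_id)
  have "(\<Sum>k\<in>B. act (F (cc.coeff i k) (cc.coeff k j)) x) = act (ssum (dH (cc.coeff i j)) F) x"
    by (simp add: cc.comul_coeff[OF H.is_vector_space_alg i j F] lin_sum[OF 1])
  also have "\<dots> = (if i = j then x else 0)"
    by (simp add: eq cc.counit_coeff i j lin_scale[OF 1] lin_zero[OF 1] act_one)
  finally show ?thesis .
qed

lemma h_N_inverse: "op_inverse B (\<lambda>i j. h j i) (\<lambda>i j. N j i)"
  unfolding op_inverse_def
proof (intro ballI allI conjI)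
  fix i j x assume i: "i \<in> B" and j: "j \<in> B"
  have "bilin sH sH sH (\<lambda>a b. b * SHi a)" "bilin sH sH sH (\<lambda>a b. SHi b * a)"
    by (intro lin_intros bilins)+
  from contract_coeff[OF j i this(1) ssum_inverse_antipode(1), of x]
    contract_coeff[OF j i this(2) ssum_inverse_antipode(2), of x]
  show "(\<Sum>k\<in>B. h k i (N j k x)) = (if i = j then x else 0)"
    "(\<Sum>k\<in>B. N k i (h j k x)) = (if i = j then x else 0)"
    by (simp_all add: h_def N_def act_mult eq_commute[of i j])
qed

lemma N_M_inverse: "op_inverse B N M"
  unfolding op_inverse_def
proof (intro ballI allI conjI)
  fix i j x assume i: "i \<in> B" and j: "j \<in> B"
  have 1: "bilin sH sH sH (\<lambda>a b. SHi (SHi b * a))" "bilin sH sH sH (\<lambda>a b. SHi (b * SHi a))"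
    by (intro lin_intros bilins)+
  have 2: "ssum (dH h) (\<lambda>a b. SHi (SHi b * a)) = sH (counitH h) 1"
    "ssum (dH h) (\<lambda>a b. SHi (b * SHi a)) = sH (counitH h) 1" for h
    by (simp_all add: ssum_inverse_antipode lin_scale[OF SHi_lin] flip: lin_ssum_out[OF SHi_lin])
  from contract_coeff[OF i j 1(1) 2(1), of x] contract_coeff[OF i j 1(2) 2(2), of x]
  show "(\<Sum>k\<in>B. N i k (M k j x)) = (if i = j then x else 0)"
    "(\<Sum>k\<in>B. M i k (N k j x)) = (if i = j then x else 0)"
    by (simp_all add: M_def N_def act_mult SHi_mult)
qed

lemma h_L_inverse: "op_inverse B h L"
  unfolding op_inverse_def
proof (intro ballI allI conjI)
  fix i j x assume i: "i \<in> B" and j: "j \<in> B"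
  have "bilin sH sH sH (\<lambda>a b. a * antipodeH b)" "bilin sH sH sH (\<lambda>a b. antipodeH a * b)"
    by (intro lin_intros bilins)+
  from contract_coeff[OF i j this(1) H.ssum_antipode_right, of x]
    contract_coeff[OF i j this(2) H.ssum_antipode_left, of x]
  show "(\<Sum>k\<in>B. h i k (L k j x)) = (if i = j then x else 0)"
    "(\<Sum>k\<in>B. L i k (h k j x)) = (if i = j then x else 0)"
    by (simp_all add: h_def L_def act_mult)
qed

lemmas hN = op_inverseD(1)[OF h_N_inverse]
lemmas Nh = op_inverseD(2)[OF h_N_inverse]
lemmas NM = op_inverseD(1)[OF N_M_inverse]
lemmas MN = op_inverseD(2)[OF N_M_inverse]
lemmas hL = op_inverseD(1)[OF h_L_inverse]
lemmas Lh = op_inverseD(2)[OF h_L_inverse]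

lemma h_mult: "i \<in> B \<Longrightarrow> j \<in> B \<Longrightarrow> h i j (x * y) = (\<Sum>k\<in>B. h i k x * h k j y)"
  unfolding h_def ssum_mult_act by (rule cc.comul_coeff[OF R.is_vector_space_alg]) (assumption | intro lin_intros bilins)+

lemma N_mult: "i \<in> B \<Longrightarrow> j \<in> B \<Longrightarrow> N i j (x * y) = (\<Sum>k\<in>B. N k j x * N i k y)"
  by (rule mult_inverse[OF finite_B h_N_inverse lin_ops(1,2) h_mult])

lemma M_mult: "i \<in> B \<Longrightarrow> j \<in> B \<Longrightarrow> M i j (x * y) = (\<Sum>k\<in>B. M i k x * M k j y)"
  by (rule mult_inverse[OF finite_B, of "\<lambda>i j. N j i" "\<lambda>i j. M j i" sR j i])
    (use N_M_inverse in \<open>simp_all add: lin_ops N_mult\<close>)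

lemma h_one: "i \<in> B \<Longrightarrow> j \<in> B \<Longrightarrow> h i j 1 = (if i = j then 1 else 0)"
  by (simp add: h_def unit_act cc.counit_coeff)

lemma N_one: "i \<in> B \<Longrightarrow> j \<in> B \<Longrightarrow> N i j 1 = (if i = j then 1 else 0)"
proof -
  assume i: "i \<in> B" and j: "j \<in> B"
  have "(\<Sum>k\<in>B. N k j (h i k 1)) = (\<Sum>k\<in>B. if k = i then N k j 1 else 0)"
    using i by (intro sum.cong) (auto simp: h_one)
  then show ?thesis using Nh[OF j i, of 1] i finite_B by (simp add: eq_commute)
qed

lemma M_one: "i \<in> B \<Longrightarrow> j \<in> B \<Longrightarrow> M i j 1 = (if i = j then 1 else 0)"
proof -
  assume i: "i \<in> B" and j: "j \<in> B"
  have "(\<Sum>k\<in>B. M i k (N k j 1)) = (\<Sum>k\<in>B. if k = j then M i k 1 else 0)"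
    using j by (intro sum.cong) (auto simp: N_one)
  then show ?thesis using MN[OF i j, of 1] j finite_B by simp
qed

lemma h_comatrix: "R.pc.comatrix B h"
  unfolding R.pc.comatrix_def
proof (intro conjI allI impI lin_ops)
  fix F :: "'r \<Rightarrow> 'r \<Rightarrow> 'k" and i j x assume F: "bilin sR sR (*) F" and i: "i \<in> B" and j: "j \<in> B"
  show "ssum (dR (h i j x)) F = (\<Sum>k\<in>B. ssum (dR x) (\<lambda>u v. F (h i k u) (h k j v)))"
    unfolding h_def ssum_comul_act[OF vector_space_field F]
    by (rule cc.comul_coeff[OF vector_space_field i j]) (intro lin_intros bilins bilin_comps[OF F])
qed

lemma N_comatrix: "R.pc.comatrix B (\<lambda>i j. N j i)"
  by (rule R.pc.comatrix_inverse[OF finite_B h_comatrix lin_ops(2) h_N_inverse])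

end

section \<open>Left integrals\<close>

text \<open>
  The span of \<open>B\<close> is a left coideal and an \<open>H\<close>-subcomodule of \<open>R\<close>. Write \<open>\<alpha>\<^sub>i\<^sub>j\<close> for the coefficients of
  the comultiplication and \<open>h\<^sub>i\<^sub>j\<close> for those of the coaction. As a comodule over the bosonization the
  span has the coefficient matrix \<open>\<alpha> h\<close>.
\<close>
locale left_matrix =
  coaction_matrix sH comulH counitH antipodeH sR act coact comul counit antipode SHi SRi B \<kappa>
  for sH :: "'k::field \<Rightarrow> 'h::ring_1 \<Rightarrow> 'h" and comulH counitH antipodeH
    and sR :: "'k \<Rightarrow> 'r::ring_1 \<Rightarrow> 'r" and act coact comul counit antipode SHi SRi B \<kappa> +
  assumes comul_closed: "b \<in> B \<Longrightarrow> lin sR (*) \<phi> \<Longrightarrow> ssum (dR b) (\<lambda>x y. sR (\<phi> x) y) \<in> V.span B"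
begin

lemma comodule_coordinates_comul: "comodule_coordinates sR dR counit sR dR B \<kappa>"
  by (intro comodule_coordinates.intro R.pc.regular_comodule comodule_coordinates_axioms.intro
    comul_closed coordinates_axioms coordinates.intro)

sublocale ac: comodule_coordinates sR dR counit sR dR B \<kappa>
  by (rule comodule_coordinates_comul)

abbreviation "al \<equiv> ac.coeff"

lemma al_antipode:
  assumes "i \<in> B" "j \<in> B"
  shows "(\<Sum>k\<in>B. al i k * antipode (al k j)) = (if i = j then 1 else 0)"
    and "(\<Sum>k\<in>B. antipode (al i k) * al k j) = (if i = j then 1 else 0)"
  using ac.comul_coeff[OF R.is_vector_space_alg assms, of "\<lambda>x y. x * antipode y"]
    ac.comul_coeff[OF R.is_vector_space_alg assms, of "\<lambda>x y. antipode x * y"]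
  by (auto simp: lin_intros blins ssum_antipode_left ssum_antipode_right ac.counit_coeff assms
    split: if_splits)

text \<open>
  The compatibility of comultiplication and coaction in coordinates:
  \<open>\<Sum>\<^sub>k h\<^sub>j\<^sub>k \<otimes> \<alpha>\<^sub>k\<^sub>l = \<Sum>\<^sub>k \<alpha>\<^sub>j\<^sub>k\<^sub>(\<^sub>-\<^sub>1\<^sub>) h\<^sub>k\<^sub>l \<otimes> \<alpha>\<^sub>j\<^sub>k\<^sub>(\<^sub>0\<^sub>)\<close>.
\<close>

lemma coact_al:
  assumes t: "vector_space t" and F: "bilin sH sR t F" and j: "j \<in> B" and l: "l \<in> B"
  shows "(\<Sum>k\<in>B. F (cc.coeff j k) (al k l)) = (\<Sum>k\<in>B. ssum (dC (al j k)) (\<lambda>g w. F (g * cc.coeff k l) w))"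
proof -
  note delta = sum_coordinate[OF t l]
  note lins = lin_intros bilins \<kappa>_lin lin_comp[OF \<kappa>_lin] t bilin_comps[OF F]
  \<comment> \<open>The last factor is tested with \<open>\<kappa> l\<close>.\<close>
  have T: "trilin sH sR sR t (\<lambda>h a b. t (\<kappa> l b) (F h a))"
    by (intro lins)
  have "(\<Sum>k\<in>B. F (cc.coeff j k) (al k l)) =
      (\<Sum>k\<in>B. \<Sum>b\<in>B. t (\<kappa> l b) (F (cc.coeff j k) (al k b)))"
    by (simp only: delta)
  also have "\<dots> = (\<Sum>k\<in>B. ssum (dR k) (\<lambda>a b. t (\<kappa> l b) (F (cc.coeff j k) a)))"
    by (intro sum.cong refl ac.coact_expand[OF t, symmetric]) (assumption, intro lins)
  also have "\<dots> = ssum (dC j) (\<lambda>h w. ssum (dR w) (\<lambda>a b. t (\<kappa> l b) (F h a)))"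
    by (rule cc.coact_expand[OF t j, symmetric]) (intro lins)
  also have "\<dots> = ssum (dR j) (\<lambda>a b. ssum (dC a) (\<lambda>g a0. ssum (dC b) (\<lambda>h b0. t (\<kappa> l b0) (F (g * h) a0))))"
    by (rule ssum_comul_coact[OF t T])
  also have "\<dots> = (\<Sum>k\<in>B. ssum (dC (al j k)) (\<lambda>g a0. ssum (dC k) (\<lambda>h b0. t (\<kappa> l b0) (F (g * h) a0))))"
    by (rule ac.coact_expand[OF t j]) (intro lins)
  also have "\<dots> = (\<Sum>k\<in>B. ssum (dC (al j k)) (\<lambda>g a0. \<Sum>b\<in>B. t (\<kappa> l b) (F (g * cc.coeff k b) a0)))"
    by (intro sum.cong refl ssum_cong cc.coact_expand[OF t]) (assumption, intro lins)
  finally show ?thesis by (simp only: delta)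
qed

text \<open>
  \<open>tw k j\<close> are the coefficients of the inverse braiding applied to a comultiplication,
  \<open>v\<^sub>2\<^sub>(\<^sub>0\<^sub>) \<otimes> S\<^sup>-\<^sup>1(v\<^sub>2\<^sub>(\<^sub>-\<^sub>1\<^sub>)) \<cdot> v\<^sub>1\<close>.
  The operators \<open>c\<close> and \<open>b\<close> below are the actions of the coefficients of \<open>a\<close> after the inverse
  antipode of the bosonization has been applied once and twice.
\<close>
definition "tw k j = (\<Sum>m\<in>B. N m j (al k m))"

definition "a i j x = (\<Sum>k\<in>B. al i k * h k j x)"
definition "c i j x = (\<Sum>k\<in>B. SRi (tw k j) * N i k x)"
definition "zeta p j = (\<Sum>m\<in>B. M p m (tw m j))"
definition "b i j x = (\<Sum>k\<in>B. SRi (SRi (zeta i k)) * M k j x)"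

lemma lin_abc: "lin sR sR (a i j)" "lin sR sR (c i j)" "lin sR sR (b i j)"
  unfolding a_def c_def b_def by (intro lin_intros bilins opl)+

lemma a_one: "i \<in> B \<Longrightarrow> j \<in> B \<Longrightarrow> a i j 1 = al i j"
proof -
  assume "i \<in> B" "j \<in> B"
  then have "a i j 1 = (\<Sum>k\<in>B. if k = j then al i k else 0)"
    unfolding a_def by (intro sum.cong refl) (auto simp: h_one)
  then show ?thesis using \<open>j \<in> B\<close> finite_B by simp
qed

lemma a_comatrix: "R.pc.comatrix B a"
  unfolding R.pc.comatrix_def
proof (intro conjI allI impI lin_abc)
  fix F :: "'r \<Rightarrow> 'r \<Rightarrow> 'k" and i j x
  assume F: "bilin sR sR (*) F" and i: "i \<in> B" and j: "j \<in> B"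
  note lins = lin_intros bilins opl bilin_comps[OF F]
  have DF: "lin sR (*) (\<lambda>x. ssum (dR x) F)" by (intro lins)
  let ?t = "\<lambda>k l m. ssum (dR x) (\<lambda>u v. ssum (dC (al k l)) (\<lambda>g w. F (al i k * act g (h l m u)) (w * h m j v)))"
  let ?t2 = "\<lambda>k m n. ssum (dR x) (\<lambda>u v. F (al i k * h k n u) (al n m * h m j v))"
  have "ssum (dR (a i j x)) F = (\<Sum>l\<in>B. ssum (dR (al i l * h l j x)) F)"
    unfolding a_def by (rule lin_sum[OF DF])
  also have "\<dots> = (\<Sum>l\<in>B. ssum (dR (al i l)) (\<lambda>p q. ssum (dR (h l j x)) (\<lambda>u v.
      ssum (dC q) (\<lambda>g w. F (p * act g u) (w * v)))))"
    by (simp only: ssum_comul_mult[OF vector_space_field F])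
  also have "\<dots> = (\<Sum>l\<in>B. \<Sum>k\<in>B. ssum (dR (h l j x)) (\<lambda>u v.
      ssum (dC (al k l)) (\<lambda>g w. F (al i k * act g u) (w * v))))"
    by (intro sum.cong refl ac.comul_coeff[OF vector_space_field i]) (assumption, intro lins)
  also have "\<dots> = (\<Sum>l\<in>B. \<Sum>k\<in>B. \<Sum>m\<in>B. ?t k l m)"
    by (intro sum.cong refl R.pc.comatrixD[OF h_comatrix _ _ j]) (intro lins, assumption)
  also have "\<dots> = (\<Sum>k\<in>B. \<Sum>m\<in>B. \<Sum>l\<in>B. ?t k l m)"
    by (rule sum_rotate3)
  also have "\<dots> = (\<Sum>k\<in>B. \<Sum>m\<in>B. ssum (dR x) (\<lambda>u v. \<Sum>l\<in>B.
      ssum (dC (al k l)) (\<lambda>g w. F (al i k * act (g * cc.coeff l m) u) (w * h m j v))))"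
    by (simp only: ssum_sum) (simp add: h_def act_mult)
  also have "\<dots> = (\<Sum>k\<in>B. \<Sum>m\<in>B. ssum (dR x) (\<lambda>u v. \<Sum>n\<in>B.
      F (al i k * act (cc.coeff k n) u) (al n m * h m j v)))"
    by (intro sum.cong refl ssum_cong coact_al[OF vector_space_field, symmetric]) (intro lins, assumption+)
  also have "\<dots> = (\<Sum>k\<in>B. \<Sum>m\<in>B. \<Sum>n\<in>B. ?t2 k m n)"
    by (simp only: ssum_sum h_def)
  also have "\<dots> = (\<Sum>n\<in>B. \<Sum>k\<in>B. \<Sum>m\<in>B. ?t2 k m n)"
    by (rule sum_rotate3[symmetric])
  also have "\<dots> = (\<Sum>n\<in>B. ssum (dR x) (\<lambda>u v. F (a i n u) (a n j v)))"
    by (rule sum.cong[OF refl])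
      (simp add: a_def lin_sum[OF bilin_left[OF F]] lin_sum[OF bilin_right[OF F]] ssum_sum, rule sum.swap)
  finally show "ssum (dR (a i j x)) F = (\<Sum>n\<in>B. ssum (dR x) (\<lambda>u v. F (a i n u) (a n j v)))" .
qed

text \<open>
  The common source of the identities below. The relation \<open>coact_al\<close> trades the matrix of the coaction
  for the coaction of \<open>\<alpha>\<close>; what then appears on the left is the expansion of the inverse antipode of a
  product by \<open>SRi_mult\<close>.
\<close>

lemma reversed_product_sum:
  assumes \<phi>: "lin sR sR \<phi>" "\<And>g x. \<phi> (act g x) = act g (\<phi> x)"
    "\<And>x F. bilin sH sR sR F \<Longrightarrow> ssum (dC (\<phi> x)) F = ssum (dC x) (\<lambda>g w. F g (\<phi> w))"
    and m: "m \<in> B" and j: "j \<in> B"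
  shows "(\<Sum>l\<in>B. SRi (\<phi> (tw l j)) * N m l (SRi y)) = (\<Sum>l\<in>B. N l j (SRi (y * \<phi> (al m l))))"
proof -
  note lins = lin_intros bilins opl lin_comp[OF \<phi>(1)]
  have "(\<Sum>l\<in>B. SRi (\<phi> (tw l j)) * N m l (SRi y)) =
      (\<Sum>l\<in>B. \<Sum>p\<in>B. N p j (SRi (\<phi> (al l p))) * N m l (SRi y))"
    by (simp add: tw_def lin_sum[OF \<phi>(1)] lin_sum[OF SRi_lin] sum_distrib_right N_def \<phi>(2) SRi_act)
  also have "\<dots> = (\<Sum>p\<in>B. \<Sum>l\<in>B. N p j (SRi (\<phi> (al l p))) * act (SHi (cc.coeff m l)) (SRi y))"
    unfolding N_def by (rule sum.swap)
  also have "\<dots> = (\<Sum>p\<in>B. \<Sum>k\<in>B. ssum (dC (al m k)) (\<lambda>g w.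
      N p j (SRi (\<phi> w)) * act (SHi (g * cc.coeff k p)) (SRi y)))"
    by (intro sum.cong refl coact_al[OF R.is_vector_space_alg _ m]) (intro lins)
  also have "\<dots> = (\<Sum>k\<in>B. \<Sum>p\<in>B. ssum (dC (al m k)) (\<lambda>g w.
      N p j (SRi (\<phi> w)) * N k p (act (SHi g) (SRi y))))"
    unfolding SHi_mult act_mult N_def by (rule sum.swap)
  also have "\<dots> = (\<Sum>k\<in>B. ssum (dC (al m k)) (\<lambda>g w. N k j (SRi (\<phi> w) * act (SHi g) (SRi y))))"
    by (simp add: N_mult j ssum_sum)
  also have "\<dots> = (\<Sum>k\<in>B. N k j (SRi (y * \<phi> (al m k))))"
  proof (rule sum.cong[OF refl])
    fix k
    have "SRi (y * \<phi> (al m k)) = ssum (dC (al m k)) (\<lambda>g w. SRi (\<phi> w) * act (SHi g) (SRi y))"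
      unfolding SRi_mult by (rule \<phi>(3)) (intro lins)
    then show "ssum (dC (al m k)) (\<lambda>g w. N k j (SRi (\<phi> w) * act (SHi g) (SRi y))) =
        N k j (SRi (y * \<phi> (al m k)))"
      by (simp add: lin_ssum_out[OF lin_ops(2)])
  qed
  finally show ?thesis .
qed

lemmas reversed_product_sum_id = reversed_product_sum[of "\<lambda>x. x", OF lin_id refl refl]
lemmas reversed_product_sum_antipode = reversed_product_sum[OF antipode_lin antipode_act ssum_coact_antipode[OF R.is_vector_space_alg]]
lemmas reversed_product_sum_SRi = reversed_product_sum[OF SRi_lin SRi_act ssum_coact_SRi[OF R.is_vector_space_alg]]

lemma SRi_tw: "SRi (tw k j) = (\<Sum>m\<in>B. N m j (SRi (al k m)))"
  by (simp add: tw_def lin_sum[OF SRi_lin] ops_commute)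

text \<open>
  Here and in \<open>tw_inverse_right\<close>, \<open>reversed_product_sum\<close> reduces the claim to the antipode axiom for \<open>\<alpha>\<close>
  inside \<open>SRi\<close>. To get there, one of the two factors \<open>\<alpha>\<close> is first rewritten as \<open>SRi\<close> of its antipode.
\<close>
lemma tw_inverse_left:
  assumes i: "i \<in> B" and j: "j \<in> B"
  shows "(\<Sum>l\<in>B. SRi (tw l j) * tw i l) = (if i = j then 1 else 0)"
proof -
  have "(\<Sum>l\<in>B. SRi (tw l j) * tw i l) =
      (\<Sum>l\<in>B. \<Sum>m\<in>B. SRi (tw l j) * N m l (SRi (antipode (al i m))))"
    unfolding sum_distrib_left[symmetric] tw_def[of i] by simp
  also have "\<dots> = (\<Sum>m\<in>B. \<Sum>l\<in>B. SRi (tw l j) * N m l (SRi (antipode (al i m))))"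
    by (rule sum.swap)
  also have "\<dots> = (\<Sum>m\<in>B. \<Sum>l\<in>B. N l j (SRi (antipode (al i m) * al m l)))"
    by (intro sum.cong refl reversed_product_sum_id j)
  also have "\<dots> = (\<Sum>l\<in>B. N l j (SRi (\<Sum>m\<in>B. antipode (al i m) * al m l)))"
    unfolding lin_sum[OF SRi_lin] op_sum by (rule sum.swap)
  also have "\<dots> = (\<Sum>l\<in>B. if l = i then N l j 1 else 0)"
    using i by (intro sum.cong refl) (auto simp: al_antipode lin_zero[OF SRi_lin])
  finally show ?thesis using i j finite_B by (simp add: N_one)
qed

lemma tw_inverse_right:
  assumes r: "r \<in> B" and q: "q \<in> B"
  shows "(\<Sum>m\<in>B. tw m q * SRi (tw r m)) = (if r = q then 1 else 0)"
proof -
  have "(\<Sum>m\<in>B. tw m q * SRi (tw r m)) =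
      (\<Sum>m\<in>B. \<Sum>p\<in>B. SRi (antipode (tw m q)) * N p m (SRi (al r p)))"
    by (simp add: SRi_tw sum_distrib_left)
  also have "\<dots> = (\<Sum>p\<in>B. \<Sum>m\<in>B. SRi (antipode (tw m q)) * N p m (SRi (al r p)))"
    by (rule sum.swap)
  also have "\<dots> = (\<Sum>p\<in>B. \<Sum>l\<in>B. N l q (SRi (al r p * antipode (al p l))))"
    by (intro sum.cong refl reversed_product_sum_antipode q)
  also have "\<dots> = (\<Sum>l\<in>B. N l q (SRi (\<Sum>p\<in>B. al r p * antipode (al p l))))"
    unfolding lin_sum[OF SRi_lin] op_sum by (rule sum.swap)
  also have "\<dots> = (\<Sum>l\<in>B. if l = r then N l q 1 else 0)"
    using r by (intro sum.cong refl) (auto simp: al_antipode lin_zero[OF SRi_lin])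
  finally show ?thesis using r q finite_B by (simp add: N_one)
qed

text \<open>Undo \<open>N\<close> in the definition of \<open>tw\<close> by applying \<open>h\<close> to \<open>tw_inverse_right\<close>.\<close>
lemma tw_cancel:
  assumes l: "l \<in> B" and p: "p \<in> B"
  shows "(\<Sum>k\<in>B. \<Sum>m\<in>B. al k m * h m p (SRi (tw l k))) = (if l = p then 1 else 0)"
proof -
  have h_tw: "(\<Sum>q\<in>B. h q m (tw k q)) = al k m" if m: "m \<in> B" for k m
  proof -
    have "(\<Sum>q\<in>B. h q m (tw k q)) = (\<Sum>r\<in>B. \<Sum>q\<in>B. h q m (N r q (al k r)))"
      unfolding tw_def op_sum by (rule sum.swap)
    also have "\<dots> = (\<Sum>r\<in>B. if r = m then al k r else 0)"
      using hN m by (intro sum.cong refl) auto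
    finally show ?thesis using m finite_B by simp
  qed
  have "(if l = p then 1 else 0) = (\<Sum>q\<in>B. if q = l then h q p 1 else 0)"
    using l p finite_B by (simp add: h_one)
  also have "\<dots> = (\<Sum>q\<in>B. h q p (\<Sum>k\<in>B. tw k q * SRi (tw l k)))"
    using l by (intro sum.cong refl) (auto simp: tw_inverse_right)
  also have "\<dots> = (\<Sum>q\<in>B. \<Sum>k\<in>B. \<Sum>m\<in>B. h q m (tw k q) * h m p (SRi (tw l k)))"
    unfolding op_sum using p by (intro sum.cong refl h_mult)
  also have "\<dots> = (\<Sum>k\<in>B. \<Sum>m\<in>B. (\<Sum>q\<in>B. h q m (tw k q)) * h m p (SRi (tw l k)))"
    unfolding sum_distrib_right by (rule sum_rotate3)
  also have "\<dots> = (\<Sum>k\<in>B. \<Sum>m\<in>B. al k m * h m p (SRi (tw l k)))"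
    by (simp add: h_tw)
  finally show ?thesis ..
qed

lemma a_c_inverse: "op_inverse B (\<lambda>i j. a j i) (\<lambda>i j. c j i)"
  unfolding op_inverse_def
proof (intro ballI allI conjI)
  fix j i x assume i: "i \<in> B" and j: "j \<in> B"
  let ?t = "\<lambda>k l m p. al k m * (h m p (SRi (tw l k)) * h p j (N i l x))"
  have "(\<Sum>k\<in>B. a k j (c i k x)) =
      (\<Sum>k\<in>B. \<Sum>m\<in>B. \<Sum>l\<in>B. \<Sum>p\<in>B. ?t k l m p)"
    unfolding a_def c_def op_sum
    by (intro sum.cong refl) (simp add: h_mult j sum_distrib_left)
  also have "\<dots> = (\<Sum>l\<in>B. \<Sum>p\<in>B. \<Sum>k\<in>B. \<Sum>m\<in>B. ?t k l m p)"
    by (rule sum_swap_pairs)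
  also have "\<dots> = (\<Sum>l\<in>B. \<Sum>p\<in>B. (\<Sum>k\<in>B. \<Sum>m\<in>B. al k m * h m p (SRi (tw l k))) * h p j (N i l x))"
    by (simp add: sum_distrib_right mult.assoc)
  also have "\<dots> = (\<Sum>l\<in>B. \<Sum>p\<in>B. if p = l then h p j (N i l x) else 0)"
    by (intro sum.cong refl) (auto simp: tw_cancel)
  also have "\<dots> = (\<Sum>l\<in>B. h l j (N i l x))"
    using finite_B by simp
  finally show "(\<Sum>k\<in>B. a k j (c i k x)) = (if j = i then x else 0)"
    using hN[OF j i] by simp
next
  fix j i x assume i: "i \<in> B" and j: "j \<in> B"
  let ?t2 = "\<lambda>k l m p. SRi (tw l j) * (N p l (al i m) * N k p (h m k x))"
  have "(\<Sum>k\<in>B. c k j (a i k x)) =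
      (\<Sum>k\<in>B. \<Sum>l\<in>B. \<Sum>m\<in>B. \<Sum>p\<in>B. ?t2 k l m p)"
    unfolding a_def c_def op_sum
    by (intro sum.cong refl) (simp add: N_mult sum_distrib_left)
  also have "\<dots> = (\<Sum>l\<in>B. \<Sum>m\<in>B. \<Sum>p\<in>B. \<Sum>k\<in>B. ?t2 k l m p)"
    by (rule sum_rotate4)
  also have "\<dots> = (\<Sum>l\<in>B. \<Sum>m\<in>B. \<Sum>p\<in>B. SRi (tw l j) * (N p l (al i m) * (\<Sum>k\<in>B. N k p (h m k x))))"
    by (simp add: sum_distrib_left)
  also have "\<dots> = (\<Sum>l\<in>B. \<Sum>m\<in>B. \<Sum>p\<in>B. if p = m then SRi (tw l j) * (N p l (al i m) * x) else 0)"
    using Nh by (intro sum.cong refl) auto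
  also have "\<dots> = (\<Sum>l\<in>B. SRi (tw l j) * tw i l) * x"
    using finite_B by (simp add: tw_def sum_distrib_left sum_distrib_right mult.assoc)
  finally show "(\<Sum>k\<in>B. c k j (a i k x)) = (if j = i then x else 0)"
    by (auto simp: tw_inverse_left i j)
qed

lemma N_zeta: 
  assumes i: "i \<in> B" and \<phi>: "lin sR sR \<phi>" "\<And>g x. \<phi> (act g x) = act g (\<phi> x)"
  shows "(\<Sum>k\<in>B. N i k (\<phi> (zeta k j) * x)) = (\<Sum>p\<in>B. \<phi> (tw p j) * N i p x)"
proof -
  have "(\<Sum>k\<in>B. N i k (\<phi> (zeta k j) * x)) =
      (\<Sum>k\<in>B. \<Sum>p\<in>B. \<Sum>m\<in>B. N p k (M k m (\<phi> (tw m j))) * N i p x)"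
    unfolding zeta_def using i
    by (intro sum.cong refl) (simp add: N_mult lin_sum[OF \<phi>(1)] op_sum sum_distrib_right M_def \<phi>(2),
      rule sum.swap)
  also have "\<dots> = (\<Sum>p\<in>B. \<Sum>m\<in>B. (\<Sum>k\<in>B. N p k (M k m (\<phi> (tw m j)))) * N i p x)"
    unfolding sum_distrib_right by (rule sum_rotate3)
  also have "\<dots> = (\<Sum>p\<in>B. \<Sum>m\<in>B. if m = p then \<phi> (tw m j) * N i p x else 0)"
    using NM by (intro sum.cong refl) auto
  finally show ?thesis using finite_B by simp
qed

text \<open>
  A second formula for \<open>c\<close>, with the action of \<open>H\<close> in front of the multiplication. In this form \<open>c\<close> is an
  ordinary product of two matrices, which can be inverted factor by factor.
\<close>
lemma c_zeta: "i \<in> B \<Longrightarrow> c i j x = (\<Sum>k\<in>B. N i k (SRi (zeta k j) * x))"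
  unfolding c_def by (rule N_zeta[OF _ SRi_lin SRi_act, symmetric])

lemma M_pull:
  assumes p: "p \<in> B"
  shows "(\<Sum>l\<in>B. M p l (X l)) * W = (\<Sum>r\<in>B. M p r (\<Sum>l\<in>B. X l * N r l W))"
proof -
  have "(\<Sum>r\<in>B. M p r (\<Sum>l\<in>B. X l * N r l W)) =
      (\<Sum>r\<in>B. \<Sum>l\<in>B. \<Sum>q\<in>B. M p q (X l) * M q r (N r l W))"
    unfolding op_sum using p by (intro sum.cong refl M_mult)
  also have "\<dots> = (\<Sum>l\<in>B. \<Sum>q\<in>B. M p q (X l) * (\<Sum>r\<in>B. M q r (N r l W)))"
    unfolding sum_distrib_left by (rule sum_rotate3)
  also have "\<dots> = (\<Sum>l\<in>B. \<Sum>q\<in>B. if q = l then M p q (X l) * W else 0)"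
    using MN by (intro sum.cong refl) auto
  also have "\<dots> = (\<Sum>l\<in>B. M p l (X l)) * W"
    using finite_B by (simp add: sum_distrib_right)
  finally show ?thesis ..
qed

text \<open>
  Pull the outer operators \<open>M\<close> out of the product by \<open>M_pull\<close>. The remaining inner sum is \<open>SRi\<close> of an
  expression that has been evaluated before: for the first claim it is \<open>c\<close> applied to \<open>a\<close>, for the
  second it is \<open>tw_inverse_right\<close>.
\<close>
lemma zeta_inverse:
  assumes p: "p \<in> B" and q: "q \<in> B"
  shows "(\<Sum>j\<in>B. SRi (zeta p j) * SRi (SRi (zeta j q))) = (if p = q then 1 else 0)"
    and "(\<Sum>j\<in>B. SRi (SRi (zeta p j)) * SRi (zeta j q)) = (if p = q then 1 else 0)"
proof -
  have SRi_zeta: "SRi (zeta p j) = (\<Sum>l\<in>B. M p l (SRi (tw l j)))" for j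
    by (simp add: zeta_def lin_sum[OF SRi_lin] ops_commute)
  have SRi_SRi_zeta: "SRi (SRi (zeta p j)) = (\<Sum>l\<in>B. M p l (SRi (SRi (tw l j))))" for j
    by (simp add: SRi_zeta lin_sum[OF SRi_lin] ops_commute)
  have M1: "(\<Sum>r\<in>B. M p r (if q = r then 1 else 0)) = (if p = q then 1 else 0)"
  proof -
    have "(\<Sum>r\<in>B. M p r (if q = r then 1 else 0)) = (\<Sum>r\<in>B. if r = q then M p r 1 else 0)"
      by (intro sum.cong) auto
    then show ?thesis using p q finite_B by (simp add: M_one)
  qed
  have inner1: "(\<Sum>j\<in>B. \<Sum>l\<in>B. SRi (tw l j) * N r l (SRi (SRi (zeta j q)))) = (if q = r then 1 else 0)"
    if r: "r \<in> B" for r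
  proof -
    have "(\<Sum>j\<in>B. \<Sum>l\<in>B. SRi (tw l j) * N r l (SRi (SRi (zeta j q)))) =
        (\<Sum>j\<in>B. \<Sum>l\<in>B. N l j (SRi (SRi (zeta j q) * al r l)))"
      by (intro sum.cong refl reversed_product_sum_id r)
    also have "\<dots> = (\<Sum>l\<in>B. \<Sum>j\<in>B. N l j (SRi (SRi (zeta j q) * al r l)))"
      by (rule sum.swap)
    also have "\<dots> = SRi (\<Sum>l\<in>B. c l q (a r l 1))"
      using r by (simp add: c_zeta a_one lin_sum[OF SRi_lin] ops_commute)
    also have "\<dots> = (if q = r then 1 else 0)"
      using op_inverseD(2)[OF a_c_inverse q r] by (simp add: lin_zero[OF SRi_lin])
    finally show ?thesis .
  qed
  have inner2: "(\<Sum>j\<in>B. \<Sum>l\<in>B. SRi (SRi (tw l j)) * N r l (SRi (zeta j q))) = (if q = r then 1 else 0)"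
    if r: "r \<in> B" for r
  proof -
    have "(\<Sum>j\<in>B. \<Sum>l\<in>B. SRi (SRi (tw l j)) * N r l (SRi (zeta j q))) =
        (\<Sum>j\<in>B. \<Sum>l\<in>B. N l j (SRi (zeta j q * SRi (al r l))))"
      by (intro sum.cong refl reversed_product_sum_SRi r)
    also have "\<dots> = (\<Sum>l\<in>B. \<Sum>j\<in>B. N l j (SRi (zeta j q * SRi (al r l))))"
      by (rule sum.swap)
    also have "\<dots> = SRi (\<Sum>l\<in>B. \<Sum>j\<in>B. N l j (zeta j q * SRi (al r l)))"
      by (simp add: lin_sum[OF SRi_lin] ops_commute)
    also have "\<dots> = SRi (\<Sum>l\<in>B. \<Sum>m\<in>B. tw m q * N l m (SRi (al r l)))"
      by (simp add: N_zeta[OF _ lin_id refl])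
    also have "\<dots> = SRi (\<Sum>m\<in>B. tw m q * SRi (tw r m))"
      unfolding SRi_tw sum_distrib_left by (rule arg_cong[of _ _ SRi], rule sum.swap)
    also have "\<dots> = (if q = r then 1 else 0)"
      using r q by (auto simp: tw_inverse_right lin_zero[OF SRi_lin])
    finally show ?thesis .
  qed
  have "(\<Sum>j\<in>B. SRi (zeta p j) * SRi (SRi (zeta j q))) =
      (\<Sum>j\<in>B. \<Sum>r\<in>B. M p r (\<Sum>l\<in>B. SRi (tw l j) * N r l (SRi (SRi (zeta j q)))))"
    unfolding SRi_zeta by (intro sum.cong refl M_pull p)
  also have "\<dots> = (\<Sum>r\<in>B. M p r (\<Sum>j\<in>B. \<Sum>l\<in>B. SRi (tw l j) * N r l (SRi (SRi (zeta j q)))))"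
    unfolding op_sum by (rule sum.swap)
  finally show "(\<Sum>j\<in>B. SRi (zeta p j) * SRi (SRi (zeta j q))) = (if p = q then 1 else 0)"
    by (simp add: inner1 M1)
  have "(\<Sum>j\<in>B. SRi (SRi (zeta p j)) * SRi (zeta j q)) =
      (\<Sum>j\<in>B. \<Sum>r\<in>B. M p r (\<Sum>l\<in>B. SRi (SRi (tw l j)) * N r l (SRi (zeta j q))))"
    unfolding SRi_SRi_zeta by (intro sum.cong refl M_pull p)
  also have "\<dots> = (\<Sum>r\<in>B. M p r (\<Sum>j\<in>B. \<Sum>l\<in>B. SRi (SRi (tw l j)) * N r l (SRi (zeta j q))))"
    unfolding op_sum by (rule sum.swap)
  finally show "(\<Sum>j\<in>B. SRi (SRi (zeta p j)) * SRi (zeta j q)) = (if p = q then 1 else 0)"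
    by (simp add: inner2 M1)
qed

lemma c_b_inverse: "op_inverse B c b"
  unfolding op_inverse_def
proof (intro ballI allI conjI)
  fix i j x assume i: "i \<in> B" and j: "j \<in> B"
  have "(\<Sum>k\<in>B. c i k (b k j x)) =
      (\<Sum>k\<in>B. \<Sum>m\<in>B. \<Sum>l\<in>B. N i m (SRi (zeta m k) * SRi (SRi (zeta k l)) * M l j x))"
    by (simp add: c_zeta i b_def sum_distrib_left op_sum mult.assoc)
  also have "\<dots> = (\<Sum>m\<in>B. N i m (\<Sum>l\<in>B. (\<Sum>k\<in>B. SRi (zeta m k) * SRi (SRi (zeta k l))) * M l j x))"
    unfolding op_sum sum_distrib_right by (rule sum_rotate3)
  also have "\<dots> = (\<Sum>m\<in>B. N i m (\<Sum>l\<in>B. if l = m then M l j x else 0))"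
    by (intro sum.cong refl arg_cong[of _ _ "N i _"]) (auto simp: zeta_inverse)
  also have "\<dots> = (\<Sum>m\<in>B. N i m (M m j x))"
    using finite_B by simp
  finally show "(\<Sum>k\<in>B. c i k (b k j x)) = (if i = j then x else 0)"
    by (simp add: NM i j)
  have "(\<Sum>k\<in>B. b i k (c k j x)) =
      (\<Sum>k\<in>B. \<Sum>m\<in>B. \<Sum>l\<in>B. SRi (SRi (zeta i m)) * M m k (N k l (SRi (zeta l j) * x)))"
    by (simp add: c_zeta b_def sum_distrib_left op_sum)
  also have "\<dots> = (\<Sum>m\<in>B. \<Sum>l\<in>B. SRi (SRi (zeta i m)) * (\<Sum>k\<in>B. M m k (N k l (SRi (zeta l j) * x))))"
    unfolding sum_distrib_left by (rule sum_rotate3)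
  also have "\<dots> = (\<Sum>m\<in>B. \<Sum>l\<in>B. if l = m then SRi (SRi (zeta i m)) * (SRi (zeta l j) * x) else 0)"
    using MN by (intro sum.cong refl) auto
  also have "\<dots> = (\<Sum>m\<in>B. SRi (SRi (zeta i m)) * SRi (zeta m j)) * x"
    using finite_B by (simp add: sum_distrib_right mult.assoc)
  finally show "(\<Sum>k\<in>B. b i k (c k j x)) = (if i = j then x else 0)"
    by (simp add: zeta_inverse i j)
qed

theorem left_integral_exists:
  assumes f: "lin sR (*) f" "f x0 \<noteq> 0" and image: "\<And>x. R.pc.rslice f x \<in> V.span B"
  shows "\<exists>l. lin sR (*) l \<and> (\<exists>r. l r \<noteq> 0) \<and>
    (\<forall>\<psi> r. lin sR (*) \<psi> \<longrightarrow> ssum (dR r) (\<lambda>u v. \<psi> u * l v) = \<psi> 1 * l r)"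
proof -
  note R.pc.integral_from_matrices[OF comodule_coordinates_comul f image a_comatrix lin_abc(2,3)
    a_c_inverse c_b_inverse a_one]
  then show ?thesis .
qed

end

section \<open>Right integrals\<close>

text \<open>
  Now the span of \<open>B\<close> is a right coideal and a left \<open>H\<close>-subcomodule. The coefficients \<open>\<alpha>\<^sub>i\<^sub>j\<close> belong to the
  co-opposite coalgebra, so \<open>\<Delta>(v\<^sub>i) = \<Sum>\<^sub>j v\<^sub>j \<otimes> \<alpha>\<^sub>i\<^sub>j\<close>. The bosonization coacts on the span from the right:
  as a right comodule over itself, \<open>R\<close> embeds into the bosonization by
  \<open>x \<mapsto> x\<^sub>(\<^sub>0\<^sub>) S\<^sup>-\<^sup>1(x\<^sub>(\<^sub>-\<^sub>1\<^sub>))\<close>, and the image is a right coideal there. This explains the formula for \<open>a\<close>.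
\<close>
locale right_matrix =
  coaction_matrix sH comulH counitH antipodeH sR act coact comul counit antipode SHi SRi B \<kappa>
  for sH :: "'k::field \<Rightarrow> 'h::ring_1 \<Rightarrow> 'h" and comulH counitH antipodeH
    and sR :: "'k \<Rightarrow> 'r::ring_1 \<Rightarrow> 'r" and act coact comul counit antipode SHi SRi B \<kappa> +
  assumes comul_closed: "b \<in> B \<Longrightarrow> lin sR (*) \<phi> \<Longrightarrow> ssum (dR b) (\<lambda>x y. sR (\<phi> y) x) \<in> V.span B"
begin

abbreviation "dRf x \<equiv> map prod.swap (dR x)"

lemma comodule_coordinates_comul: "comodule_coordinates sR dRf counit sR dRf B \<kappa>"
  by (intro comodule_coordinates.intro pair_coalgebra.regular_comodule[OF R.pc.flip]
    comodule_coordinates_axioms.intro coordinates_axioms coordinates.intro)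
    (simp add: ssum_flip comul_closed)

sublocale ac: comodule_coordinates sR dRf counit sR dRf B \<kappa>
  by (rule comodule_coordinates_comul)

abbreviation "al \<equiv> ac.coeff"

lemma al_expand:
  assumes "vector_space t" "i \<in> B" "bilin sR sR t F"
  shows "ssum (dR i) F = (\<Sum>k\<in>B. F k (al i k))"
  using ac.coact_expand[OF assms(1,2), of "\<lambda>x y. F y x"]
  by (simp add: ssum_flip lin_intros bilin_comps[OF assms(3)])

lemma comul_al:
  assumes "vector_space t" "i \<in> B" "j \<in> B" "bilin sR sR t F"
  shows "ssum (dR (al i j)) F = (\<Sum>k\<in>B. F (al k j) (al i k))"
  using ac.comul_coeff[OF assms(1-3), of "\<lambda>x y. F y x"]
  by (simp add: ssum_flip lin_intros bilin_comps[OF assms(4)])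

lemma al_antipode:
  assumes "i \<in> B" "j \<in> B"
  shows "(\<Sum>k\<in>B. al k j * antipode (al i k)) = (if i = j then 1 else 0)"
    and "(\<Sum>k\<in>B. antipode (al k j) * al i k) = (if i = j then 1 else 0)"
  using comul_al[OF R.is_vector_space_alg assms, of "\<lambda>x y. x * antipode y"]
    comul_al[OF R.is_vector_space_alg assms, of "\<lambda>x y. antipode x * y"]
  by (auto simp: lin_intros blins ssum_antipode_left ssum_antipode_right ac.counit_coeff assms
    split: if_splits)

lemma coact_al:
  assumes t: "vector_space t" and F: "bilin sH sR t F" and j: "j \<in> B" and l: "l \<in> B"
  shows "(\<Sum>k\<in>B. F (cc.coeff j k) (al k l)) = (\<Sum>k\<in>B. ssum (dC (al j k)) (\<lambda>g w. F (cc.coeff k l * g) w))"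
proof -
  note delta = sum_coordinate[OF t l]
  note lins = lin_intros bilins \<kappa>_lin lin_comp[OF \<kappa>_lin] t bilin_comps[OF F]
  have T: "trilin sH sR sR t (\<lambda>h a b. t (\<kappa> l a) (F h b))"
    by (intro lins)
  have "(\<Sum>k\<in>B. F (cc.coeff j k) (al k l)) =
      (\<Sum>k\<in>B. \<Sum>b\<in>B. t (\<kappa> l b) (F (cc.coeff j k) (al k b)))"
    by (simp only: delta)
  also have "\<dots> = (\<Sum>k\<in>B. ssum (dR k) (\<lambda>a b. t (\<kappa> l a) (F (cc.coeff j k) b)))"
    by (intro sum.cong refl al_expand[OF t, symmetric]) (assumption, intro lins)
  also have "\<dots> = ssum (dC j) (\<lambda>h w. ssum (dR w) (\<lambda>a b. t (\<kappa> l a) (F h b)))"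
    by (rule cc.coact_expand[OF t j, symmetric]) (intro lins)
  also have "\<dots> = ssum (dR j) (\<lambda>a b. ssum (dC a) (\<lambda>g a0. ssum (dC b) (\<lambda>h b0. t (\<kappa> l a0) (F (g * h) b0))))"
    by (rule ssum_comul_coact[OF t T])
  also have "\<dots> = (\<Sum>k\<in>B. ssum (dC k) (\<lambda>g a0. ssum (dC (al j k)) (\<lambda>h b0. t (\<kappa> l a0) (F (g * h) b0))))"
    by (rule al_expand[OF t j]) (intro lins)
  also have "\<dots> = (\<Sum>k\<in>B. \<Sum>b\<in>B. ssum (dC (al j k)) (\<lambda>h b0. t (\<kappa> l b) (F (cc.coeff k b * h) b0)))"
    by (intro sum.cong refl cc.coact_expand[OF t]) (assumption, intro lins)
  also have "\<dots> = (\<Sum>k\<in>B. ssum (dC (al j k)) (\<lambda>g w. F (cc.coeff k l * g) w))"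
    by (simp only: delta flip: lin_ssum_out[OF lin_scale_right[OF t lin_id]])
  finally show ?thesis .
qed

text \<open>
  \<open>ab i l\<close> are the coefficients of the braiding applied to a comultiplication,
  \<open>v\<^sub>1\<^sub>(\<^sub>-\<^sub>1\<^sub>) \<cdot> v\<^sub>2 \<otimes> v\<^sub>1\<^sub>(\<^sub>0\<^sub>)\<close>.
\<close>
definition "ab i l = (\<Sum>k\<in>B. h k l (al i k))"

definition "a i j x = (\<Sum>k\<in>B. al k j * N i k x)"
definition "c i j x = (\<Sum>l\<in>B. antipode (ab i l) * h l j x)"
definition "b i j x = (\<Sum>p\<in>B. L i p (antipode (antipode (ab p j)) * x))"

lemma lin_abc: "lin sR sR (a i j)" "lin sR sR (c i j)" "lin sR sR (b i j)"
  unfolding a_def c_def b_def by (intro lin_intros bilins opl)+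

lemma a_one: "i \<in> B \<Longrightarrow> j \<in> B \<Longrightarrow> a i j 1 = al i j"
proof -
  assume "i \<in> B" "j \<in> B"
  then have "a i j 1 = (\<Sum>k\<in>B. if k = i then al k j else 0)"
    unfolding a_def by (intro sum.cong refl) (auto simp: N_one)
  then show ?thesis using \<open>i \<in> B\<close> finite_B by simp
qed

text \<open>
  \<open>coact_al\<close> solved for the coaction of \<open>\<alpha>\<close>: multiply by \<open>N\<close> on both sides.
\<close>
lemma coact_al_N:
  assumes F: "bilin sR sR (*) F" and l: "l \<in> B" and p: "p \<in> B"
  shows "(\<Sum>k\<in>B. ssum (dC (al k l)) (\<lambda>g w. F (act g (N p k u)) w)) = (\<Sum>i\<in>B. F (N i l u) (al p i))"
proof -
  note lins = lin_intros bilins opl bilin_comps[OF F]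
  have "(\<Sum>k\<in>B. ssum (dC (al k l)) (\<lambda>g w. F (act g (N p k u)) w)) =
      (\<Sum>k\<in>B. \<Sum>q\<in>B. if q = l then ssum (dC (al k q)) (\<lambda>g w. F (act g (N p k u)) w) else 0)"
    using l finite_B by simp
  also have "\<dots> = (\<Sum>k\<in>B. \<Sum>q\<in>B. ssum (dC (al k q)) (\<lambda>g w. F (\<Sum>i\<in>B. N i l (h q i (act g (N p k u)))) w))"
    using Nh[OF l] by (intro sum.cong refl) (auto simp: lin_zero[OF bilin_left[OF F]])
  also have "\<dots> = (\<Sum>k\<in>B. \<Sum>q\<in>B. \<Sum>i\<in>B. ssum (dC (al k q)) (\<lambda>g w. F (N i l (act (cc.coeff q i * g) (N p k u))) w))"
    by (simp only: lin_sum[OF bilin_left[OF F]] ssum_sum h_def act_mult)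
  also have "\<dots> = (\<Sum>k\<in>B. \<Sum>i\<in>B. \<Sum>q\<in>B. ssum (dC (al k q)) (\<lambda>g w. F (N i l (act (cc.coeff q i * g) (N p k u))) w))"
    by (rule sum_swap_inner)
  also have "\<dots> = (\<Sum>k\<in>B. \<Sum>i\<in>B. \<Sum>q\<in>B. F (N i l (act (cc.coeff k q) (N p k u))) (al q i))"
    by (intro sum.cong refl coact_al[OF vector_space_field, symmetric]) (intro lins, assumption+)
  also have "\<dots> = (\<Sum>i\<in>B. \<Sum>k\<in>B. \<Sum>q\<in>B. F (N i l (h k q (N p k u))) (al q i))"
    unfolding h_def by (rule sum.swap)
  also have "\<dots> = (\<Sum>i\<in>B. \<Sum>q\<in>B. \<Sum>k\<in>B. F (N i l (h k q (N p k u))) (al q i))"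
    by (rule sum_swap_inner)
  also have "\<dots> = (\<Sum>i\<in>B. \<Sum>q\<in>B. F (N i l (\<Sum>k\<in>B. h k q (N p k u))) (al q i))"
    by (simp only: lin_sum[OF bilin_left[OF F]] op_sum)
  also have "\<dots> = (\<Sum>i\<in>B. \<Sum>q\<in>B. if q = p then F (N i l u) (al q i) else 0)"
    using hN p by (intro sum.cong refl) (auto simp: lin_zero[OF bilin_left[OF F]])
  finally show ?thesis using p finite_B by simp
qed

lemma a_comatrix: "ac.H.comatrix B a"
proof -
  have main: "ssum (dR (a i j x)) F = (\<Sum>n\<in>B. ssum (dR x) (\<lambda>u v. F (a n j u) (a i n v)))"
    if F: "bilin sR sR (*) F" and i: "i \<in> B" and j: "j \<in> B" for F i j x
  proof -
    note lins = lin_intros bilins opl bilin_comps[OF F]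
    have DF: "lin sR (*) (\<lambda>x. ssum (dR x) F)" by (intro lins)
    let ?t = "\<lambda>k l p. ssum (dR x) (\<lambda>u v. ssum (dC (al k l)) (\<lambda>g w. F (al l j * act g (N p k u)) (w * N i p v)))"
    let ?t2 = "\<lambda>l n p. ssum (dR x) (\<lambda>u v. F (al l j * N n l u) (al p n * N i p v))"
    have "ssum (dR (a i j x)) F = (\<Sum>k\<in>B. ssum (dR (al k j * N i k x)) F)"
      unfolding a_def by (rule lin_sum[OF DF])
    also have "\<dots> = (\<Sum>k\<in>B. ssum (dR (al k j)) (\<lambda>p q. ssum (dR (N i k x)) (\<lambda>u v.
        ssum (dC q) (\<lambda>g w. F (p * act g u) (w * v)))))"
      by (simp only: ssum_comul_mult[OF vector_space_field F])
    also have "\<dots> = (\<Sum>k\<in>B. \<Sum>l\<in>B. ssum (dR (N i k x)) (\<lambda>u v.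
        ssum (dC (al k l)) (\<lambda>g w. F (al l j * act g u) (w * v))))"
      by (intro sum.cong refl comul_al[OF vector_space_field _ j]) (assumption, intro lins)
    also have "\<dots> = (\<Sum>k\<in>B. \<Sum>l\<in>B. \<Sum>p\<in>B. ?t k l p)"
      by (intro sum.cong refl R.pc.comatrixD[OF N_comatrix _ _ i]) (intro lins, assumption)
    also have "\<dots> = (\<Sum>l\<in>B. \<Sum>p\<in>B. \<Sum>k\<in>B. ?t k l p)"
      by (rule sum_rotate3)
    also have "\<dots> = (\<Sum>l\<in>B. \<Sum>p\<in>B. ssum (dR x) (\<lambda>u v. \<Sum>k\<in>B.
        ssum (dC (al k l)) (\<lambda>g w. F (al l j * act g (N p k u)) (w * N i p v))))"
      by (simp only: ssum_sum)
    also have "\<dots> = (\<Sum>l\<in>B. \<Sum>p\<in>B. ssum (dR x) (\<lambda>u v. \<Sum>n\<in>B.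
        F (al l j * N n l u) (al p n * N i p v)))"
      by (intro sum.cong refl ssum_cong coact_al_N[where F = "\<lambda>u w. F (al _ j * u) (w * N i _ _)"])
        (intro lins, assumption+)
    also have "\<dots> = (\<Sum>l\<in>B. \<Sum>p\<in>B. \<Sum>n\<in>B. ?t2 l n p)"
      by (simp only: ssum_sum)
    also have "\<dots> = (\<Sum>n\<in>B. \<Sum>l\<in>B. \<Sum>p\<in>B. ?t2 l n p)"
      by (rule sum_rotate3[symmetric])
    also have "\<dots> = (\<Sum>n\<in>B. ssum (dR x) (\<lambda>u v. F (a n j u) (a i n v)))"
      by (rule sum.cong[OF refl])
        (simp add: a_def lin_sum[OF bilin_left[OF F]] lin_sum[OF bilin_right[OF F]] ssum_sum, rule sum.swap)
    finally show ?thesis .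
  qed
  show ?thesis
    unfolding ac.H.comatrix_def
  proof (intro conjI allI impI lin_abc)
    fix F :: "'r \<Rightarrow> 'r \<Rightarrow> 'k" and i j x
    assume F: "bilin sR sR (*) F" and ij: "i \<in> B" "j \<in> B"
    have "bilin sR sR (*) (\<lambda>u v. F v u)"
      by (intro lin_intros bilin_comps[OF F])
    from main[OF this ij, of x]
    show "ssum (dRf (a i j x)) F = (\<Sum>k\<in>B. ssum (dRf x) (\<lambda>u v. F (a i k u) (a k j v)))"
      by (simp add: ssum_flip)
  qed
qed

lemma reversed_product_sum:
  assumes \<phi>: "lin sR sR \<phi>" "\<And>g x. \<phi> (act g x) = act g (\<phi> x)"
    "\<And>x F. bilin sH sR sR F \<Longrightarrow> ssum (dC (\<phi> x)) F = ssum (dC x) (\<lambda>g w. F g (\<phi> w))"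
    and k: "k \<in> B" and j: "j \<in> B"
  shows "(\<Sum>l\<in>B. antipode (h k l y) * antipode (\<phi> (ab l j))) =
      (\<Sum>l\<in>B. h l j (antipode (\<phi> (al k l) * y)))"
proof -
  note lins = lin_intros bilins opl lin_comp[OF \<phi>(1)]
  have "(\<Sum>l\<in>B. antipode (h k l y) * antipode (\<phi> (ab l j))) =
      (\<Sum>l\<in>B. \<Sum>m\<in>B. antipode (h k l y) * h m j (antipode (\<phi> (al l m))))"
    by (simp add: ab_def lin_sum[OF \<phi>(1)] lin_sum[OF antipode_lin] sum_distrib_left h_def \<phi>(2) antipode_act)
  also have "\<dots> = (\<Sum>m\<in>B. \<Sum>l\<in>B. antipode (act (cc.coeff k l) y) * h m j (antipode (\<phi> (al l m))))"
    unfolding h_def by (rule sum.swap)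
  also have "\<dots> = (\<Sum>m\<in>B. \<Sum>l\<in>B. ssum (dC (al k l)) (\<lambda>g w.
      antipode (act (cc.coeff l m * g) y) * h m j (antipode (\<phi> w))))"
    by (intro sum.cong refl coact_al[OF R.is_vector_space_alg _ k]) (intro lins)
  also have "\<dots> = (\<Sum>l\<in>B. \<Sum>m\<in>B. ssum (dC (al k l)) (\<lambda>g w.
      h l m (antipode (act g y)) * h m j (antipode (\<phi> w))))"
    unfolding act_mult h_def antipode_act by (rule sum.swap)
  also have "\<dots> = (\<Sum>l\<in>B. ssum (dC (al k l)) (\<lambda>g w. h l j (antipode (act g y) * antipode (\<phi> w))))"
    by (simp add: h_mult j ssum_sum)
  also have "\<dots> = (\<Sum>l\<in>B. h l j (antipode (\<phi> (al k l) * y)))"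
  proof (rule sum.cong[OF refl])
    fix l
    have "antipode (\<phi> (al k l) * y) = ssum (dC (al k l)) (\<lambda>g w. antipode (act g y) * antipode (\<phi> w))"
      unfolding antipode_mult by (rule \<phi>(3)) (intro lins)
    then show "ssum (dC (al k l)) (\<lambda>g w. h l j (antipode (act g y) * antipode (\<phi> w))) =
        h l j (antipode (\<phi> (al k l) * y))"
      by (simp add: lin_ssum_out[OF lin_ops(1)])
  qed
  finally show ?thesis .
qed

lemmas reversed_product_sum_id = reversed_product_sum[of "\<lambda>x. x", OF lin_id refl refl]
lemmas reversed_product_sum_antipode = reversed_product_sum[OF antipode_lin antipode_act ssum_coact_antipode[OF R.is_vector_space_alg]]

lemma antipode_ab: "antipode (ab i l) = (\<Sum>k\<in>B. antipode (h k l (al i k)))"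
  by (simp add: ab_def lin_sum[OF antipode_lin])

text \<open>
  By \<open>antipode_mult\<close> these are antipodes of \<open>S(x\<^sub>1) x\<^sub>2\<close> and \<open>x\<^sub>1 S(x\<^sub>2)\<close> in coordinates.
\<close>
lemma ab_inverse:
  assumes i: "i \<in> B" and j: "j \<in> B"
  shows "(\<Sum>l\<in>B. antipode (ab i l) * antipode (antipode (ab l j))) = (if i = j then 1 else 0)"
    and "(\<Sum>l\<in>B. antipode (antipode (ab i l)) * antipode (ab l j)) = (if i = j then 1 else 0)"
proof -
  have delta: "(\<Sum>l\<in>B. h l j (if i = l then 1 else 0)) = (if i = j then 1 else 0)"
  proof -
    have "(\<Sum>l\<in>B. h l j (if i = l then 1 else 0)) = (\<Sum>l\<in>B. if l = i then h l j 1 else 0)"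
      by (intro sum.cong) auto
    then show ?thesis using i j finite_B by (simp add: h_one)
  qed
  have S_if: "antipode (if P then 1 else 0) = (if P then 1 else 0)" for P
    by (simp add: antipode_one lin_zero[OF antipode_lin])
  have "(\<Sum>l\<in>B. antipode (ab i l) * antipode (antipode (ab l j))) =
      (\<Sum>l\<in>B. \<Sum>k\<in>B. antipode (h k l (al i k)) * antipode (antipode (ab l j)))"
    by (simp add: antipode_ab[of i] sum_distrib_right)
  also have "\<dots> = (\<Sum>k\<in>B. \<Sum>l\<in>B. antipode (h k l (al i k)) * antipode (antipode (ab l j)))"
    by (rule sum.swap)
  also have "\<dots> = (\<Sum>k\<in>B. \<Sum>l\<in>B. h l j (antipode (antipode (al k l) * al i k)))"
    by (intro sum.cong refl reversed_product_sum_antipode j)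
  also have "\<dots> = (\<Sum>l\<in>B. h l j (antipode (\<Sum>k\<in>B. antipode (al k l) * al i k)))"
    unfolding lin_sum[OF antipode_lin] op_sum by (rule sum.swap)
  finally show "(\<Sum>l\<in>B. antipode (ab i l) * antipode (antipode (ab l j))) = (if i = j then 1 else 0)"
    by (simp add: al_antipode i S_if delta)
  have "(\<Sum>l\<in>B. antipode (antipode (ab i l)) * antipode (ab l j)) =
      (\<Sum>l\<in>B. \<Sum>k\<in>B. antipode (h k l (antipode (al i k))) * antipode (ab l j))"
    by (simp add: antipode_ab[of i] lin_sum[OF antipode_lin] sum_distrib_right ops_commute)
  also have "\<dots> = (\<Sum>k\<in>B. \<Sum>l\<in>B. antipode (h k l (antipode (al i k))) * antipode (ab l j))"
    by (rule sum.swap)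
  also have "\<dots> = (\<Sum>k\<in>B. \<Sum>l\<in>B. h l j (antipode (al k l * antipode (al i k))))"
    by (intro sum.cong refl reversed_product_sum_id j)
  also have "\<dots> = (\<Sum>l\<in>B. h l j (antipode (\<Sum>k\<in>B. al k l * antipode (al i k))))"
    unfolding lin_sum[OF antipode_lin] op_sum by (rule sum.swap)
  finally show "(\<Sum>l\<in>B. antipode (antipode (ab i l)) * antipode (ab l j)) = (if i = j then 1 else 0)"
    by (simp add: al_antipode i S_if delta)
qed

lemma ab_cancel:
  assumes m: "m \<in> B" and p: "p \<in> B"
  shows "(\<Sum>k\<in>B. \<Sum>l\<in>B. antipode (ab k l) * h l p (al m k)) = (if m = p then 1 else 0)"
proof -
  have "(\<Sum>k\<in>B. \<Sum>l\<in>B. antipode (ab k l) * h l p (al m k)) =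
      (\<Sum>k\<in>B. \<Sum>l\<in>B. \<Sum>q\<in>B. h q l (antipode (al k q)) * h l p (al m k))"
    by (simp add: antipode_ab ops_commute sum_distrib_right)
  also have "\<dots> = (\<Sum>k\<in>B. \<Sum>q\<in>B. \<Sum>l\<in>B. h q l (antipode (al k q)) * h l p (al m k))"
    by (rule sum_swap_inner)
  also have "\<dots> = (\<Sum>k\<in>B. \<Sum>q\<in>B. h q p (antipode (al k q) * al m k))"
    using p by (intro sum.cong refl h_mult[symmetric])
  also have "\<dots> = (\<Sum>q\<in>B. h q p (\<Sum>k\<in>B. antipode (al k q) * al m k))"
    unfolding op_sum by (rule sum.swap)
  also have "\<dots> = (\<Sum>q\<in>B. if q = m then h q p 1 else 0)"
    using m by (intro sum.cong refl) (auto simp: al_antipode)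
  finally show ?thesis using m p finite_B by (simp add: h_one)
qed

lemma a_c_inverse: "op_inverse B (\<lambda>i j. a j i) (\<lambda>i j. c j i)"
  unfolding op_inverse_def
proof (intro ballI allI conjI)
  fix j i x assume i: "i \<in> B" and j: "j \<in> B"
  have N_ab: "(\<Sum>l\<in>B. N l m (antipode (ab i l))) = antipode (al i m)" if m: "m \<in> B" for m
  proof -
    have "(\<Sum>l\<in>B. N l m (antipode (ab i l))) = (\<Sum>k\<in>B. \<Sum>l\<in>B. N l m (h k l (antipode (al i k))))"
      unfolding antipode_ab ops_commute op_sum by (rule sum.swap)
    also have "\<dots> = (\<Sum>k\<in>B. if k = m then antipode (al i k) else 0)"
      using Nh m by (intro sum.cong refl) auto
    finally show ?thesis using m finite_B by simp
  qed
  let ?t = "\<lambda>k l m p. al m j * (N p m (antipode (ab i l)) * N k p (h l k x))"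
  have "(\<Sum>k\<in>B. a k j (c i k x)) =
      (\<Sum>k\<in>B. \<Sum>m\<in>B. \<Sum>l\<in>B. \<Sum>p\<in>B. ?t k l m p)"
    unfolding a_def c_def op_sum
    by (intro sum.cong refl) (simp add: N_mult sum_distrib_left)
  also have "\<dots> = (\<Sum>m\<in>B. \<Sum>l\<in>B. \<Sum>p\<in>B. \<Sum>k\<in>B. ?t k l m p)"
    by (rule sum_rotate4)
  also have "\<dots> = (\<Sum>m\<in>B. \<Sum>l\<in>B. \<Sum>p\<in>B. al m j * (N p m (antipode (ab i l)) * (\<Sum>k\<in>B. N k p (h l k x))))"
    by (simp add: sum_distrib_left)
  also have "\<dots> = (\<Sum>m\<in>B. \<Sum>l\<in>B. \<Sum>p\<in>B. if p = l then al m j * (N p m (antipode (ab i l)) * x) else 0)"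
    using Nh by (intro sum.cong refl) auto
  also have "\<dots> = (\<Sum>m\<in>B. al m j * ((\<Sum>l\<in>B. N l m (antipode (ab i l))) * x))"
    using finite_B by (simp add: sum_distrib_left sum_distrib_right)
  also have "\<dots> = (\<Sum>m\<in>B. al m j * antipode (al i m)) * x"
    by (simp add: N_ab sum_distrib_right mult.assoc)
  finally show "(\<Sum>k\<in>B. a k j (c i k x)) = (if j = i then x else 0)"
    by (auto simp: al_antipode i j)
next
  fix j i x assume i: "i \<in> B" and j: "j \<in> B"
  let ?t2 = "\<lambda>k l m p. antipode (ab k l) * (h l p (al m k) * h p j (N i m x))"
  have "(\<Sum>k\<in>B. c k j (a i k x)) =
      (\<Sum>k\<in>B. \<Sum>l\<in>B. \<Sum>m\<in>B. \<Sum>p\<in>B. ?t2 k l m p)"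
    unfolding a_def c_def op_sum
    by (intro sum.cong refl) (simp add: h_mult j sum_distrib_left)
  also have "\<dots> = (\<Sum>m\<in>B. \<Sum>p\<in>B. \<Sum>k\<in>B. \<Sum>l\<in>B. ?t2 k l m p)"
    by (rule sum_swap_pairs)
  also have "\<dots> = (\<Sum>m\<in>B. \<Sum>p\<in>B. (\<Sum>k\<in>B. \<Sum>l\<in>B. antipode (ab k l) * h l p (al m k)) * h p j (N i m x))"
    by (simp add: sum_distrib_right mult.assoc)
  also have "\<dots> = (\<Sum>m\<in>B. \<Sum>p\<in>B. if p = m then h p j (N i m x) else 0)"
    by (intro sum.cong refl) (auto simp: ab_cancel)
  also have "\<dots> = (\<Sum>m\<in>B. h m j (N i m x))"
    using finite_B by simp
  finally show "(\<Sum>k\<in>B. c k j (a i k x)) = (if j = i then x else 0)"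
    using hN[OF j i] by simp
qed

lemma c_b_inverse: "op_inverse B c b"
  unfolding op_inverse_def
proof (intro ballI allI conjI)
  fix i j x assume i: "i \<in> B" and j: "j \<in> B"
  have "(\<Sum>k\<in>B. c i k (b k j x)) =
      (\<Sum>k\<in>B. \<Sum>l\<in>B. \<Sum>p\<in>B. antipode (ab i l) * h l k (L k p (antipode (antipode (ab p j)) * x)))"
    by (simp add: c_def b_def op_sum sum_distrib_left)
  also have "\<dots> = (\<Sum>l\<in>B. \<Sum>p\<in>B. antipode (ab i l) * (\<Sum>k\<in>B. h l k (L k p (antipode (antipode (ab p j)) * x))))"
    unfolding sum_distrib_left by (rule sum_rotate3)
  also have "\<dots> = (\<Sum>l\<in>B. \<Sum>p\<in>B. if p = l then antipode (ab i l) * (antipode (antipode (ab p j)) * x) else 0)"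
    using hL by (intro sum.cong refl) auto
  also have "\<dots> = (\<Sum>l\<in>B. antipode (ab i l) * antipode (antipode (ab l j))) * x"
    using finite_B by (simp add: sum_distrib_right mult.assoc)
  finally show "(\<Sum>k\<in>B. c i k (b k j x)) = (if i = j then x else 0)"
    by (simp add: ab_inverse i j)
  have "(\<Sum>k\<in>B. b i k (c k j x)) =
      (\<Sum>k\<in>B. \<Sum>p\<in>B. \<Sum>l\<in>B. L i p (antipode (antipode (ab p k)) * antipode (ab k l) * h l j x))"
    by (simp add: c_def b_def op_sum sum_distrib_left mult.assoc)
  also have "\<dots> = (\<Sum>p\<in>B. L i p (\<Sum>l\<in>B. (\<Sum>k\<in>B. antipode (antipode (ab p k)) * antipode (ab k l)) * h l j x))"
    unfolding op_sum sum_distrib_right by (rule sum_rotate3)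
  also have "\<dots> = (\<Sum>p\<in>B. L i p (\<Sum>l\<in>B. if l = p then h l j x else 0))"
    by (intro sum.cong refl arg_cong[of _ _ "L i _"]) (auto simp: ab_inverse)
  also have "\<dots> = (\<Sum>p\<in>B. L i p (h p j x))"
    using finite_B by simp
  finally show "(\<Sum>k\<in>B. b i k (c k j x)) = (if i = j then x else 0)"
    by (simp add: Lh i j)
qed

theorem right_integral_exists:
  assumes f: "lin sR (*) f" "f x0 \<noteq> 0" and image: "\<And>x. R.pc.lslice f x \<in> V.span B"
  shows "\<exists>l. lin sR (*) l \<and> (\<exists>r. l r \<noteq> 0) \<and>
    (\<forall>\<psi> r. lin sR (*) \<psi> \<longrightarrow> ssum (dR r) (\<lambda>u v. l u * \<psi> v) = \<psi> 1 * l r)"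
proof -
  have "ac.H.rslice f x = R.pc.lslice f x" for x
    by (simp add: ac.H.rslice_def R.pc.lslice_def ssum_flip)
  then have "ac.H.rslice f x \<in> V.span B" for x
    using image by simp
  from ac.H.integral_from_matrices[OF comodule_coordinates_comul f this a_comatrix lin_abc(2,3)
    a_c_inverse c_b_inverse a_one]
  show ?thesis by (simp add: ssum_flip mult.commute)
qed

end

section \<open>From a finite coradical filtration to integrals\<close>

context bijective_braided_hopf_algebra begin

definition coslice :: "('h \<Rightarrow> 'k) \<Rightarrow> 'r \<Rightarrow> 'r"
  where "coslice \<phi> v = ssum (dC v) (\<lambda>h w. sR (\<phi> h) w)"

lemma lin_coslice: "lin sH (*) \<phi> \<Longrightarrow> lin sR sR (coslice \<phi>)"
  unfolding coslice_def by (intro lin_intros bilins)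

text \<open>
  The elements \<open>\<phi>(v\<^sub>(\<^sub>-\<^sub>1\<^sub>)) v\<^sub>(\<^sub>0\<^sub>)\<close> span the \<open>H\<close>-subcomodule generated by \<open>V\<close>. It remains a subcoalgebra
  because the comultiplication of \<open>R\<close> is a comodule map: a slice of such an element is a sum of
  elements of the same kind, with other forms in place of \<open>\<phi>\<close>.
\<close>
lemma coaction_hull:
  assumes V: "R.pc.stable V" and X: "finite X" "V \<subseteq> V.span X"
  shows "\<exists>B \<kappa>. coordinates sR B \<kappa> \<and> V \<subseteq> V.span B \<and>
    (\<forall>b\<in>B. \<forall>\<phi>. lin sH (*) \<phi> \<longrightarrow> coslice \<phi> b \<in> V.span B) \<and>
    (\<forall>b\<in>B. \<forall>\<psi>. lin sR (*) \<psi> \<longrightarrow> R.pc.lslice \<psi> b \<in> V.span B \<and> R.pc.rslice \<psi> b \<in> V.span B)"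
proof -
  obtain B \<kappa> where B: "coordinates sR B \<kappa>" "V = V.span B"
    using coordinates_exist[OF R.is_vector_space_alg R.pc.stable_subspace[OF V] X] by blast
  interpret B: coordinates sR B \<kappa> by (rule B(1))
  have BV: "b \<in> V" if "b \<in> B" for b using that B(2) V.span_base by blast
  interpret lc: comodule_coordinates sR dR counit sR dR B \<kappa>
    using R.pc.stable_lslice[OF V _ BV] unfolding R.pc.lslice_def B(2)
    by (intro comodule_coordinates.intro R.pc.regular_comodule comodule_coordinates_axioms.intro B(1))
  interpret rc: comodule_coordinates sR "\<lambda>x. map prod.swap (dR x)" counit sR "\<lambda>x. map prod.swap (dR x)" B \<kappa>
    using R.pc.stable_rslice[OF V _ BV] unfolding R.pc.rslice_def B(2)
    by (intro comodule_coordinates.intro pair_coalgebra.regular_comodule[OF R.pc.flip]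
      comodule_coordinates_axioms.intro B(1)) (simp add: ssum_flip)
  let ?Y = "{coslice \<phi> b | \<phi> b. lin sH (*) \<phi> \<and> b \<in> B}"
  let ?W = "V.span ?Y"
  have WI: "coslice \<phi> b \<in> ?W" if "lin sH (*) \<phi>" "b \<in> B" for \<phi> b
    using that by (intro V.span_base) blast
  have "b \<in> ?W" if "b \<in> B" for b
    using WI[OF H.counit_lin that] com.coact_counit_vec[OF R.is_vector_space_alg lin_id, of b] by (simp add: coslice_def)
  then have VW: "V \<subseteq> ?W" unfolding B(2) by (intro V.span_minimal) auto
  have fin: "?W \<subseteq> V.span (\<Union>b\<in>B. snd ` set (dC b))" (is "_ \<subseteq> V.span ?Z")
  proof (rule V.span_minimal)
    show "?Y \<subseteq> V.span ?Z"
    proof safe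
      fix \<phi> b assume "b \<in> B"
      then show "coslice \<phi> b \<in> V.span ?Z"
        unfolding coslice_def
        by (intro R.pc.ssum_in_subspace V.span_scale V.span_base) (auto intro!: rev_bexI[of b] image_eqI)
    qed
  qed simp
  have "finite ?Z" using B.finite_B by simp
  then obtain B' \<kappa>' where B': "coordinates sR B' \<kappa>'" "?W = V.span B'"
    using coordinates_exist[OF R.is_vector_space_alg _ _ fin] by blast
  have closed: "F z \<in> ?W" if F: "lin sR sR F" and gen: "\<And>\<phi> b. lin sH (*) \<phi> \<Longrightarrow> b \<in> B \<Longrightarrow> F (coslice \<phi> b) \<in> ?W"
    and z: "z \<in> B'" for F z
  proof (rule R.pc.lin_image_span[OF F])
    show "z \<in> ?W" using z B'(2) V.span_base by blast
  qed (use gen in blast)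
  have 1: "coslice \<chi> z \<in> ?W" if \<chi>: "lin sH (*) \<chi>" and z: "z \<in> B'" for \<chi> z
  proof (rule closed[OF lin_coslice[OF \<chi>] _ z])
    fix \<phi> b assume \<phi>: "lin sH (*) \<phi>" and b: "b \<in> B"
    have "coslice \<chi> (coslice \<phi> b) = ssum (dC b) (\<lambda>h w. ssum (dC w) (\<lambda>g u. sR (\<phi> h * \<chi> g) u))"
      unfolding coslice_def[of \<phi>] lin_ssum_out[OF lin_coslice[OF \<chi>]] lin_scale[OF lin_coslice[OF \<chi>]]
      by (simp add: coslice_def lin_ssum_out[OF lin_scale_right[OF R.is_vector_space_alg lin_id]])
    also have "\<dots> = ssum (dC b) (\<lambda>h w. ssum (dH h) (\<lambda>h1 h2. sR (\<phi> h1 * \<chi> h2) w))"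
      by (rule com.coact_coassoc_vec[OF R.is_vector_space_alg, symmetric])
        (intro lin_intros bilins lin_comp[OF \<phi>] lin_comp[OF \<chi>])
    also have "\<dots> = coslice (H.pc.conv \<phi> \<chi>) b"
      by (simp add: coslice_def H.pc.conv_def lin_ssum_out[OF lin_scale_left[OF R.is_vector_space_alg lin_id]])
    finally show "coslice \<chi> (coslice \<phi> b) \<in> ?W"
      using WI[OF H.pc.lin_conv[OF \<phi> \<chi>] b] by simp
  qed
  have 2: "R.pc.lslice \<psi> z \<in> ?W" if \<psi>: "lin sR (*) \<psi>" and z: "z \<in> B'" for \<psi> z
  proof (rule closed[OF R.pc.lin_lslice[OF \<psi>] _ z])
    fix \<phi> b assume \<phi>: "lin sH (*) \<phi>" and b: "b \<in> B"
    note lins = lin_intros bilins lin_comp[OF \<phi>] lin_comp[OF \<psi>]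
    have "R.pc.lslice \<psi> (coslice \<phi> b) = ssum (dC b) (\<lambda>h w. ssum (dR w) (\<lambda>x y. sR (\<phi> h * \<psi> x) y))"
      unfolding coslice_def lin_ssum_out[OF R.pc.lin_lslice[OF \<psi>]] lin_scale[OF R.pc.lin_lslice[OF \<psi>]]
      by (simp add: R.pc.lslice_def lin_ssum_out[OF lin_scale_right[OF R.is_vector_space_alg lin_id]])
    also have "\<dots> = ssum (dR b) (\<lambda>x y. ssum (dC x) (\<lambda>g x0. ssum (dC y) (\<lambda>h y0. sR (\<phi> (g * h) * \<psi> x0) y0)))"
      by (rule ssum_comul_coact[OF R.is_vector_space_alg]) (intro lins)
    also have "\<dots> = (\<Sum>k\<in>B. ssum (dC (lc.coeff b k)) (\<lambda>g x0. ssum (dC k) (\<lambda>h y0. sR (\<phi> (g * h) * \<psi> x0) y0)))"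
      by (rule lc.coact_expand[OF R.is_vector_space_alg b]) (intro lins)
    also have "\<dots> = (\<Sum>k\<in>B. coslice (\<lambda>h. ssum (dC (lc.coeff b k)) (\<lambda>g x0. \<phi> (g * h) * \<psi> x0)) k)"
    proof (rule sum.cong[OF refl])
      fix k
      show "ssum (dC (lc.coeff b k)) (\<lambda>g x0. ssum (dC k) (\<lambda>h y0. sR (\<phi> (g * h) * \<psi> x0) y0)) =
          coslice (\<lambda>h. ssum (dC (lc.coeff b k)) (\<lambda>g x0. \<phi> (g * h) * \<psi> x0)) k"
        unfolding coslice_def lin_ssum_out[OF lin_scale_left[OF R.is_vector_space_alg lin_id]] by (rule ssum_swap)
    qed
    finally show "R.pc.lslice \<psi> (coslice \<phi> b) \<in> ?W"
      by (simp only:) (intro V.span_sum WI lins, assumption)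
  qed
  have 3: "R.pc.rslice \<psi> z \<in> ?W" if \<psi>: "lin sR (*) \<psi>" and z: "z \<in> B'" for \<psi> z
  proof (rule closed[OF R.pc.lin_rslice[OF \<psi>] _ z])
    fix \<phi> b assume \<phi>: "lin sH (*) \<phi>" and b: "b \<in> B"
    note lins = lin_intros bilins lin_comp[OF \<phi>] lin_comp[OF \<psi>]
    have "R.pc.rslice \<psi> (coslice \<phi> b) = ssum (dC b) (\<lambda>h w. ssum (dR w) (\<lambda>x y. sR (\<phi> h * \<psi> y) x))"
      unfolding coslice_def lin_ssum_out[OF R.pc.lin_rslice[OF \<psi>]] lin_scale[OF R.pc.lin_rslice[OF \<psi>]]
      by (simp add: R.pc.rslice_def lin_ssum_out[OF lin_scale_right[OF R.is_vector_space_alg lin_id]])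
    also have "\<dots> = ssum (dR b) (\<lambda>x y. ssum (dC x) (\<lambda>g x0. ssum (dC y) (\<lambda>h y0. sR (\<phi> (g * h) * \<psi> y0) x0)))"
      by (rule ssum_comul_coact[OF R.is_vector_space_alg]) (intro lins)
    also have "\<dots> = ssum (map prod.swap (dR b)) (\<lambda>y x. ssum (dC x) (\<lambda>g x0. ssum (dC y) (\<lambda>h y0. sR (\<phi> (g * h) * \<psi> y0) x0)))"
      by (simp add: ssum_flip)
    also have "\<dots> = (\<Sum>k\<in>B. ssum (dC k) (\<lambda>g x0. ssum (dC (rc.coeff b k)) (\<lambda>h y0. sR (\<phi> (g * h) * \<psi> y0) x0)))"
      by (rule rc.coact_expand[OF R.is_vector_space_alg b]) (intro lins)
    also have "\<dots> = (\<Sum>k\<in>B. coslice (\<lambda>g. ssum (dC (rc.coeff b k)) (\<lambda>h y0. \<phi> (g * h) * \<psi> y0)) k)"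
      by (simp add: coslice_def lin_ssum_out[OF lin_scale_left[OF R.is_vector_space_alg lin_id]])
    finally show "R.pc.rslice \<psi> (coslice \<phi> b) \<in> ?W"
      by (simp only:) (intro V.span_sum WI lins, assumption)
  qed
  show ?thesis
    using B' VW 1 2 3 by (intro exI[of _ B'] exI[of _ \<kappa>']) auto
qed

theorem co_frobenius_if_finite_coradical_filtration:
  assumes "finite_coradical_filtration sR comul"
  shows "co_frobenius sR comul"
proof -
  have one: "counit 1 \<noteq> 0" by (simp add: counit_one)
  obtain f x0 where f: "lin sR (*) f" "f x0 \<noteq> 0" and kill:
    "\<And>g. R.radical_form g \<Longrightarrow> R.pc.conv g f = (\<lambda>x. 0) \<and> R.pc.conv f g = (\<lambda>x. 0)"
    using R.radical_annihilated_form[OF assms one] by blast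
  have linear: "Vector_Spaces.linear sR (*) g \<longleftrightarrow> lin sR (*) g" for g :: "'r \<Rightarrow> 'k"
    by (rule linear_iff_lin[OF R.is_vector_space_alg vector_space_field])
  have conv: "convolution comul p q x = ssum (dR x) (\<lambda>u v. p u * q v)"
    if "lin sR (*) p" "lin sR (*) q" for p q x
    unfolding convolution_def by (rule contract_eq_ssum[of sR sR]) (intro lin_intros that)
  have left: "\<exists>l. lin sR (*) l \<and> (\<exists>r. l r \<noteq> 0) \<and>
    (\<forall>\<psi> r. lin sR (*) \<psi> \<longrightarrow> ssum (dR r) (\<lambda>u v. \<psi> u * l v) = \<psi> 1 * l r)"
  proof -
    obtain f' V X x where f': "lin sR (*) f'" "f' x \<noteq> 0" and V: "R.pc.stable V" "finite X" "V \<subseteq> V.span X"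
      and image: "\<And>x. R.pc.rslice f' x \<in> V"
      using R.pc.finite_image_functional[OF f] kill by (auto simp: R.radical_form_def)
    obtain B \<kappa> where B: "coordinates sR B \<kappa>" "V \<subseteq> V.span B"
      "\<And>b \<phi>. b \<in> B \<Longrightarrow> lin sH (*) \<phi> \<Longrightarrow> coslice \<phi> b \<in> V.span B"
      "\<And>b \<psi>. b \<in> B \<Longrightarrow> lin sR (*) \<psi> \<Longrightarrow> R.pc.lslice \<psi> b \<in> V.span B"
      using coaction_hull[OF V] by blast
    interpret coordinates sR B \<kappa> by (rule B(1))
    interpret left_matrix sH comulH counitH antipodeH sR act coact comul counit antipode SHi SRi B \<kappa>
      by unfold_locales (use B(3,4) in \<open>auto simp: coslice_def R.pc.lslice_def\<close>)
    show ?thesis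
      using left_integral_exists[OF f'] image B(2) by blast
  qed
  have right: "\<exists>l. lin sR (*) l \<and> (\<exists>r. l r \<noteq> 0) \<and>
    (\<forall>\<psi> r. lin sR (*) \<psi> \<longrightarrow> ssum (dR r) (\<lambda>u v. l u * \<psi> v) = \<psi> 1 * l r)"
  proof -
    obtain f' V X x where f': "lin sR (*) f'" "f' x \<noteq> 0" and V: "R.pc.stable V" "finite X" "V \<subseteq> V.span X"
      and image: "\<And>x. R.pc.lslice f' x \<in> V"
      using R.pc.finite_image_functional_right[OF f] kill by (auto simp: R.radical_form_def)
    obtain B \<kappa> where B: "coordinates sR B \<kappa>" "V \<subseteq> V.span B"
      "\<And>b \<phi>. b \<in> B \<Longrightarrow> lin sH (*) \<phi> \<Longrightarrow> coslice \<phi> b \<in> V.span B"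
      "\<And>b \<psi>. b \<in> B \<Longrightarrow> lin sR (*) \<psi> \<Longrightarrow> R.pc.rslice \<psi> b \<in> V.span B"
      using coaction_hull[OF V] by blast
    interpret coordinates sR B \<kappa> by (rule B(1))
    interpret right_matrix sH comulH counitH antipodeH sR act coact comul counit antipode SHi SRi B \<kappa>
      by unfold_locales (use B(3,4) in \<open>auto simp: coslice_def R.pc.rslice_def\<close>)
    show ?thesis
      using right_integral_exists[OF f'] image B(2) by blast
  qed
  obtain l r where l: "lin sR (*) l" "l r \<noteq> 0"
    "\<forall>\<psi> r. lin sR (*) \<psi> \<longrightarrow> ssum (dR r) (\<lambda>u v. \<psi> u * l v) = \<psi> 1 * l r"
    using left by (elim exE conjE)
  then have "left_integral sR comul l"
    by (simp add: left_integral_def linear conv fun_eq_iff)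
  moreover have "l \<noteq> (\<lambda>x. 0)" using l(2) by auto
  ultimately have "left_co_frobenius sR comul"
    unfolding left_co_frobenius_def by blast
  obtain l r where l: "lin sR (*) l" "l r \<noteq> 0"
    "\<forall>\<psi> r. lin sR (*) \<psi> \<longrightarrow> ssum (dR r) (\<lambda>u v. l u * \<psi> v) = \<psi> 1 * l r"
    using right by (elim exE conjE)
  then have "right_integral sR comul l"
    by (simp add: right_integral_def linear conv fun_eq_iff)
  moreover have "l \<noteq> (\<lambda>x. 0)" using l(2) by auto
  ultimately have "right_co_frobenius sR comul"
    unfolding right_co_frobenius_def by blast
  with \<open>left_co_frobenius sR comul\<close> show ?thesis
    by (simp add: co_frobenius_def)
qed

end

theorem lemma2p4:
  fixes sH :: "'k::field \<Rightarrow> 'h::ring_1 \<Rightarrow> 'h"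
    and comulH :: "'h \<Rightarrow> ('h \<times> 'h \<Rightarrow>\<^sub>0 int) set"
    and counitH :: "'h \<Rightarrow> 'k"
    and antipodeH :: "'h \<Rightarrow> 'h"
    and sR :: "'k \<Rightarrow> 'r::ring_1 \<Rightarrow> 'r"
    and act :: "'h \<Rightarrow> 'r \<Rightarrow> 'r"
    and coact :: "'r \<Rightarrow> ('h \<times> 'r \<Rightarrow>\<^sub>0 int) set"
    and comulR :: "'r \<Rightarrow> ('r \<times> 'r \<Rightarrow>\<^sub>0 int) set"
    and counitR :: "'r \<Rightarrow> 'k"
    and antipodeR :: "'r \<Rightarrow> 'r"
  assumes "hopf_algebra sH comulH counitH antipodeH"
    and "bij antipodeH"
    and "braided_hopf_algebra sH comulH counitH antipodeH sR act coact comulR counitR antipodeR"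
    and "bij antipodeR"
    and "finite_coradical_filtration sR comulR"
  shows "co_frobenius sR comulR"
proof -
  interpret bijective_braided_hopf_algebra sH comulH counitH antipodeH sR act coact comulR counitR
    antipodeR "inv antipodeH" "inv antipodeR"
    using assms(2-4)
    by (simp add: bijective_braided_hopf_algebra_def bijective_braided_hopf_algebra_axioms_def
      bij_is_inj bij_is_surj surj_f_inv_f)
  show ?thesis
    by (rule co_frobenius_if_finite_coradical_filtration) (rule assms(5))
qed

end
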